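(* Let $\pi_1:V_1\to X_1$ and $\pi_2:V_2\to X_2$ be two finite-dimensional diffeological vector pseudo-bundles, let $(\tilde f,f)$ be a gluing between them, where $f:X_1\supseteq Y\to f(Y)\subseteq X_2$ and $\tilde f:\pi_1^{-1}(Y)\to\pi_2^{-1}(f(Y))$, such that $\tilde f$ is a diffeomorphism, and let $g_1$ and $g_2$ be pseudo-metrics on $V_1$ and $V_2$ compatible with this gluing. Let $\pi_i^{C\ell}:C\ell(V_i,g_i)\to X_i$, $i=1,2$, be the corresponding pseudo-bundles of Clifford algebras. Let $\tilde F^{C\ell}:(\pi_1^{C\ell})^{-1}(Y)\to(\pi_2^{C\ell})^{-1}(f(Y))$ be the map over $f$ induced by $\tilde f$, and let $\tilde g$ be the pseudo-metric on $\pi_1\cup_{(\tilde f,f)}\pi_2:V_1\cup_{\tilde f}V_2\to X_1\cup_fX_2$ induced by $g_1$ and $g_2$. Then the following two pseudo-bundles are diffeomorphic: $$\pi_1^{C\ell}\cup_{(\tilde F^{C\ell},f)}\pi_2^{C\ell}:C\ell(V_1,g_1)\cup_{\tilde F^{C\ell}}C\ell(V_2,g_2)\to X_1\cup_fX_2$$ and $$(\pi_1\cup_{(\tilde f,f)}\pi_2)^{C\ell}:C\ell(V_1\cup_{\tilde f}V_2,\tilde g)\to X_1\cup_fX_2.$$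
   Context: **Diffeology.** A diffeology on a set $X$ is a collection of maps $U\to X$ (plots), $U$ open in $\mathbb R^n$, $n\in\mathbb N$, containing all constant maps, closed under precomposition with smooth maps between domains, and such that any map that is locally a plot is a plot. A map is smooth if its composition with every plot is a plot; a diffeomorphism is a smooth bijection with smooth inverse. Subset diffeology: plots with range in the subset. Product diffeology: componentwise plots. Disjoint union diffeology: maps locally given by plots of one component. Quotient (pushforward) diffeology along a surjection $\pi$: maps locally of the form $\pi\circ p$, $p$ a plot. A diffeological vector space is a real vector space with a diffeology for which addition and scalar multiplication are smooth ($\mathbb R$ having the standard diffeology, i.e. all usual smooth maps). Its diffeological dual is the space of smooth linear functionals. **Pseudo-bundles.** A diffeological vector pseudo-bundle is a smooth surjection $\pi:V\to X$ of diffeological spaces with a real vector space structure on each fibre $\pi^{-1}(x)$ such that fibrewise addition $V\times_XV\to V$, fibrewise scalar multiplication $\mathbb R\times V\to V$ and the zero section $X\to V$ are smooth. It is finite-dimensional if all fibres are (fibre dimensions may vary). Two pseudo-bundles over the same base $X$ are diffeomorphic if there is a diffeomorphism of the total spaces, linear on fibres, covering the identity of $X$. The dual pseudo-bundle $V^*=\bigcup_x(\pi^{-1}(x))^*$ (diffeological duals) has as plots those $p:U\to V^*$ such that for every plot $q:U'\to V$ the map $(u,u')\mapsto p(u)(q(u'))$ is smooth on $\{(u,u'):\ p(u)\text{ and }q(u')\text{ lie over the same point of }X\}\subseteq U\times U'$ with the subset diffeology. The tensor product of pseudo-bundles over $X$ is the union of the tensor products of the fibres; its plots are the maps that locally, over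 a plot of $X$, are finite sums of pointwise tensor products of plots of the factors covering that same plot of $X$ (the zero section over the plot being the empty sum). **Pseudo-metrics.** A pseudo-metric on $\pi:V\to X$ is a smooth section $g:X\to V^*\otimes V^*$ such that each $g(x)$ is a positive semi-definite symmetric bilinear form on $\pi^{-1}(x)$ of rank $\dim((\pi^{-1}(x))^* )$. **Clifford algebras.** $T(V)=\bigcup_xT(\pi^{-1}(x))=\bigcup_x\bigoplus_{r\ge0}(\pi^{-1}(x))^{\otimes r}$ (degree-0 part $X\times\mathbb R$) carries the diffeology whose plots are the maps that locally take values in a finite partial sum, with all components plots of the tensor power pseudo-bundles over the same plot of $X$. For a vector space $W$ with symmetric bilinear form $q$, $C\ell(W,q)=T(W)/I$, where $I$ is the two-sided ideal generated by the elements $v\otimes w+w\otimes v+4q(v,w)$. The pseudo-bundle of Clifford algebras $\pi^{C\ell}:C\ell(V,g)\to X$ is $\bigcup_xC\ell(\pi^{-1}(x),g(x))$ with the quotient diffeology from $T(V)$. **Gluing.** For diffeological spaces $X_1,X_2$ and a smooth map $f:X_1\supseteq Y\to X_2$ ($Y$ with the subset diffeology), $X_1\cup_fX_2$ is the quotient of $X_1\sqcup X_2$ by the equivalence relation generated by $y\sim f(y)$, $y\in Y$, with the quotient of the disjoint union diffeology. A gluing $(\tilde f,f)$ between pseudo-bundles $\pi_1:V_1\to X_1$ and $\pi_2:V_2\to X_2$ consists of a diffeomorphism $f:Y\to f(Y)$, $Y\subseteq X_1$, $f(Y)\subseteq X_2$ (subset diffeologies), and a smooth map $\tilde f:\pi_1^{-1}(Y)\to\pi_2^{-1}(f(Y))$,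 linear on each fibre, with $\pi_2\circ\tilde f=f\circ\pi_1$. It yields the pseudo-bundle $\pi_1\cup_{(\tilde f,f)}\pi_2:V_1\cup_{\tilde f}V_2\to X_1\cup_fX_2$. Denote by $i_1:X_1\setminus Y\to X_1\cup_fX_2$, $i_2:X_2\to X_1\cup_fX_2$, $j_1:V_1\setminus\pi_1^{-1}(Y)\to V_1\cup_{\tilde f}V_2$, $j_2:V_2\to V_1\cup_{\tilde f}V_2$ the natural injections; the fibre over $i_1(x)$ is $j_1(\pi_1^{-1}(x))$ and the fibre over $i_2(x)$ is $j_2(\pi_2^{-1}(x))$. Pseudo-metrics $g_1,g_2$ are compatible with the gluing if $g_1(y)(v,w)=g_2(f(y))(\tilde f(v),\tilde f(w))$ for all $y\in Y$, $v,w\in\pi_1^{-1}(y)$. Then the induced pseudo-metric $\tilde g$ on $V_1\cup_{\tilde f}V_2$ is $\tilde g(i_k(x))(v,w)=g_k(x)(j_k^{-1}(v),j_k^{-1}(w))$ ($k=1$, $x\in X_1\setminus Y$; $k=2$, $x\in X_2$). **The map $\tilde F^{C\ell}$.** For compatible $g_1,g_2$, $\tilde F^{C\ell}:(\pi_1^{C\ell})^{-1}(Y)\to(\pi_2^{C\ell})^{-1}(f(Y))$ is the map whose restriction to each fibre $C\ell(\pi_1^{-1}(y),g_1(y))$, $y\in Y$, is the unital algebra homomorphism to $C\ell(\pi_2^{-1}(f(y)),g_2(f(y)))$ extending $\tilde f|_{\pi_1^{-1}(y)}$. The pair $(\tilde F^{C\ell},f)$ is a gluing between $C\ell(V_1,g_1)$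 and $C\ell(V_2,g_2)$. *)

theory Defs
  imports
    "HOL-Analysis.Abstract_Euclidean_Space"
    "HOL-Algebra.QuotRing"
    "Jordan_Normal_Form.VS_Connect"
begin

section \<open>Smooth maps between open subsets of Euclidean spaces\<close>

text \<open>
  Plots have domains in \<open>\<real>\<^sup>n\<close> with \<open>n\<close> varying, so \<open>\<real>\<^sup>n\<close> is the library's
  \<^const>\<open>Euclidean_space\<close> \<open>n\<close>, the sequences vanishing from index \<open>n\<close> on.
  Below \<open>U\<close> is always open in \<open>\<real>\<^sup>n\<close>; no notion depends on values outside \<open>U\<close>.
\<close>

primrec Ck_on :: "nat \<Rightarrow> nat \<Rightarrow> (nat \<Rightarrow> real) set \<Rightarrow> ((nat \<Rightarrow> real) \<Rightarrow> real) \<Rightarrow> bool" where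
  "Ck_on 0 n U f \<longleftrightarrow> continuous_map (subtopology (Euclidean_space n) U) euclideanreal f"
| "Ck_on (Suc k) n U f \<longleftrightarrow>
     continuous_map (subtopology (Euclidean_space n) U) euclideanreal f \<and>
     (\<forall>i<n. \<exists>f'. Ck_on k n U f' \<and>
        (\<forall>x\<in>U. ((\<lambda>t. f (x(i := t))) has_real_derivative f' x) (at (x i))))"

definition smooth_fun :: "nat \<Rightarrow> (nat \<Rightarrow> real) set \<Rightarrow> ((nat \<Rightarrow> real) \<Rightarrow> real) \<Rightarrow> bool" where
  "smooth_fun n U f \<longleftrightarrow> (\<forall>k. Ck_on k n U f)"

definition smooth_between ::
  "nat \<Rightarrow> (nat \<Rightarrow> real) set \<Rightarrow> nat \<Rightarrow> (nat \<Rightarrow> real) set \<Rightarrow> ((nat \<Rightarrow> real) \<Rightarrow> nat \<Rightarrow> real) \<Rightarrow> bool"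
  where
  "smooth_between m W n U h \<longleftrightarrow> h ` W \<subseteq> U \<and> (\<forall>i<n. smooth_fun m W (\<lambda>w. h w i))"


section \<open>Diffeological spaces\<close>

text \<open>\<open>plots D n U p\<close>: the set \<open>U\<close> is open in \<open>\<real>\<^sup>n\<close> and \<open>p\<close> restricted to \<open>U\<close> is a plot.\<close>

record 'a dspace =
  points :: "'a set"
  plots :: "nat \<Rightarrow> (nat \<Rightarrow> real) set \<Rightarrow> ((nat \<Rightarrow> real) \<Rightarrow> 'a) \<Rightarrow> bool"

definition locally_of ::
  "(nat \<Rightarrow> (nat \<Rightarrow> real) set \<Rightarrow> ((nat \<Rightarrow> real) \<Rightarrow> 'a) \<Rightarrow> bool) \<Rightarrow>
   nat \<Rightarrow> (nat \<Rightarrow> real) set \<Rightarrow> ((nat \<Rightarrow> real) \<Rightarrow> 'a) \<Rightarrow> bool" where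
  "locally_of P n U p \<longleftrightarrow>
     openin (Euclidean_space n) U \<and>
     (\<forall>u\<in>U. \<exists>W q. openin (Euclidean_space n) W \<and> u \<in> W \<and> W \<subseteq> U \<and>
                  P n W q \<and> (\<forall>w\<in>W. p w = q w))"

definition diffeological_space :: "'a dspace \<Rightarrow> bool" where
  "diffeological_space D \<longleftrightarrow>
     (\<forall>n U p. plots D n U p \<longrightarrow> openin (Euclidean_space n) U \<and> p ` U \<subseteq> points D) \<and>
     (\<forall>n U x. openin (Euclidean_space n) U \<and> x \<in> points D \<longrightarrow> plots D n U (\<lambda>_. x)) \<and>
     (\<forall>n U p m W h. plots D n U p \<and> openin (Euclidean_space m) W \<and> smooth_between m W n U h
        \<longrightarrow> plots D m W (p \<circ> h)) \<and>
     (\<forall>n U p. locally_of (plots D) n U p \<longrightarrow> plots D n U p)"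

definition dsmooth :: "'a dspace \<Rightarrow> 'b dspace \<Rightarrow> ('a \<Rightarrow> 'b) \<Rightarrow> bool" where
  "dsmooth D D' h \<longleftrightarrow>
     h ` points D \<subseteq> points D' \<and> (\<forall>n U p. plots D n U p \<longrightarrow> plots D' n U (h \<circ> p))"

definition diffeomorphism :: "'a dspace \<Rightarrow> 'b dspace \<Rightarrow> ('a \<Rightarrow> 'b) \<Rightarrow> bool" where
  "diffeomorphism D D' h \<longleftrightarrow>
     bij_betw h (points D) (points D') \<and> dsmooth D D' h \<and>
     dsmooth D' D (inv_into (points D) h)"

definition real_dspace :: "real dspace" where
  "real_dspace = \<lparr>points = UNIV,
     plots = (\<lambda>n U p. openin (Euclidean_space n) U \<and> smooth_fun n U p)\<rparr>"

definition euclid_dspace :: "nat \<Rightarrow> (nat \<Rightarrow> real) set \<Rightarrow> (nat \<Rightarrow> real) dspace" where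
  "euclid_dspace n U = \<lparr>points = U,
     plots = (\<lambda>m W h. openin (Euclidean_space m) W \<and> smooth_between m W n U h)\<rparr>"

definition sub_dspace :: "'a dspace \<Rightarrow> 'a set \<Rightarrow> 'a dspace" where
  "sub_dspace D S = \<lparr>points = points D \<inter> S,
     plots = (\<lambda>n U p. plots D n U p \<and> p ` U \<subseteq> S)\<rparr>"

definition prod_dspace :: "'a dspace \<Rightarrow> 'b dspace \<Rightarrow> ('a \<times> 'b) dspace" where
  "prod_dspace D D' = \<lparr>points = points D \<times> points D',
     plots = (\<lambda>n U p. plots D n U (fst \<circ> p) \<and> plots D' n U (snd \<circ> p))\<rparr>"

definition sum_dspace :: "'a dspace \<Rightarrow> 'b dspace \<Rightarrow> ('a + 'b) dspace" where
  "sum_dspace D D' = \<lparr>points = points D <+> points D',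
     plots = locally_of (\<lambda>n U p. (\<exists>q. plots D n U q \<and> p = Inl \<circ> q) \<or>
                                 (\<exists>q. plots D' n U q \<and> p = Inr \<circ> q))\<rparr>"

definition quot_dspace :: "'a dspace \<Rightarrow> ('a \<Rightarrow> 'b) \<Rightarrow> 'b dspace" where
  "quot_dspace D pr = \<lparr>points = pr ` points D,
     plots = locally_of (\<lambda>n U p. \<exists>q. plots D n U q \<and> p = pr \<circ> q)\<rparr>"


section \<open>Real vector spaces as module records\<close>

text \<open>
  Real vector spaces on carrier sets are modules over \<open>class_ring :: real ring\<close>. The ring
  fields \<open>mult\<close> and \<open>one\<close> of a module record are meaningful only for the algebras below.
\<close>

definition transport :: "('a \<Rightarrow> 'b) \<Rightarrow> (real, 'a) module \<Rightarrow> (real, 'b) module" where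
  "transport h M = (let k = inv_into (carrier M) h in
     \<lparr>carrier = h ` carrier M,
      mult = (\<lambda>a b. h (k a \<otimes>\<^bsub>M\<^esub> k b)), one = h \<one>\<^bsub>M\<^esub>,
      zero = h \<zero>\<^bsub>M\<^esub>, add = (\<lambda>a b. h (k a \<oplus>\<^bsub>M\<^esub> k b)),
      smult = (\<lambda>r a. h (r \<odot>\<^bsub>M\<^esub> k a))\<rparr>)"

definition real_line :: "(real, real) module" where
  "real_line = \<lparr>carrier = UNIV, mult = (*), one = 1, zero = 0, add = (+), smult = (*)\<rparr>"

definition fun_module :: "('s \<Rightarrow> real) set \<Rightarrow> (real, 's \<Rightarrow> real) module" where
  "fun_module C = \<lparr>carrier = C, mult = undefined, one = undefined, zero = (\<lambda>_. 0),
     add = (\<lambda>a b s. a s + b s), smult = (\<lambda>r a s. r * a s)\<rparr>"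

definition quot_module :: "(real, 'a) module \<Rightarrow> 'a set \<Rightarrow> (real, 'a set) module" where
  "quot_module M N = \<lparr>carrier = a_rcosets\<^bsub>M\<^esub> N, mult = undefined, one = undefined, zero = N,
     add = set_add M, smult = (\<lambda>r A. \<Union>a\<in>A. N +>\<^bsub>M\<^esub> (r \<odot>\<^bsub>M\<^esub> a))\<rparr>"


section \<open>Tensor powers, tensor algebra, Clifford algebra\<close>

text \<open>
  The \<open>r\<close>-th tensor power of \<open>M\<close> is the free vector space on \<open>r\<close>-tuples (lists of length
  \<open>r\<close>) modulo the multilinearity relations. For \<open>r = 0\<close> it is the line spanned by the
  class of the empty tuple, identified with \<open>\<real>\<close>.
\<close>

definition free_space :: "'s set \<Rightarrow> (real, 's \<Rightarrow> real) module" where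
  "free_space S = fun_module {c. finite {s. c s \<noteq> 0} \<and> {s. c s \<noteq> 0} \<subseteq> S}"

definition delta :: "'s \<Rightarrow> 's \<Rightarrow> real" where
  "delta s = (\<lambda>t. if t = s then 1 else 0)"

definition tuples :: "(real, 'v) module \<Rightarrow> nat \<Rightarrow> 'v list set" where
  "tuples M r = {xs. length xs = r \<and> set xs \<subseteq> carrier M}"

definition multilin_rels :: "(real, 'v) module \<Rightarrow> nat \<Rightarrow> ('v list \<Rightarrow> real) set" where
  "multilin_rels M r =
     {(\<lambda>l. delta (xs @ (x \<oplus>\<^bsub>M\<^esub> y) # ys) l - delta (xs @ x # ys) l - delta (xs @ y # ys) l)
        | xs x y ys. xs @ x # ys \<in> tuples M r \<and> y \<in> carrier M} \<union>
     {(\<lambda>l. delta (xs @ (a \<odot>\<^bsub>M\<^esub> x) # ys) l - a * delta (xs @ x # ys) l)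
        | xs a x ys. xs @ x # ys \<in> tuples M r}"

definition multilin_span :: "(real, 'v) module \<Rightarrow> nat \<Rightarrow> ('v list \<Rightarrow> real) set" where
  "multilin_span M r =
     LinearCombinations.module.span class_ring (free_space (tuples M r)) (multilin_rels M r)"

definition tensor_class ::
  "(real, 'v) module \<Rightarrow> nat \<Rightarrow> ('v list \<Rightarrow> real) \<Rightarrow> ('v list \<Rightarrow> real) set" where
  "tensor_class M r c = multilin_span M r +>\<^bsub>free_space (tuples M r)\<^esub> c"

definition tensor_power :: "(real, 'v) module \<Rightarrow> nat \<Rightarrow> (real, ('v list \<Rightarrow> real) set) module" where
  "tensor_power M r = quot_module (free_space (tuples M r)) (multilin_span M r)"

definition pure_tensor :: "(real, 'v) module \<Rightarrow> 'v list \<Rightarrow> ('v list \<Rightarrow> real) set" where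
  "pure_tensor M xs = tensor_class M (length xs) (delta xs)"

text \<open>
  The product \<open>M\<^bsup>\<otimes>i\<^esup> \<times> M\<^bsup>\<otimes>j\<^esup> \<rightarrow> M\<^bsup>\<otimes>(i+j)\<^esup>\<close>. On representatives it is the bilinear
  extension of concatenation of tuples: a list of length \<open>i + j\<close> arises from exactly one
  pair, namely \<open>(take i l, drop i l)\<close>.
\<close>

definition tensor_mult :: "(real, 'v) module \<Rightarrow> nat \<Rightarrow> nat \<Rightarrow>
    ('v list \<Rightarrow> real) set \<Rightarrow> ('v list \<Rightarrow> real) set \<Rightarrow> ('v list \<Rightarrow> real) set" where
  "tensor_mult M i j A B =
     (\<Union>a\<in>A. \<Union>b\<in>B. tensor_class M (i + j) (\<lambda>l. a (take i l) * b (drop i l)))"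

definition tensor_algebra ::
  "(real, 'v) module \<Rightarrow> (real, nat \<Rightarrow> ('v list \<Rightarrow> real) set) module" where
  "tensor_algebra M =
     \<lparr>carrier = {t. (\<forall>r. t r \<in> carrier (tensor_power M r)) \<and>
                    finite {r. t r \<noteq> \<zero>\<^bsub>tensor_power M r\<^esub>}},
      mult = (\<lambda>s t r. finsum (tensor_power M r)
                        (\<lambda>i. tensor_mult M i (r - i) (s i) (t (r - i))) {..r}),
      one = (\<lambda>r. if r = 0 then pure_tensor M [] else \<zero>\<^bsub>tensor_power M r\<^esub>),
      zero = (\<lambda>r. \<zero>\<^bsub>tensor_power M r\<^esub>),
      add = (\<lambda>s t r. s r \<oplus>\<^bsub>tensor_power M r\<^esub> t r),
      smult = (\<lambda>a t r. a \<odot>\<^bsub>tensor_power M r\<^esub> t r)\<rparr>"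

definition tensor_incl :: "(real, 'v) module \<Rightarrow> 'v \<Rightarrow> nat \<Rightarrow> ('v list \<Rightarrow> real) set" where
  "tensor_incl M v = (\<lambda>r. if r = 1 then pure_tensor M [v] else \<zero>\<^bsub>tensor_power M r\<^esub>)"

definition clifford_ideal ::
  "(real, 'v) module \<Rightarrow> ('v \<Rightarrow> 'v \<Rightarrow> real) \<Rightarrow> (nat \<Rightarrow> ('v list \<Rightarrow> real) set) set" where
  "clifford_ideal M q = (let T = tensor_algebra M; e = tensor_incl M in
     Idl\<^bsub>T\<^esub> {(e v \<otimes>\<^bsub>T\<^esub> e w) \<oplus>\<^bsub>T\<^esub> (e w \<otimes>\<^bsub>T\<^esub> e v) \<oplus>\<^bsub>T\<^esub> ((4 * q v w) \<odot>\<^bsub>T\<^esub> \<one>\<^bsub>T\<^esub>)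
              | v w. v \<in> carrier M \<and> w \<in> carrier M})"

definition clifford_class :: "(real, 'v) module \<Rightarrow> ('v \<Rightarrow> 'v \<Rightarrow> real) \<Rightarrow>
    (nat \<Rightarrow> ('v list \<Rightarrow> real) set) \<Rightarrow> (nat \<Rightarrow> ('v list \<Rightarrow> real) set) set" where
  "clifford_class M q t = clifford_ideal M q +>\<^bsub>tensor_algebra M\<^esub> t"

text \<open>The library's quotient ring, with the induced scalar multiplication added.\<close>

definition clifford_algebra :: "(real, 'v) module \<Rightarrow> ('v \<Rightarrow> 'v \<Rightarrow> real) \<Rightarrow>
    (real, (nat \<Rightarrow> ('v list \<Rightarrow> real) set) set) module" where
  "clifford_algebra M q = (let Q = tensor_algebra M Quot clifford_ideal M q in
     \<lparr>carrier = carrier Q, mult = mult Q, one = one Q, zero = zero Q, add = add Q,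
      smult = (\<lambda>r A. \<Union>t\<in>A. clifford_class M q (r \<odot>\<^bsub>tensor_algebra M\<^esub> t))\<rparr>)"


section \<open>Diffeological vector pseudo-bundles\<close>

text \<open>
  The vector space structure on the fibre over \<open>x\<close> is the module record \<open>fib E x\<close>, whose
  carrier is the fibre.
\<close>

record ('x, 'v) pbundle =
  base :: "'x dspace"
  total :: "'v dspace"
  proj :: "'v \<Rightarrow> 'x"
  fib :: "'x \<Rightarrow> (real, 'v) module"

definition pseudo_bundle :: "('x, 'v) pbundle \<Rightarrow> bool" where
  "pseudo_bundle E \<longleftrightarrow>
     diffeological_space (base E) \<and> diffeological_space (total E) \<and>
     dsmooth (total E) (base E) (proj E) \<and>
     proj E ` points (total E) = points (base E) \<and>
     (\<forall>x\<in>points (base E). vectorspace class_ring (fib E x) \<and>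
        carrier (fib E x) = {v \<in> points (total E). proj E v = x}) \<and>
     dsmooth (sub_dspace (prod_dspace (total E) (total E)) {(v, w). proj E v = proj E w})
       (total E) (\<lambda>(v, w). v \<oplus>\<^bsub>fib E (proj E v)\<^esub> w) \<and>
     dsmooth (prod_dspace real_dspace (total E)) (total E)
       (\<lambda>(a, v). a \<odot>\<^bsub>fib E (proj E v)\<^esub> v) \<and>
     dsmooth (base E) (total E) (\<lambda>x. \<zero>\<^bsub>fib E x\<^esub>)"

definition finite_dimensional :: "('x, 'v) pbundle \<Rightarrow> bool" where
  "finite_dimensional E \<longleftrightarrow> (\<forall>x\<in>points (base E). vectorspace.fin_dim class_ring (fib E x))"

definition bundle_diffeomorphic :: "('x, 'v) pbundle \<Rightarrow> ('x, 'w) pbundle \<Rightarrow> bool" where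
  "bundle_diffeomorphic E E' \<longleftrightarrow>
     base E = base E' \<and>
     (\<exists>\<Phi>. diffeomorphism (total E) (total E') \<Phi> \<and>
          (\<forall>v\<in>points (total E). proj E' (\<Phi> v) = proj E v) \<and>
          (\<forall>x\<in>points (base E). linear_map class_ring (fib E x) (fib E' x) \<Phi>))"

text \<open>Functionals on a fibre are extended by zero outside of it.\<close>

definition dual_fibre :: "('x, 'v) pbundle \<Rightarrow> 'x \<Rightarrow> (real, 'v \<Rightarrow> real) module" where
  "dual_fibre E x = fun_module {\<phi>.
     \<phi> \<in> module_hom class_ring (fib E x) real_line \<and>
     dsmooth (sub_dspace (total E) (carrier (fib E x))) real_dspace \<phi> \<and>
     (\<forall>v. v \<notin> carrier (fib E x) \<longrightarrow> \<phi> v = 0)}"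

text \<open>
  Points of the dual, tensor and Clifford pseudo-bundles are pairs of a base point and an
  element of the construction applied to the fibre over it, which makes the unions of
  fibres disjoint.
\<close>

definition dual_bundle :: "('x, 'v) pbundle \<Rightarrow> ('x, 'x \<times> ('v \<Rightarrow> real)) pbundle" where
  "dual_bundle E =
     (let P = (SIGMA x:points (base E). carrier (dual_fibre E x)) in
      \<lparr>base = base E,
       total = \<lparr>points = P,
         plots = (\<lambda>n U p. openin (Euclidean_space n) U \<and> p ` U \<subseteq> P \<and>
           (\<forall>n' U' q. plots (total E) n' U' q \<longrightarrow>
              dsmooth (sub_dspace (prod_dspace (euclid_dspace n U) (euclid_dspace n' U'))
                         {(u, u'). fst (p u) = proj E (q u')})
                real_dspace (\<lambda>(u, u'). snd (p u) (q u'))))\<rparr>,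
       proj = fst,
       fib = (\<lambda>x. transport (Pair x) (dual_fibre E x))\<rparr>)"

text \<open>
  Plots of the \<open>r\<close>-th tensor power are locally sums of \<open>m\<close> pointwise tensor products of
  plots \<open>q k 0, \<dots>, q k (r - 1)\<close> lying over one plot \<open>b\<close> of the base. The power of degree
  zero carries the product diffeology of the base and \<open>\<real>\<close>.
\<close>

definition tensor_power_bundle ::
  "('x, 'v) pbundle \<Rightarrow> nat \<Rightarrow> ('x, 'x \<times> ('v list \<Rightarrow> real) set) pbundle" where
  "tensor_power_bundle E r =
     \<lparr>base = base E,
      total = \<lparr>points = (SIGMA x:points (base E). carrier (tensor_power (fib E x) r)),
        plots = locally_of (\<lambda>n W s. \<exists>b. plots (base E) n W b \<and>
          (if r = 0
           then \<exists>c. plots real_dspace n W c \<and>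
             (\<forall>w\<in>W. s w = (b w, c w \<odot>\<^bsub>tensor_power (fib E (b w)) 0\<^esub> pure_tensor (fib E (b w)) []))
           else \<exists>(m::nat) q.
             (\<forall>k<m. \<forall>i<r. plots (total E) n W (q k i) \<and> (\<forall>w\<in>W. proj E (q k i w) = b w)) \<and>
             (\<forall>w\<in>W. s w = (b w, finsum (tensor_power (fib E (b w)) r)
                (\<lambda>k. pure_tensor (fib E (b w)) (map (\<lambda>i. q k i w) [0..<r])) {..<m}))))\<rparr>,
      proj = fst,
      fib = (\<lambda>x. transport (Pair x) (tensor_power (fib E x) r))\<rparr>"

definition tensor_algebra_bundle ::
  "('x, 'v) pbundle \<Rightarrow> ('x, 'x \<times> (nat \<Rightarrow> ('v list \<Rightarrow> real) set)) pbundle" where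
  "tensor_algebra_bundle E =
     \<lparr>base = base E,
      total = \<lparr>points = (SIGMA x:points (base E). carrier (tensor_algebra (fib E x))),
        plots = locally_of (\<lambda>n W s. \<exists>b t N. plots (base E) n W b \<and>
          (\<forall>w\<in>W. s w = (b w, t w) \<and> (\<forall>r>N. t w r = \<zero>\<^bsub>tensor_power (fib E (b w)) r\<^esub>)) \<and>
          (\<forall>r\<le>N. plots (total (tensor_power_bundle E r)) n W (\<lambda>w. (b w, t w r))))\<rparr>,
      proj = fst,
      fib = (\<lambda>x. transport (Pair x) (tensor_algebra (fib E x)))\<rparr>"

definition clifford_bundle :: "('x, 'v) pbundle \<Rightarrow> ('x \<Rightarrow> 'v \<Rightarrow> 'v \<Rightarrow> real) \<Rightarrow>
    ('x, 'x \<times> (nat \<Rightarrow> ('v list \<Rightarrow> real) set) set) pbundle" where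
  "clifford_bundle E g =
     \<lparr>base = base E,
      total = quot_dspace (total (tensor_algebra_bundle E))
                (\<lambda>(x, t). (x, clifford_class (fib E x) (g x) t)),
      proj = fst,
      fib = (\<lambda>x. transport (Pair x) (clifford_algebra (fib E x) (g x)))\<rparr>"


section \<open>Pseudo-metrics\<close>

text \<open>The rank of a bilinear form \<open>b\<close> on \<open>M\<close>: dimension of the image of \<open>v \<mapsto> b(v, \<cdot>)\<close>.\<close>

definition form_rank :: "(real, 'v) module \<Rightarrow> ('v \<Rightarrow> 'v \<Rightarrow> real) \<Rightarrow> nat" where
  "form_rank M b = vectorspace.dim class_ring
     (fun_module ((\<lambda>v w. if w \<in> carrier M then b v w else 0) ` carrier M))"

text \<open>
  A pseudo-metric is handled as the family of bilinear forms \<open>g x\<close> that it defines; \<open>G\<close> is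
  the same object as a section of the tensor square of the dual. The value of a tensor as
  a bilinear form is computed from any of its representatives, a finitely supported
  combination \<open>c\<close> of pairs \<open>l = [(x, \<phi>), (x, \<psi>)]\<close>.
\<close>

definition tensor_represents ::
  "(('x \<times> ('v \<Rightarrow> real)) list \<Rightarrow> real) set \<Rightarrow> 'v set \<Rightarrow> ('v \<Rightarrow> 'v \<Rightarrow> real) \<Rightarrow> bool" where
  "tensor_represents A S b \<longleftrightarrow> (\<forall>c\<in>A. \<forall>v\<in>S. \<forall>w\<in>S.
     b v w = (\<Sum>l | c l \<noteq> 0. c l * snd (l ! 0) v * snd (l ! 1) w))"

definition pseudo_metric :: "('x, 'v) pbundle \<Rightarrow> ('x \<Rightarrow> 'v \<Rightarrow> 'v \<Rightarrow> real) \<Rightarrow> bool" where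
  "pseudo_metric E g \<longleftrightarrow>
     (\<exists>G. dsmooth (base E) (total (tensor_power_bundle (dual_bundle E) 2)) G \<and>
          (\<forall>x\<in>points (base E).
             fst (G x) = x \<and> tensor_represents (snd (G x)) (carrier (fib E x)) (g x))) \<and>
     (\<forall>x\<in>points (base E).
        (\<forall>v\<in>carrier (fib E x). \<forall>w\<in>carrier (fib E x). g x v w = g x w v) \<and>
        (\<forall>v\<in>carrier (fib E x). 0 \<le> g x v v) \<and>
        form_rank (fib E x) (g x) = vectorspace.dim class_ring (dual_fibre E x))"


section \<open>Gluing\<close>

definition glue_rel :: "'a set \<Rightarrow> 'b set \<Rightarrow> 'a set \<Rightarrow> ('a \<Rightarrow> 'b) \<Rightarrow> ('a + 'b) rel" where
  "glue_rel A B Y f = {(a, b). a \<in> A <+> B \<and> b \<in> A <+> B \<and>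
     equivclp (\<lambda>a b. \<exists>y\<in>Y. a = Inl y \<and> b = Inr (f y)) a b}"

definition glue_dspace :: "'a dspace \<Rightarrow> 'b dspace \<Rightarrow> 'a set \<Rightarrow> ('a \<Rightarrow> 'b) \<Rightarrow> ('a + 'b) set dspace" where
  "glue_dspace D1 D2 Y f = quot_dspace (sum_dspace D1 D2)
     (\<lambda>a. glue_rel (points D1) (points D2) Y f `` {a})"

definition glue_inl :: "'a dspace \<Rightarrow> 'b dspace \<Rightarrow> 'a set \<Rightarrow> ('a \<Rightarrow> 'b) \<Rightarrow> 'a \<Rightarrow> ('a + 'b) set" where
  "glue_inl D1 D2 Y f x = glue_rel (points D1) (points D2) Y f `` {Inl x}"

definition glue_inr :: "'a dspace \<Rightarrow> 'b dspace \<Rightarrow> 'a set \<Rightarrow> ('a \<Rightarrow> 'b) \<Rightarrow> 'b \<Rightarrow> ('a + 'b) set" where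
  "glue_inr D1 D2 Y f x = glue_rel (points D1) (points D2) Y f `` {Inr x}"

definition over :: "('x, 'v) pbundle \<Rightarrow> 'x set \<Rightarrow> 'v set" where
  "over E Y = {v \<in> points (total E). proj E v \<in> Y}"

definition gluing :: "('x, 'v) pbundle \<Rightarrow> ('y, 'w) pbundle \<Rightarrow> 'x set \<Rightarrow>
    ('x \<Rightarrow> 'y) \<Rightarrow> ('v \<Rightarrow> 'w) \<Rightarrow> bool" where
  "gluing E1 E2 Y f ft \<longleftrightarrow>
     Y \<subseteq> points (base E1) \<and> f ` Y \<subseteq> points (base E2) \<and>
     diffeomorphism (sub_dspace (base E1) Y) (sub_dspace (base E2) (f ` Y)) f \<and>
     dsmooth (sub_dspace (total E1) (over E1 Y)) (sub_dspace (total E2) (over E2 (f ` Y))) ft \<and>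
     (\<forall>v\<in>over E1 Y. proj E2 (ft v) = f (proj E1 v)) \<and>
     (\<forall>y\<in>Y. linear_map class_ring (fib E1 y) (fib E2 (f y)) ft)"

text \<open>
  The total space and the base are glued along \<open>ft\<close> and \<open>f\<close>. A class of the total space is
  projected elementwise; \<open>glue_rel `` _\<close> turns the resulting equivalent points of the base
  into their full class. Fibres are transported along \<open>j\<^sub>2\<close> over the image of \<open>i\<^sub>2\<close> and along
  \<open>j\<^sub>1\<close> over its complement, the image of \<open>X\<^sub>1 - Y\<close> under \<open>i\<^sub>1\<close>.
\<close>

definition glue_bundle :: "('x, 'v) pbundle \<Rightarrow> ('y, 'w) pbundle \<Rightarrow> 'x set \<Rightarrow>
    ('x \<Rightarrow> 'y) \<Rightarrow> ('v \<Rightarrow> 'w) \<Rightarrow> (('x + 'y) set, ('v + 'w) set) pbundle" where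
  "glue_bundle E1 E2 Y f ft =
     (let X1 = points (base E1); X2 = points (base E2);
          i1 = glue_inl (base E1) (base E2) Y f;
          i2 = glue_inr (base E1) (base E2) Y f;
          j1 = glue_inl (total E1) (total E2) (over E1 Y) ft;
          j2 = glue_inr (total E1) (total E2) (over E1 Y) ft in
      \<lparr>base = glue_dspace (base E1) (base E2) Y f,
       total = glue_dspace (total E1) (total E2) (over E1 Y) ft,
       proj = (\<lambda>C. glue_rel X1 X2 Y f `` (map_sum (proj E1) (proj E2) ` C)),
       fib = (\<lambda>z. if z \<in> i2 ` X2
                  then transport j2 (fib E2 (inv_into X2 i2 z))
                  else transport j1 (fib E1 (inv_into (X1 - Y) i1 z)))\<rparr>)"

definition compatible_metrics :: "('x, 'v) pbundle \<Rightarrow> 'x set \<Rightarrow> ('x \<Rightarrow> 'y) \<Rightarrow> ('v \<Rightarrow> 'w) \<Rightarrow>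
    ('x \<Rightarrow> 'v \<Rightarrow> 'v \<Rightarrow> real) \<Rightarrow> ('y \<Rightarrow> 'w \<Rightarrow> 'w \<Rightarrow> real) \<Rightarrow> bool" where
  "compatible_metrics E1 Y f ft g1 g2 \<longleftrightarrow>
     (\<forall>y\<in>Y. \<forall>v\<in>carrier (fib E1 y). \<forall>w\<in>carrier (fib E1 y).
        g1 y v w = g2 (f y) (ft v) (ft w))"

definition glue_metric :: "('x, 'v) pbundle \<Rightarrow> ('y, 'w) pbundle \<Rightarrow> 'x set \<Rightarrow>
    ('x \<Rightarrow> 'y) \<Rightarrow> ('v \<Rightarrow> 'w) \<Rightarrow> ('x \<Rightarrow> 'v \<Rightarrow> 'v \<Rightarrow> real) \<Rightarrow> ('y \<Rightarrow> 'w \<Rightarrow> 'w \<Rightarrow> real) \<Rightarrow>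
    ('x + 'y) set \<Rightarrow> ('v + 'w) set \<Rightarrow> ('v + 'w) set \<Rightarrow> real" where
  "glue_metric E1 E2 Y f ft g1 g2 z v w =
     (let X1 = points (base E1); X2 = points (base E2);
          i1 = glue_inl (base E1) (base E2) Y f;
          i2 = glue_inr (base E1) (base E2) Y f;
          k1 = inv_into (points (total E1) - over E1 Y)
                 (glue_inl (total E1) (total E2) (over E1 Y) ft);
          k2 = inv_into (points (total E2)) (glue_inr (total E1) (total E2) (over E1 Y) ft) in
      if z \<in> i2 ` X2
      then g2 (inv_into X2 i2 z) (k2 v) (k2 w)
      else g1 (inv_into (X1 - Y) i1 z) (k1 v) (k1 w))"

text \<open>
  \<open>F\<close> is the map induced by \<open>ft\<close> between the parts of the Clifford pseudo-bundles over \<open>Y\<close>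
  and \<open>f ` Y\<close>; its values there are determined because a Clifford algebra is generated by
  the underlying vector space.
\<close>

definition clifford_induced :: "('x, 'v) pbundle \<Rightarrow> ('y, 'w) pbundle \<Rightarrow> 'x set \<Rightarrow>
    ('x \<Rightarrow> 'y) \<Rightarrow> ('v \<Rightarrow> 'w) \<Rightarrow> ('x \<Rightarrow> 'v \<Rightarrow> 'v \<Rightarrow> real) \<Rightarrow> ('y \<Rightarrow> 'w \<Rightarrow> 'w \<Rightarrow> real) \<Rightarrow>
    ('x \<times> (nat \<Rightarrow> ('v list \<Rightarrow> real) set) set \<Rightarrow> 'y \<times> (nat \<Rightarrow> ('w list \<Rightarrow> real) set) set) \<Rightarrow> bool"
  where
  "clifford_induced E1 E2 Y f ft g1 g2 F \<longleftrightarrow>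
     (\<forall>y\<in>Y.
        F \<in> Ring.ring_hom (fib (clifford_bundle E1 g1) y) (fib (clifford_bundle E2 g2) (f y)) \<and>
        F \<in> module_hom class_ring (fib (clifford_bundle E1 g1) y)
              (fib (clifford_bundle E2 g2) (f y)) \<and>
        (\<forall>v\<in>carrier (fib E1 y).
           F (y, clifford_class (fib E1 y) (g1 y) (tensor_incl (fib E1 y) v)) =
           (f y, clifford_class (fib E2 (f y)) (g2 (f y)) (tensor_incl (fib E2 (f y)) (ft v)))))"

end

theory Submission
  imports Defs
begin

text \<open>
  Write \<open>V\<close> for the glued pseudo-bundle and \<open>g\<close> for the glued pseudo-metric. The two natural
  maps \<open>j\<^sub>1\<close> and \<open>j\<^sub>2\<close> of \<open>V\<^sub>1\<close> and \<open>V\<^sub>2\<close> into \<open>V\<close> cover \<open>i\<^sub>1\<close> and \<open>i\<^sub>2\<close>, and both are isometric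
  linear isomorphisms on \<^emph>\<open>every\<close> fibre. For \<open>j\<^sub>1\<close> over a point \<open>y\<close> of \<open>Y\<close> this uses that \<open>ft\<close> is
  a diffeomorphism and that the pseudo-metrics are compatible: there \<open>j\<^sub>1\<close> is \<open>j\<^sub>2\<close> after \<open>ft\<close>.
  The Clifford algebra is functorial for isometric isomorphisms, so both maps induce maps
  \<open>cliff\<^sub>k\<close> from \<open>Cl(V\<^sub>k, g\<^sub>k)\<close> to \<open>Cl(V, g)\<close>. As Clifford algebras are generated by vectors, \<open>F\<close> is
  fibrewise the map induced by \<open>ft\<close> (\<open>F_eq\<close>); hence \<open>cliff\<^sub>2\<close> after \<open>F\<close> equals \<open>cliff\<^sub>1\<close> over \<open>Y\<close>
  (\<open>cliff_F\<close>), and the two maps descend to one map \<open>\<Phi>\<close> on the glued Clifford pseudo-bundle. It is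
  bijective and fibrewise linear because the \<open>cliff\<^sub>k\<close> are fibrewise isomorphisms and take the
  same value at \<open>a\<close> and \<open>b\<close> exactly when \<open>F\<close> glues \<open>a\<close> to \<open>b\<close> (\<open>cliff_eq_iff\<close>).

  Smoothness of \<open>\<Phi>\<close> is functoriality on plots: composing with \<open>j\<^sub>k\<close> turns sums of pure tensors
  of plots of \<open>V\<^sub>k\<close> into such sums for \<open>V\<close> (\<open>cliff_smooth\<close>). For the inverse, a plot of \<open>Cl(V, g)\<close>
  comes locally from sums of pure tensors of plots of \<open>V\<close> over a plot \<open>b\<close> of the base, and
  \<open>b\<close> lifts locally to one \<open>X\<^sub>k\<close>. The finitely many plots of \<open>V\<close> involved may lift to
  different \<open>V\<^sub>l\<close>, but wherever a lift ends up in the wrong one it lies over the glued part,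
  and \<open>ft\<close> or its smooth inverse moves it to the other side (\<open>lifts_over_1\<close>, \<open>lifts_over_2\<close>). So
  the whole expression lifts to \<open>V\<^sub>k\<close> (\<open>clifford_lift\<close>).

  For the algebra, the tensor algebra is presented as the image of the algebra of finitely
  supported functions on words under \<open>tensor_of\<close>, from which it inherits the ring axioms. An
  isomorphism \<open>h\<close> acts on functions on words by relabelling (\<open>pushforward\<close>); this maps the
  multilinearity relations onto each other, so the induced maps on tensor powers, tensor
  algebras and Clifford algebras are simply images of cosets.
\<close>

section \<open>Modules over the real field\<close>

lemma vectorspace_iff_module: "vectorspace (class_ring :: real ring) M \<longleftrightarrow> module class_ring M"
  unfolding vectorspace_def using class_field by blast

lemma real_moduleI:
  fixes M :: "(real, 'a) module"
  assumes "\<zero>\<^bsub>M\<^esub> \<in> carrier M"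
    and "\<And>x y. x \<in> carrier M \<Longrightarrow> y \<in> carrier M \<Longrightarrow> x \<oplus>\<^bsub>M\<^esub> y \<in> carrier M"
    and "\<And>a x. x \<in> carrier M \<Longrightarrow> a \<odot>\<^bsub>M\<^esub> x \<in> carrier M"
    and "\<And>x y z. x \<in> carrier M \<Longrightarrow> y \<in> carrier M \<Longrightarrow> z \<in> carrier M \<Longrightarrow>
           (x \<oplus>\<^bsub>M\<^esub> y) \<oplus>\<^bsub>M\<^esub> z = x \<oplus>\<^bsub>M\<^esub> (y \<oplus>\<^bsub>M\<^esub> z)"
    and "\<And>x y. x \<in> carrier M \<Longrightarrow> y \<in> carrier M \<Longrightarrow> x \<oplus>\<^bsub>M\<^esub> y = y \<oplus>\<^bsub>M\<^esub> x"
    and "\<And>x. x \<in> carrier M \<Longrightarrow> \<zero>\<^bsub>M\<^esub> \<oplus>\<^bsub>M\<^esub> x = x"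
    and "\<And>x. x \<in> carrier M \<Longrightarrow> ((-1) \<odot>\<^bsub>M\<^esub> x) \<oplus>\<^bsub>M\<^esub> x = \<zero>\<^bsub>M\<^esub>"
    and "\<And>a b x. x \<in> carrier M \<Longrightarrow> (a + b) \<odot>\<^bsub>M\<^esub> x = a \<odot>\<^bsub>M\<^esub> x \<oplus>\<^bsub>M\<^esub> b \<odot>\<^bsub>M\<^esub> x"
    and "\<And>a x y. x \<in> carrier M \<Longrightarrow> y \<in> carrier M \<Longrightarrow>
           a \<odot>\<^bsub>M\<^esub> (x \<oplus>\<^bsub>M\<^esub> y) = a \<odot>\<^bsub>M\<^esub> x \<oplus>\<^bsub>M\<^esub> a \<odot>\<^bsub>M\<^esub> y"
    and "\<And>a b x. x \<in> carrier M \<Longrightarrow> (a * b) \<odot>\<^bsub>M\<^esub> x = a \<odot>\<^bsub>M\<^esub> (b \<odot>\<^bsub>M\<^esub> x)"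
    and "\<And>x. x \<in> carrier M \<Longrightarrow> 1 \<odot>\<^bsub>M\<^esub> x = x"
  shows "module class_ring M"
proof (rule moduleI)
  show "cring (class_ring :: real ring)"
    by (rule class_cring.cring_axioms)
  show "abelian_group M"
  proof (rule abelian_groupI)
    fix x assume "x \<in> carrier M"
    then show "\<exists>y\<in>carrier M. y \<oplus>\<^bsub>M\<^esub> x = \<zero>\<^bsub>M\<^esub>"
      using assms(3,7) by blast
  qed (use assms in auto)
qed (use assms in auto)

text \<open>
  The axioms of a module pass to the image under a map that preserves the operations. The
  tensor powers, the tensor algebra and the Clifford algebra are shown to be modules in this
  way, as images of modules of functions.
\<close>

lemma module_surj_image:
  fixes M :: "(real, 'a) module" and N :: "(real, 'b) module"
  assumes M: "module class_ring M"
    and surj: "h ` carrier M = carrier N"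
    and add: "\<And>x y. x \<in> carrier M \<Longrightarrow> y \<in> carrier M \<Longrightarrow> h (x \<oplus>\<^bsub>M\<^esub> y) = h x \<oplus>\<^bsub>N\<^esub> h y"
    and smult: "\<And>a x. x \<in> carrier M \<Longrightarrow> h (a \<odot>\<^bsub>M\<^esub> x) = a \<odot>\<^bsub>N\<^esub> h x"
    and zero: "h \<zero>\<^bsub>M\<^esub> = \<zero>\<^bsub>N\<^esub>"
  shows "module class_ring N"
proof -
  interpret module class_ring M by (rule M)
  have ex: "\<exists>x. x \<in> carrier M \<and> y = h x" if "y \<in> carrier N" for y
    using surj that by blast
  have mem: "h x \<in> carrier N" if "x \<in> carrier M" for x
    using surj that by blast
  have neg: "((-1) \<odot>\<^bsub>M\<^esub> x) \<oplus>\<^bsub>M\<^esub> x = \<zero>\<^bsub>M\<^esub>" if "x \<in> carrier M" for x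
    using smult_l_distr[of "-1" 1 x] that smult_one[OF that] smult_l_null[OF that] by simp
  note hom = add[symmetric] smult[symmetric] zero[symmetric]
  show ?thesis
  proof (rule real_moduleI)
    show "\<zero>\<^bsub>N\<^esub> \<in> carrier N" using mem[OF M.zero_closed] by (simp add: zero)
  next
    fix x y assume "x \<in> carrier N" "y \<in> carrier N"
    then obtain x' y' where "x' \<in> carrier M" "x = h x'" "y' \<in> carrier M" "y = h y'" using ex by metis
    then show "x \<oplus>\<^bsub>N\<^esub> y \<in> carrier N" "x \<oplus>\<^bsub>N\<^esub> y = y \<oplus>\<^bsub>N\<^esub> x"
      "a \<odot>\<^bsub>N\<^esub> (x \<oplus>\<^bsub>N\<^esub> y) = a \<odot>\<^bsub>N\<^esub> x \<oplus>\<^bsub>N\<^esub> a \<odot>\<^bsub>N\<^esub> y" for a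
      by (simp_all add: hom mem M.a_comm smult_r_distr)
  next
    fix x assume "x \<in> carrier N"
    then obtain x' where x': "x' \<in> carrier M" "x = h x'" using ex by metis
    then show "a \<odot>\<^bsub>N\<^esub> x \<in> carrier N" "\<zero>\<^bsub>N\<^esub> \<oplus>\<^bsub>N\<^esub> x = x" "(-1) \<odot>\<^bsub>N\<^esub> x \<oplus>\<^bsub>N\<^esub> x = \<zero>\<^bsub>N\<^esub>" for a
      by (simp_all add: hom mem neg)
    show "(a + b) \<odot>\<^bsub>N\<^esub> x = a \<odot>\<^bsub>N\<^esub> x \<oplus>\<^bsub>N\<^esub> b \<odot>\<^bsub>N\<^esub> x" for a b
      using smult_l_distr[of a b x'] x' by (simp add: hom)
    show "(a * b) \<odot>\<^bsub>N\<^esub> x = a \<odot>\<^bsub>N\<^esub> (b \<odot>\<^bsub>N\<^esub> x)" for a b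
      using smult_assoc1[of a b x'] x' by (simp add: hom)
    show "1 \<odot>\<^bsub>N\<^esub> x = x"
      using smult_one[of x'] x' by (simp add: hom)
  next
    fix x y z assume "x \<in> carrier N" "y \<in> carrier N" "z \<in> carrier N"
    then obtain x' y' z' where "x' \<in> carrier M" "x = h x'" "y' \<in> carrier M" "y = h y'"
      "z' \<in> carrier M" "z = h z'" using ex by metis
    then show "x \<oplus>\<^bsub>N\<^esub> y \<oplus>\<^bsub>N\<^esub> z = x \<oplus>\<^bsub>N\<^esub> (y \<oplus>\<^bsub>N\<^esub> z)"
      by (simp add: hom M.a_assoc)
  qed
qed

lemma real_module_closed:
  fixes M :: "(real, 'a) module"
  assumes "module class_ring M"
  shows "x \<in> carrier M \<Longrightarrow> y \<in> carrier M \<Longrightarrow> x \<oplus>\<^bsub>M\<^esub> y \<in> carrier M"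
    and "x \<in> carrier M \<Longrightarrow> a \<odot>\<^bsub>M\<^esub> x \<in> carrier M"
    and "\<zero>\<^bsub>M\<^esub> \<in> carrier M"
proof -
  interpret module class_ring M by (rule assms)
  show "x \<in> carrier M \<Longrightarrow> y \<in> carrier M \<Longrightarrow> x \<oplus>\<^bsub>M\<^esub> y \<in> carrier M"
    and "x \<in> carrier M \<Longrightarrow> a \<odot>\<^bsub>M\<^esub> x \<in> carrier M"
    and "\<zero>\<^bsub>M\<^esub> \<in> carrier M" by (auto intro: smult_closed)
qed


section \<open>Free vector spaces and tensor powers\<close>

lemma free_space_simps:
  "\<zero>\<^bsub>free_space S\<^esub> = (\<lambda>_. 0)"
  "a \<oplus>\<^bsub>free_space S\<^esub> b = (\<lambda>s. a s + b s)"
  "r \<odot>\<^bsub>free_space S\<^esub> a = (\<lambda>s. r * a s)"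
  by (simp_all add: free_space_def fun_module_def)

lemma free_space_carrier:
  "c \<in> carrier (free_space S) \<longleftrightarrow> finite {s. c s \<noteq> 0} \<and> (\<forall>s. c s \<noteq> 0 \<longrightarrow> s \<in> S)"
  by (auto simp: free_space_def fun_module_def)

lemma free_space_add_closed:
  assumes "a \<in> carrier (free_space S)" "b \<in> carrier (free_space S)"
  shows "(\<lambda>s. a s + b s) \<in> carrier (free_space S)"
proof -
  have "{s. a s + b s \<noteq> 0} \<subseteq> {s. a s \<noteq> 0} \<union> {s. b s \<noteq> 0}" by auto
  then have "finite {s. a s + b s \<noteq> 0}"
    using assms unfolding free_space_carrier by (meson finite_UnI finite_subset)
  moreover have "s \<in> S" if "a s + b s \<noteq> 0" for s
    using that assms unfolding free_space_carrier by (cases "a s = 0") auto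
  ultimately show ?thesis by (auto simp: free_space_carrier)
qed

lemma free_space_smult_closed:
  "a \<in> carrier (free_space S) \<Longrightarrow> (\<lambda>s. r * a s) \<in> carrier (free_space S)"
  by (auto simp: free_space_carrier elim: rev_finite_subset)

lemma free_space_zero_closed: "(\<lambda>s. 0) \<in> carrier (free_space S)"
  by (auto simp: free_space_carrier)

lemma free_space_module: "module class_ring (free_space S)"
  by (rule real_moduleI)
    (auto simp: free_space_simps free_space_add_closed free_space_smult_closed
        free_space_zero_closed algebra_simps)

lemma delta_closed: "s \<in> S \<Longrightarrow> delta s \<in> carrier (free_space S)"
  by (auto simp: free_space_carrier delta_def)

lemma free_space_diff_closed:
  assumes "a \<in> carrier (free_space S)" "b \<in> carrier (free_space S)"
  shows "(\<lambda>s. a s - b s) \<in> carrier (free_space S)"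
  using free_space_add_closed[OF assms(1) free_space_smult_closed[OF assms(2), of "-1"]] by simp

lemma free_space_sum_closed:
  assumes "\<And>k. k \<in> K \<Longrightarrow> c k \<in> carrier (free_space S)"
  shows "(\<lambda>s. \<Sum>k\<in>K. c k s) \<in> carrier (free_space S)"
  using assms
  by (induction K rule: infinite_finite_induct)
    (auto simp: free_space_zero_closed free_space_add_closed)

lemma free_space_induct [consumes 1, case_names zero delta add smult]:
  assumes "c \<in> carrier (free_space S)"
    and "P (\<lambda>_. 0)"
    and delta: "\<And>s. s \<in> S \<Longrightarrow> P (delta s)"
    and add: "\<And>a b. a \<in> carrier (free_space S) \<Longrightarrow> b \<in> carrier (free_space S) \<Longrightarrow>
           P a \<Longrightarrow> P b \<Longrightarrow> P (\<lambda>s. a s + b s)"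
    and smult: "\<And>r a. a \<in> carrier (free_space S) \<Longrightarrow> P a \<Longrightarrow> P (\<lambda>s. r * a s)"
  shows "P c"
proof -
  have "finite A \<Longrightarrow> (\<And>s. c s \<noteq> 0 \<Longrightarrow> s \<in> A) \<Longrightarrow> A \<subseteq> S \<Longrightarrow> P c" for A c
  proof (induction A arbitrary: c rule: finite_induct)
    case empty
    then have "c = (\<lambda>_. 0)" by auto
    then show ?case using assms(2) by simp
  next
    case (insert x A)
    let ?c = "c(x := 0)"
    have c: "c = (\<lambda>s. ?c s + c x * delta x s)" by (auto simp: delta_def)
    have sub: "s \<in> A" if "?c s \<noteq> 0" for s using that insert.prems(1)[of s] by (auto split: if_splits)
    then have "?c \<in> carrier (free_space S)"
      using insert.prems(2) insert.hyps(1) unfolding free_space_carrier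
      by (auto intro: finite_subset[of _ A])
    moreover have "P ?c" using insert.IH[of ?c] sub insert.prems(2) by (metis insert_subset)
    moreover have "P (\<lambda>s. c x * delta x s)"
      using insert.prems(2) by (intro smult delta delta_closed) auto
    moreover have "(\<lambda>s. c x * delta x s) \<in> carrier (free_space S)"
      using insert.prems(2) by (intro free_space_smult_closed delta_closed) auto
    ultimately show ?case by (subst c) (rule add)
  qed
  from this[of "{s. c s \<noteq> 0}" c] assms(1) show ?thesis by (auto simp: free_space_carrier)
qed

lemma (in module) span_induct [consumes 2, case_names zero gen add smult]:
  assumes S: "S \<subseteq> carrier M" and v: "v \<in> span S"
    and P: "P \<zero>\<^bsub>M\<^esub>" "\<And>s. s \<in> S \<Longrightarrow> P s"
      "\<And>a b. a \<in> carrier M \<Longrightarrow> b \<in> carrier M \<Longrightarrow> P a \<Longrightarrow> P b \<Longrightarrow> P (a \<oplus>\<^bsub>M\<^esub> b)"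
      "\<And>r a. r \<in> carrier R \<Longrightarrow> a \<in> carrier M \<Longrightarrow> P a \<Longrightarrow> P (r \<odot>\<^bsub>M\<^esub> a)"
  shows "P v"
proof -
  have "submodule R {x \<in> carrier M. P x} M"
    using P module_axioms by (unfold_locales) auto
  then have "span S \<subseteq> {x \<in> carrier M. P x}"
    using S P(2) by (intro span_is_subset) auto
  then show ?thesis using v by auto
qed

text \<open>
  The underlying set of the free vector space on \<open>r\<close>-tuples, of which the \<open>r\<close>-th tensor power is
  a quotient.
\<close>

abbreviation tuple_space :: "(real, 'v) module \<Rightarrow> nat \<Rightarrow> ('v list \<Rightarrow> real) set" where
  "tuple_space M r \<equiv> carrier (free_space (tuples M r))"

lemma tuples_iff: "xs \<in> tuples M r \<longleftrightarrow> length xs = r \<and> set xs \<subseteq> carrier M"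
  by (simp add: tuples_def)

lemma multilin_rels_cases:
  assumes "c \<in> multilin_rels M r"
  obtains
    (sum) xs x y ys where "xs @ x # ys \<in> tuples M r" "y \<in> carrier M"
      "c = (\<lambda>l. delta (xs @ (x \<oplus>\<^bsub>M\<^esub> y) # ys) l - delta (xs @ x # ys) l - delta (xs @ y # ys) l)"
  | (scale) xs a x ys where "xs @ x # ys \<in> tuples M r"
      "c = (\<lambda>l. delta (xs @ (a \<odot>\<^bsub>M\<^esub> x) # ys) l - a * delta (xs @ x # ys) l)"
  using assms unfolding multilin_rels_def by blast

lemma multilin_rels_closed:
  assumes "module class_ring M"
  shows "multilin_rels M r \<subseteq> tuple_space M r"
proof
  note cl = real_module_closed[OF assms]
  fix c assume "c \<in> multilin_rels M r"
  then show "c \<in> tuple_space M r"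
    by (cases rule: multilin_rels_cases) (auto intro!: free_space_diff_closed free_space_smult_closed delta_closed
        simp: tuples_iff cl)
qed

lemma multilin_span_props:
  assumes "module class_ring M"
  shows multilin_span_closed: "multilin_span M r \<subseteq> tuple_space M r"
    and multilin_span_zero: "(\<lambda>_. 0) \<in> multilin_span M r"
    and multilin_span_add: "\<And>a b. a \<in> multilin_span M r \<Longrightarrow> b \<in> multilin_span M r \<Longrightarrow>
          (\<lambda>l. a l + b l) \<in> multilin_span M r"
    and multilin_span_smult: "\<And>k a. a \<in> multilin_span M r \<Longrightarrow> (\<lambda>l. k * a l) \<in> multilin_span M r"
    and multilin_span_rels: "\<And>a. a \<in> multilin_rels M r \<Longrightarrow> a \<in> multilin_span M r"
proof -
  interpret F: module class_ring "free_space (tuples M r)" by (rule free_space_module)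
  interpret submodule class_ring "multilin_span M r" "free_space (tuples M r)"
    unfolding multilin_span_def by (rule F.span_is_submodule[OF multilin_rels_closed[OF assms]])
  show "multilin_span M r \<subseteq> tuple_space M r" by (rule subset)
  show "(\<lambda>_. 0) \<in> multilin_span M r" using zero_closed by (simp add: free_space_simps)
  show "\<And>a b. a \<in> multilin_span M r \<Longrightarrow> b \<in> multilin_span M r \<Longrightarrow>
          (\<lambda>l. a l + b l) \<in> multilin_span M r" using m_closed by (simp add: free_space_simps)
  show "\<And>k a. a \<in> multilin_span M r \<Longrightarrow> (\<lambda>l. k * a l) \<in> multilin_span M r"
    using smult_closed by (simp add: free_space_simps)
  show "\<And>a. a \<in> multilin_rels M r \<Longrightarrow> a \<in> multilin_span M r"
    unfolding multilin_span_def using F.in_own_span[OF multilin_rels_closed[OF assms]] by blast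
qed

lemma multilin_span_diff:
  assumes "module class_ring M" "a \<in> multilin_span M r" "b \<in> multilin_span M r"
  shows "(\<lambda>l. a l - b l) \<in> multilin_span M r"
  using multilin_span_add[OF assms(1,2) multilin_span_smult[OF assms(1,3), of "-1"]] by simp

lemma multilin_span_induct [consumes 2, case_names zero gen add smult]:
  assumes M: "module class_ring M" and n: "n \<in> multilin_span M r"
    and P: "P (\<lambda>_. 0)" "\<And>s. s \<in> multilin_rels M r \<Longrightarrow> P s"
      "\<And>a b. P a \<Longrightarrow> P b \<Longrightarrow> P (\<lambda>l. a l + b l)"
      "\<And>k a. P a \<Longrightarrow> P (\<lambda>l. k * a l)"
  shows "P n"
proof -
  interpret F: module class_ring "free_space (tuples M r)" by (rule free_space_module)
  show ?thesis
    using multilin_rels_closed[OF M] n[unfolded multilin_span_def]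
    by (induction rule: F.span_induct) (auto simp: free_space_simps intro: P)
qed

text \<open>
  Cosets are compared by differences. No membership of representatives in the free space is
  needed, since addition is pointwise and makes sense for all functions.
\<close>

lemma tensor_class_iff:
  "d \<in> tensor_class M r c \<longleftrightarrow> (\<lambda>l. d l - c l) \<in> multilin_span M r"
proof
  assume "d \<in> tensor_class M r c"
  then obtain n where "n \<in> multilin_span M r" "d = (\<lambda>l. n l + c l)"
    by (auto simp: tensor_class_def a_r_coset_def' free_space_simps)
  then show "(\<lambda>l. d l - c l) \<in> multilin_span M r" by simp
next
  assume "(\<lambda>l. d l - c l) \<in> multilin_span M r"
  then show "d \<in> tensor_class M r c"
    unfolding tensor_class_def a_r_coset_def' free_space_simps
    by (intro UN_I[of "\<lambda>l. d l - c l"]) auto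
qed

lemma tensor_class_eq_iff:
  assumes "module class_ring M"
  shows "tensor_class M r c = tensor_class M r d \<longleftrightarrow> (\<lambda>l. c l - d l) \<in> multilin_span M r"
proof
  assume "tensor_class M r c = tensor_class M r d"
  moreover have "c \<in> tensor_class M r c"
    using multilin_span_zero[OF assms] by (simp add: tensor_class_iff)
  ultimately show "(\<lambda>l. c l - d l) \<in> multilin_span M r" by (simp add: tensor_class_iff)
next
  assume cd: "(\<lambda>l. c l - d l) \<in> multilin_span M r"
  show "tensor_class M r c = tensor_class M r d"
  proof (intro equalityI subsetI)
    fix e assume "e \<in> tensor_class M r c"
    then show "e \<in> tensor_class M r d"
      using multilin_span_add[OF assms _ cd, of "\<lambda>l. e l - c l"] by (simp add: tensor_class_iff)
  next
    fix e assume "e \<in> tensor_class M r d"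
    then show "e \<in> tensor_class M r c"
      using multilin_span_diff[OF assms _ cd, of "\<lambda>l. e l - d l"] by (simp add: tensor_class_iff)
  qed
qed

lemma tensor_class_self: "module class_ring M \<Longrightarrow> c \<in> tensor_class M r c"
  using multilin_span_zero by (simp add: tensor_class_iff)

lemma tensor_power_carrier:
  "carrier (tensor_power M r) = tensor_class M r ` tuple_space M r"
  by (auto simp: tensor_power_def quot_module_def A_RCOSETS_def' tensor_class_def)

lemma tensor_power_zero:
  assumes "module class_ring M"
  shows "\<zero>\<^bsub>tensor_power M r\<^esub> = tensor_class M r (\<lambda>_. 0)"
  by (auto simp: tensor_power_def quot_module_def tensor_class_iff)

lemma tensor_power_add:
  assumes M: "module class_ring M"
  shows "tensor_class M r c \<oplus>\<^bsub>tensor_power M r\<^esub> tensor_class M r d = tensor_class M r (\<lambda>l. c l + d l)"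
proof -
  have add: "A \<oplus>\<^bsub>tensor_power M r\<^esub> B = {(\<lambda>l. a l + b l) | a b. a \<in> A \<and> b \<in> B}" for A B
    unfolding tensor_power_def quot_module_def set_add_def'
    by (simp add: free_space_simps) blast
  show ?thesis
  proof (intro equalityI subsetI)
    fix e assume "e \<in> tensor_class M r c \<oplus>\<^bsub>tensor_power M r\<^esub> tensor_class M r d"
    then obtain a b where ab: "a \<in> tensor_class M r c" "b \<in> tensor_class M r d" "e = (\<lambda>l. a l + b l)"
      unfolding add by blast
    have *: "(\<lambda>l. a l + b l - (c l + d l)) = (\<lambda>l. (a l - c l) + (b l - d l))" by auto
    show "e \<in> tensor_class M r (\<lambda>l. c l + d l)"
      using ab(1,2) unfolding tensor_class_iff ab(3) * by (rule multilin_span_add[OF M])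
  next
    fix e assume "e \<in> tensor_class M r (\<lambda>l. c l + d l)"
    then have "(\<lambda>l. e l - d l) \<in> tensor_class M r c"
      unfolding tensor_class_iff by (simp add: algebra_simps)
    moreover have "e = (\<lambda>l. (e l - d l) + d l)" by simp
    ultimately show "e \<in> tensor_class M r c \<oplus>\<^bsub>tensor_power M r\<^esub> tensor_class M r d"
      unfolding add using tensor_class_self[OF M, of d r] by fast
  qed
qed

lemma tensor_power_smult:
  assumes M: "module class_ring M"
  shows "k \<odot>\<^bsub>tensor_power M r\<^esub> tensor_class M r c = tensor_class M r (\<lambda>l. k * c l)"
proof -
  have "k \<odot>\<^bsub>tensor_power M r\<^esub> tensor_class M r c =
      (\<Union>a\<in>tensor_class M r c. tensor_class M r (\<lambda>l. k * a l))"
    by (simp add: tensor_power_def quot_module_def tensor_class_def free_space_simps)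
  also have "\<dots> = tensor_class M r (\<lambda>l. k * c l)"
  proof -
    have "tensor_class M r (\<lambda>l. k * a l) = tensor_class M r (\<lambda>l. k * c l)"
      if "a \<in> tensor_class M r c" for a
      using multilin_span_smult[OF M, of "\<lambda>l. a l - c l" r k] that
      by (simp add: tensor_class_iff tensor_class_eq_iff[OF M] right_diff_distrib)
    then show ?thesis using tensor_class_self[OF M] by blast
  qed
  finally show ?thesis .
qed

lemma tensor_power_module:
  assumes M: "module class_ring M"
  shows "module class_ring (tensor_power M r)"
  by (rule module_surj_image[OF free_space_module[of "tuples M r"], of "tensor_class M r"])
    (simp_all add: tensor_power_carrier tensor_power_add[OF M] tensor_power_smult[OF M]
      tensor_power_zero[OF M] free_space_simps)

lemma tensor_power_finsum:
  assumes M: "module class_ring M"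
    and c: "\<And>k. k \<in> K \<Longrightarrow> c k \<in> tuple_space M r"
  shows "finsum (tensor_power M r) (\<lambda>k. tensor_class M r (c k)) K =
    tensor_class M r (\<lambda>l. \<Sum>k\<in>K. c k l)"
proof -
  interpret T: module class_ring "tensor_power M r" by (rule tensor_power_module[OF M])
  have carr: "(\<lambda>k. tensor_class M r (c k)) \<in> K \<rightarrow> carrier (tensor_power M r)"
    using c by (auto simp: tensor_power_carrier)
  show ?thesis
    using c carr
  proof (induction K rule: infinite_finite_induct)
    case (insert x F)
    then show ?case
      by (subst T.finsum_insert) (auto simp: tensor_power_add[OF M])
  qed (simp_all add: tensor_power_zero[OF M])
qed

lemma pure_tensor_closed:
  assumes "module class_ring M" "set xs \<subseteq> carrier M"
  shows "pure_tensor M xs \<in> carrier (tensor_power M (length xs))"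
  using assms by (auto simp: pure_tensor_def tensor_power_carrier tuples_iff intro!: imageI delta_closed)

lemma delta_take_drop:
  "length xs = i \<Longrightarrow> delta xs (take i l) * delta ys (drop i l) = delta (xs @ ys) l"
  unfolding delta_def by (auto simp: append_eq_conv_conj) (metis append_take_drop_id)

text \<open>
  Concatenation with a fixed tuple on either side maps multilinearity relations to
  multilinearity relations. By linearity, products with an element of the span lie in the
  span, which makes the product of tensors independent of representatives.
\<close>

lemma multilin_span_concat_left:
  assumes M: "module class_ring M" and n: "n \<in> multilin_span M j"
    and xs: "xs \<in> tuples M i"
  shows "(\<lambda>l. delta xs (take i l) * n (drop i l)) \<in> multilin_span M (i + j)"
  using M n
proof (induction rule: multilin_span_induct)
  case zero
  then show ?case by (simp add: multilin_span_zero[OF M])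
next
  case (gen s)
  have len: "length xs = i" and car: "set xs \<subseteq> carrier M" using xs by (auto simp: tuples_iff)
  from gen show ?case
  proof (cases rule: multilin_rels_cases)
    case (sum us x y vs)
    have "(\<lambda>l. delta xs (take i l) * s (drop i l)) = (\<lambda>l. delta ((xs @ us) @ (x \<oplus>\<^bsub>M\<^esub> y) # vs) l
        - delta ((xs @ us) @ x # vs) l - delta ((xs @ us) @ y # vs) l)"
      by (simp add: sum(3) right_diff_distrib delta_take_drop[OF len])
    moreover have "(xs @ us) @ x # vs \<in> tuples M (i + j)"
      using sum(1) len car by (auto simp: tuples_iff)
    ultimately show ?thesis
      using sum(2) by (intro multilin_span_rels[OF M]) (unfold multilin_rels_def, blast)
  next
    case (scale us a x vs)
    have "(\<lambda>l. delta xs (take i l) * s (drop i l)) = (\<lambda>l. delta ((xs @ us) @ (a \<odot>\<^bsub>M\<^esub> x) # vs) l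
        - a * delta ((xs @ us) @ x # vs) l)"
      by (simp add: scale(2) right_diff_distrib mult.left_commute delta_take_drop[OF len])
    moreover have "(xs @ us) @ x # vs \<in> tuples M (i + j)"
      using scale(1) len car by (auto simp: tuples_iff)
    ultimately show ?thesis
      by (intro multilin_span_rels[OF M]) (unfold multilin_rels_def, blast)
  qed
next
  case (add a b)
  then show ?case using multilin_span_add[OF M] by (simp add: distrib_left)
next
  case (smult k a)
  then show ?case using multilin_span_smult[OF M, of _ _ k] by (simp add: mult.left_commute)
qed

lemma multilin_span_concat_right:
  assumes M: "module class_ring M" and n: "n \<in> multilin_span M i"
    and ys: "ys \<in> tuples M j"
  shows "(\<lambda>l. n (take i l) * delta ys (drop i l)) \<in> multilin_span M (i + j)"
  using M n
proof (induction rule: multilin_span_induct)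
  case zero
  then show ?case by (simp add: multilin_span_zero[OF M])
next
  case (gen s)
  have len: "length ys = j" and car: "set ys \<subseteq> carrier M" using ys by (auto simp: tuples_iff)
  from gen show ?case
  proof (cases rule: multilin_rels_cases)
    case (sum us x y vs)
    have li: "length (us @ z # vs) = i" for z using sum(1) by (simp add: tuples_iff)
    have "(\<lambda>l. s (take i l) * delta ys (drop i l)) = (\<lambda>l. delta (us @ (x \<oplus>\<^bsub>M\<^esub> y) # (vs @ ys)) l
        - delta (us @ x # (vs @ ys)) l - delta (us @ y # (vs @ ys)) l)"
      by (simp add: sum(3) left_diff_distrib delta_take_drop[OF li])
    moreover have "us @ x # (vs @ ys) \<in> tuples M (i + j)"
      using sum(1) len car by (auto simp: tuples_iff)
    ultimately show ?thesis
      using sum(2) by (intro multilin_span_rels[OF M]) (unfold multilin_rels_def, blast)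
  next
    case (scale us a x vs)
    have li: "length (us @ z # vs) = i" for z using scale(1) by (simp add: tuples_iff)
    have "(\<lambda>l. s (take i l) * delta ys (drop i l)) = (\<lambda>l. delta (us @ (a \<odot>\<^bsub>M\<^esub> x) # (vs @ ys)) l
        - a * delta (us @ x # (vs @ ys)) l)"
      by (simp add: scale(2) left_diff_distrib mult.assoc delta_take_drop[OF li])
    moreover have "us @ x # (vs @ ys) \<in> tuples M (i + j)"
      using scale(1) len car by (auto simp: tuples_iff)
    ultimately show ?thesis
      by (intro multilin_span_rels[OF M]) (unfold multilin_rels_def, blast)
  qed
next
  case (add a b)
  then show ?case using multilin_span_add[OF M] by (simp add: distrib_right)
next
  case (smult k a)
  then show ?case using multilin_span_smult[OF M, of _ _ k] by (simp add: mult.assoc)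
qed

lemma multilin_span_mult_left:
  assumes M: "module class_ring M" and n: "n \<in> multilin_span M j"
    and a: "a \<in> tuple_space M i"
  shows "(\<lambda>l. a (take i l) * n (drop i l)) \<in> multilin_span M (i + j)"
  using a
proof (induction rule: free_space_induct)
  case zero
  then show ?case by (simp add: multilin_span_zero[OF M])
next
  case (delta s)
  then show ?case using multilin_span_concat_left[OF M n] by simp
next
  case (add a b)
  then show ?case using multilin_span_add[OF M] by (simp add: distrib_right)
next
  case (smult k a)
  then show ?case using multilin_span_smult[OF M, of _ _ k] by (simp add: mult.assoc)
qed

lemma multilin_span_mult_right:
  assumes M: "module class_ring M" and n: "n \<in> multilin_span M i"
    and b: "b \<in> tuple_space M j"
  shows "(\<lambda>l. n (take i l) * b (drop i l)) \<in> multilin_span M (i + j)"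
  using b
proof (induction rule: free_space_induct)
  case zero
  then show ?case by (simp add: multilin_span_zero[OF M])
next
  case (delta s)
  then show ?case using multilin_span_concat_right[OF M n] by simp
next
  case (add a b)
  then show ?case using multilin_span_add[OF M] by (simp add: distrib_left)
next
  case (smult k a)
  then show ?case using multilin_span_smult[OF M, of _ _ k] by (simp add: mult.left_commute)
qed

lemma tensor_mult_class:
  assumes M: "module class_ring M"
    and a: "a \<in> tuple_space M i" and b: "b \<in> tuple_space M j"
  shows "tensor_mult M i j (tensor_class M i a) (tensor_class M j b) =
    tensor_class M (i + j) (\<lambda>l. a (take i l) * b (drop i l))"
proof -
  have eq: "tensor_class M (i + j) (\<lambda>l. a' (take i l) * b' (drop i l)) =
      tensor_class M (i + j) (\<lambda>l. a (take i l) * b (drop i l))"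
    if "a' \<in> tensor_class M i a" "b' \<in> tensor_class M j b" for a' b'
  proof -
    have n: "(\<lambda>l. a' l - a l) \<in> multilin_span M i" and m: "(\<lambda>l. b' l - b l) \<in> multilin_span M j"
      using that by (auto simp: tensor_class_iff)
    have "(\<lambda>l. b l + (b' l - b l)) \<in> tuple_space M j"
      using b m multilin_span_closed[OF M] by (intro free_space_add_closed) auto
    then have "b' \<in> tuple_space M j" by simp
    from multilin_span_mult_right[OF M n this] multilin_span_mult_left[OF M m a]
    show ?thesis
      unfolding tensor_class_eq_iff[OF M] by (auto dest: multilin_span_add[OF M] simp: algebra_simps)
  qed
  show ?thesis
    unfolding tensor_mult_def using eq tensor_class_self[OF M] by blast
qed


section \<open>The tensor algebra\<close>

text \<open>
  The underlying space of the free algebra on \<open>S\<close>: finitely supported functions on the words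
  in \<open>S\<close>.
\<close>

abbreviation words :: "'s set \<Rightarrow> ('s list \<Rightarrow> real) set" where
  "words S \<equiv> carrier (free_space (lists S))"

text \<open>
  The convolution product, the bilinear extension of concatenation of words. A word has
  finitely many splittings, so the product is defined and associative for arbitrary functions.
\<close>

definition conv :: "('s list \<Rightarrow> real) \<Rightarrow> ('s list \<Rightarrow> real) \<Rightarrow> 's list \<Rightarrow> real" where
  "conv a b = (\<lambda>l. \<Sum>i\<le>length l. a (take i l) * b (drop i l))"

text \<open>
  The free algebra on \<open>S\<close>; its unit is the empty word.
\<close>

definition free_algebra :: "'s set \<Rightarrow> (real, 's list \<Rightarrow> real) module" where
  "free_algebra S = (free_space (lists S))\<lparr>mult := conv, one := delta []\<rparr>"

lemma free_algebra_simps: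
  "carrier (free_algebra S) = words S"
  "\<zero>\<^bsub>free_algebra S\<^esub> = (\<lambda>_. 0)"
  "\<one>\<^bsub>free_algebra S\<^esub> = delta []"
  "a \<oplus>\<^bsub>free_algebra S\<^esub> b = (\<lambda>s. a s + b s)"
  "a \<otimes>\<^bsub>free_algebra S\<^esub> b = conv a b"
  "r \<odot>\<^bsub>free_algebra S\<^esub> a = (\<lambda>s. r * a s)"
  by (simp_all add: free_algebra_def free_space_def fun_module_def)

lemma conv_assoc: "conv (conv a b) c = conv a (conv b c)"
proof
  fix l :: "'a list"
  let ?n = "length l"
  let ?t = "\<lambda>k i. a (take k l) * b (take (i - k) (drop k l)) * c (drop i l)"
  have "conv (conv a b) c l = (\<Sum>i\<le>?n. \<Sum>k\<le>i. ?t k i)"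
    unfolding conv_def sum_distrib_right
    by (intro sum.cong refl) (auto simp: min_absorb1 min_absorb2 drop_take intro!: sum.cong)
  also have "\<dots> = (\<Sum>(i, k)\<in>(SIGMA i:{..?n}. {..i}). ?t k i)"
    by (simp add: sum.Sigma)
  \<comment> \<open>With \<open>i = k + m\<close>, both sides sum over the ways to cut the word into three parts.\<close>
  also have "\<dots> = (\<Sum>(k, m)\<in>(SIGMA k:{..?n}. {..?n - k}). ?t k (k + m))"
    by (rule sum.reindex_bij_witness[of _ "\<lambda>(k, m). (k + m, k)" "\<lambda>(i, k). (k, i - k)"]) auto
  also have "\<dots> = (\<Sum>k\<le>?n. \<Sum>m\<le>?n - k. ?t k (k + m))"
    by (simp add: sum.Sigma)
  also have "\<dots> = conv a (conv b c) l"
    unfolding conv_def sum_distrib_left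
    by (intro sum.cong refl) (auto simp: mult.assoc add.commute intro!: sum.cong)
  finally show "conv (conv a b) c l = conv a (conv b c) l" .
qed

lemma conv_delta_Nil_left: "conv (delta []) a = a"
proof
  fix l
  have "conv (delta []) a l = (\<Sum>i\<le>length l. if i = 0 then a l else 0)"
    unfolding conv_def by (intro sum.cong refl) (auto simp: delta_def)
  then show "conv (delta []) a l = a l" by simp
qed

lemma conv_delta_Nil_right: "conv a (delta []) = a"
proof
  fix l
  have "conv a (delta []) l = (\<Sum>i\<le>length l. if i = length l then a l else 0)"
    unfolding conv_def by (intro sum.cong refl) (auto simp: delta_def)
  then show "conv a (delta []) l = a l" by simp
qed

lemma conv_delta: "conv (delta xs) (delta ys) = delta (xs @ ys)"
proof
  fix l
  have "conv (delta xs) (delta ys) l =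
      (\<Sum>i\<le>length l. if i = length xs then delta (xs @ ys) l else 0)"
    unfolding conv_def
    by (intro sum.cong refl) (auto simp: delta_take_drop, auto simp: delta_def min_def split: if_splits)
  also have "\<dots> = delta (xs @ ys) l" by (auto simp: delta_def)
  finally show "conv (delta xs) (delta ys) l = delta (xs @ ys) l" .
qed

lemma conv_closed:
  assumes "a \<in> words S" "b \<in> words S"
  shows "conv a b \<in> words S"
proof -
  have *: "\<exists>i. a (take i l) \<noteq> 0 \<and> b (drop i l) \<noteq> 0" if "conv a b l \<noteq> 0" for l
  proof -
    from that obtain i where "a (take i l) * b (drop i l) \<noteq> 0"
      unfolding conv_def by (meson sum.neutral)
    then show ?thesis by auto
  qed
  have "{l. conv a b l \<noteq> 0} \<subseteq> (\<lambda>(x, y). x @ y) ` ({l. a l \<noteq> 0} \<times> {l. b l \<noteq> 0})"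
  proof
    fix l assume "l \<in> {l. conv a b l \<noteq> 0}"
    then obtain i where "a (take i l) \<noteq> 0" "b (drop i l) \<noteq> 0" using * by blast
    then show "l \<in> (\<lambda>(x, y). x @ y) ` ({l. a l \<noteq> 0} \<times> {l. b l \<noteq> 0})"
      by (intro image_eqI[of _ _ "(take i l, drop i l)"]) auto
  qed
  then have "finite {l. conv a b l \<noteq> 0}"
    using assms by (auto simp: free_space_carrier elim!: finite_subset)
  moreover have "l \<in> lists S" if nz: "conv a b l \<noteq> 0" for l
  proof -
    obtain i where "a (take i l) \<noteq> 0" "b (drop i l) \<noteq> 0" using *[OF nz] by blast
    then have "take i l \<in> lists S" "drop i l \<in> lists S"
      using assms by (auto simp: free_space_carrier)
    then show ?thesis using append_in_lists_conv[of "take i l" "drop i l" S] by simp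
  qed
  ultimately show ?thesis by (simp add: free_space_carrier)
qed

lemma free_algebra_module: "module class_ring (free_algebra S)"
  by (rule module_surj_image[OF free_space_module[of "lists S"], of "\<lambda>x. x"])
    (simp_all add: free_algebra_simps free_space_simps)

lemma free_algebra_ring: "ring (free_algebra S)"
proof (rule ringI)
  interpret module class_ring "free_algebra S" by (rule free_algebra_module)
  show "abelian_group (free_algebra S)" by (rule M.abelian_group_axioms)
  show "Group.monoid (free_algebra S)"
    by (rule Group.monoidI)
      (auto simp: free_algebra_simps conv_closed conv_assoc conv_delta_Nil_left
        conv_delta_Nil_right intro!: delta_closed)
qed (auto simp: free_algebra_simps conv_def distrib_left distrib_right sum.distrib)

text \<open>
  The homogeneous component of degree \<open>r\<close>.
\<close>

definition homog :: "nat \<Rightarrow> ('s list \<Rightarrow> real) \<Rightarrow> 's list \<Rightarrow> real" where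
  "homog r c = (\<lambda>l. if length l = r then c l else 0)"

text \<open>
  The homogeneous components of an element of the free algebra, read modulo the
  multilinearity relations, form an element of the tensor algebra. This presents the tensor
  algebra as a quotient of the free algebra, whose ring axioms it inherits.
\<close>

definition tensor_of :: "(real, 'v) module \<Rightarrow> ('v list \<Rightarrow> real) \<Rightarrow> nat \<Rightarrow> ('v list \<Rightarrow> real) set" where
  "tensor_of M c = (\<lambda>r. tensor_class M r (homog r c))"

lemma homog_closed:
  "c \<in> words (carrier M) \<Longrightarrow> homog r c \<in> tuple_space M r"
  by (auto simp: homog_def free_space_carrier tuples_iff elim: rev_finite_subset)

lemma homog_add: "homog r (\<lambda>l. a l + b l) = (\<lambda>l. homog r a l + homog r b l)"
  by (auto simp: homog_def)

lemma homog_smult: "homog r (\<lambda>l. k * a l) = (\<lambda>l. k * homog r a l)"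
  by (auto simp: homog_def)

lemma homog_zero: "homog r (\<lambda>_. 0) = (\<lambda>_. 0)"
  by (auto simp: homog_def)

lemma homog_conv:
  "homog r (conv a b) = (\<lambda>l. \<Sum>i\<le>r. homog i a (take i l) * homog (r - i) b (drop i l))"
proof
  fix l
  show "homog r (conv a b) l = (\<Sum>i\<le>r. homog i a (take i l) * homog (r - i) b (drop i l))"
  proof (cases "length l = r")
    case True
    then show ?thesis
      unfolding homog_def conv_def by (auto intro!: sum.cong)
  next
    case False
    then have "homog i a (take i l) * homog (r - i) b (drop i l) = 0" if "i \<le> r" for i
      using that by (auto simp: homog_def)
    then have "(\<Sum>i\<le>r. homog i a (take i l) * homog (r - i) b (drop i l)) = 0"
      by (intro sum.neutral) auto
    then show ?thesis using False by (simp add: homog_def)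
  qed
qed

lemma tensor_algebra_simps:
  "\<zero>\<^bsub>tensor_algebra M\<^esub> = (\<lambda>r. \<zero>\<^bsub>tensor_power M r\<^esub>)"
  "\<one>\<^bsub>tensor_algebra M\<^esub> = (\<lambda>r. if r = 0 then pure_tensor M [] else \<zero>\<^bsub>tensor_power M r\<^esub>)"
  "s \<oplus>\<^bsub>tensor_algebra M\<^esub> t = (\<lambda>r. s r \<oplus>\<^bsub>tensor_power M r\<^esub> t r)"
  "a \<odot>\<^bsub>tensor_algebra M\<^esub> t = (\<lambda>r. a \<odot>\<^bsub>tensor_power M r\<^esub> t r)"
  "s \<otimes>\<^bsub>tensor_algebra M\<^esub> t = (\<lambda>r. finsum (tensor_power M r)
                        (\<lambda>i. tensor_mult M i (r - i) (s i) (t (r - i))) {..r})"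
  "t \<in> carrier (tensor_algebra M) \<longleftrightarrow> (\<forall>r. t r \<in> carrier (tensor_power M r)) \<and>
                    finite {r. t r \<noteq> \<zero>\<^bsub>tensor_power M r\<^esub>}"
  by (simp_all add: tensor_algebra_def)

context
  fixes M :: "(real, 'v) module"
  assumes M: "module class_ring M"
begin

lemma tensor_of_zero: "tensor_of M (\<lambda>_. 0) = \<zero>\<^bsub>tensor_algebra M\<^esub>"
  by (simp add: tensor_of_def tensor_algebra_simps homog_zero tensor_power_zero[OF M])

lemma tensor_of_one: "tensor_of M (delta []) = \<one>\<^bsub>tensor_algebra M\<^esub>"
proof -
  have "homog r (delta [] :: 'v list \<Rightarrow> real) = (if r = 0 then delta [] else (\<lambda>_. 0))" for r :: nat
    by (auto simp: homog_def delta_def)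
  then show ?thesis
    unfolding tensor_of_def tensor_algebra_simps
    by (intro ext) (simp add: pure_tensor_def tensor_power_zero[OF M])
qed

lemma tensor_of_delta: "tensor_of M (delta [v]) = tensor_incl M v"
proof -
  have "homog r (delta [v]) = (if r = 1 then delta [v] else (\<lambda>_. 0))" for r :: nat
    by (auto simp: homog_def delta_def)
  then show ?thesis
    unfolding tensor_of_def tensor_incl_def
    by (intro ext) (simp add: pure_tensor_def tensor_power_zero[OF M])
qed

lemma tensor_of_add:
  "tensor_of M (\<lambda>l. a l + b l) = tensor_of M a \<oplus>\<^bsub>tensor_algebra M\<^esub> tensor_of M b"
  by (simp add: tensor_of_def tensor_algebra_simps homog_add tensor_power_add[OF M])

lemma tensor_of_smult:
  "tensor_of M (\<lambda>l. k * a l) = k \<odot>\<^bsub>tensor_algebra M\<^esub> tensor_of M a"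
  by (simp add: tensor_of_def tensor_algebra_simps homog_smult tensor_power_smult[OF M])

lemma tensor_of_conv:
  assumes a: "a \<in> words (carrier M)"
    and b: "b \<in> words (carrier M)"
  shows "tensor_of M (conv a b) = tensor_of M a \<otimes>\<^bsub>tensor_algebra M\<^esub> tensor_of M b"
proof
  fix r
  let ?p = "\<lambda>i l. homog i a (take i l) * homog (r - i) b (drop i l)"
  have mult: "tensor_mult M i (r - i) (tensor_class M i (homog i a)) (tensor_class M (r - i) (homog (r - i) b))
      = tensor_class M r (?p i)" if "i \<le> r" for i
    using tensor_mult_class[OF M homog_closed[OF a] homog_closed[OF b], of i "r - i"] that by simp
  have p: "?p i \<in> tuple_space M r" if "i \<le> r" for i
  proof -
    have "?p i = homog r (conv (homog i a) (homog (r - i) b))"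
      unfolding homog_conv
    proof
      fix l
      have "(\<Sum>k\<le>r. homog k (homog i a) (take k l) * homog (r - k) (homog (r - i) b) (drop k l)) =
          (\<Sum>k\<le>r. if k = i then ?p i l else 0)"
        using that by (intro sum.cong refl) (auto simp: homog_def)
      then show "?p i l = (\<Sum>k\<le>r. homog k (homog i a) (take k l) *
          homog (r - k) (homog (r - i) b) (drop k l))" using that by simp
    qed
    moreover have "homog k c \<in> words (carrier M)"
      if "c \<in> words (carrier M)" for k c
      using that by (auto simp: homog_def free_space_carrier elim: rev_finite_subset)
    ultimately show ?thesis using a b by (auto intro!: homog_closed conv_closed)
  qed
  have "(tensor_of M a \<otimes>\<^bsub>tensor_algebra M\<^esub> tensor_of M b) r =
      finsum (tensor_power M r) (\<lambda>i. tensor_class M r (?p i)) {..r}"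
    unfolding tensor_of_def tensor_algebra_simps
  proof (rule abelian_monoid.finsum_cong')
    interpret T: module class_ring "tensor_power M r" by (rule tensor_power_module[OF M])
    show "abelian_monoid (tensor_power M r)" by (rule T.M.abelian_monoid_axioms)
  qed (use p mult in \<open>auto simp: tensor_power_carrier\<close>)
  also have "\<dots> = tensor_of M (conv a b) r"
    unfolding tensor_of_def homog_conv by (rule tensor_power_finsum[OF M p]) simp
  finally show "tensor_of M (conv a b) r = (tensor_of M a \<otimes>\<^bsub>tensor_algebra M\<^esub> tensor_of M b) r" ..
qed

lemma tensor_of_surj:
  "tensor_of M ` words (carrier M) = carrier (tensor_algebra M)"
proof (intro equalityI subsetI)
  fix t assume "t \<in> tensor_of M ` words (carrier M)"
  then obtain c where c: "c \<in> words (carrier M)" "t = tensor_of M c" by blast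
  have "t r = \<zero>\<^bsub>tensor_power M r\<^esub>" if "r \<notin> length ` {l. c l \<noteq> 0}" for r
  proof -
    have "homog r c = (\<lambda>_. 0)" unfolding homog_def using that by (intro ext) auto
    then show ?thesis by (simp add: c(2) tensor_of_def tensor_power_zero[OF M])
  qed
  then have "{r. t r \<noteq> \<zero>\<^bsub>tensor_power M r\<^esub>} \<subseteq> length ` {l. c l \<noteq> 0}" by blast
  moreover have "finite {l. c l \<noteq> 0}" using c(1) by (simp add: free_space_carrier)
  ultimately have "finite {r. t r \<noteq> \<zero>\<^bsub>tensor_power M r\<^esub>}" by (meson finite_imageI finite_subset)
  then show "t \<in> carrier (tensor_algebra M)"
    using homog_closed[OF c(1)] by (auto simp: tensor_algebra_simps c(2) tensor_of_def tensor_power_carrier)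
next
  fix t assume t: "t \<in> carrier (tensor_algebra M)"
  let ?R = "{r. t r \<noteq> \<zero>\<^bsub>tensor_power M r\<^esub>}"
  have "\<forall>r. \<exists>d. d \<in> tuple_space M r \<and> t r = tensor_class M r d"
    using t by (auto simp: tensor_algebra_simps tensor_power_carrier)
  then obtain d where d: "\<And>r. d r \<in> tuple_space M r"
    "\<And>r. t r = tensor_class M r (d r)" by metis
  \<comment> \<open>The representatives of the finitely many nonzero components are put together.\<close>
  define c where "c = (\<lambda>l. if length l \<in> ?R then d (length l) l else 0)"
  have "{l. c l \<noteq> 0} \<subseteq> (\<Union>r\<in>?R. {l. d r l \<noteq> 0})" by (auto simp: c_def)
  moreover have "finite (\<Union>r\<in>?R. {l. d r l \<noteq> 0})"
    using t d(1) by (auto simp: tensor_algebra_simps free_space_carrier)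
  ultimately have "finite {l. c l \<noteq> 0}" by (rule finite_subset)
  moreover have "l \<in> lists (carrier M)" if "c l \<noteq> 0" for l
  proof -
    have "d (length l) l \<noteq> 0" using that by (auto simp: c_def split: if_splits)
    then show ?thesis using d(1)[of "length l"] by (auto simp: free_space_carrier tuples_iff)
  qed
  ultimately have c: "c \<in> words (carrier M)" by (simp add: free_space_carrier)
  have "tensor_of M c r = t r" for r
  proof (cases "r \<in> ?R")
    case True
    then have "homog r c = d r"
      using d(1)[of r] by (force simp: homog_def c_def free_space_carrier tuples_iff)
    then show ?thesis by (simp add: tensor_of_def d(2))
  next
    case False
    then have "homog r c = (\<lambda>_. 0)" by (auto simp: homog_def c_def)
    then show ?thesis using False by (simp add: tensor_of_def tensor_power_zero[OF M])
  qed
  then have "t = tensor_of M c" by auto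
  then show "t \<in> tensor_of M ` words (carrier M)" using c by blast
qed

lemma tensor_of_closed:
  "c \<in> words (carrier M) \<Longrightarrow> tensor_of M c \<in> carrier (tensor_algebra M)"
  using tensor_of_surj by blast

lemma tensor_algebra_module: "module class_ring (tensor_algebra M)"
  by (rule module_surj_image[OF free_algebra_module[of "carrier M"], of "tensor_of M"])
    (simp_all add: free_algebra_simps tensor_of_surj tensor_of_add tensor_of_smult tensor_of_zero)

lemma tensor_of_hom: "tensor_of M \<in> Ring.ring_hom (free_algebra (carrier M)) (tensor_algebra M)"
  by (rule ring_hom_memI)
    (simp_all add: free_algebra_simps tensor_of_closed tensor_of_conv tensor_of_add tensor_of_one)

lemma tensor_algebra_ring: "ring (tensor_algebra M)"
proof -
  interpret ring "free_algebra (carrier M)" by (rule free_algebra_ring)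
  have "ring (tensor_algebra M\<lparr>carrier := carrier (tensor_algebra M), zero := \<zero>\<^bsub>tensor_algebra M\<^esub>\<rparr>)"
    using ring_hom_imp_img_ring[OF tensor_of_hom]
    by (simp add: free_algebra_simps tensor_of_surj tensor_of_zero)
  then show ?thesis by simp
qed

lemma tensor_algebra_cases:
  assumes "t \<in> carrier (tensor_algebra M)"
  obtains c where "c \<in> words (carrier M)" "t = tensor_of M c"
  using assms tensor_of_surj by blast

lemma tensor_algebra_smult_mult:
  assumes "s \<in> carrier (tensor_algebra M)" "t \<in> carrier (tensor_algebra M)"
  shows "(k \<odot>\<^bsub>tensor_algebra M\<^esub> s) \<otimes>\<^bsub>tensor_algebra M\<^esub> t = k \<odot>\<^bsub>tensor_algebra M\<^esub> (s \<otimes>\<^bsub>tensor_algebra M\<^esub> t)"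
proof -
  obtain a b where a: "a \<in> words (carrier M)" "s = tensor_of M a"
    and b: "b \<in> words (carrier M)" "t = tensor_of M b"
    using assms by (metis tensor_algebra_cases)
  have "conv (\<lambda>l. k * a l) b = (\<lambda>l. k * conv a b l)"
    by (auto simp: conv_def sum_distrib_left mult.assoc)
  then show ?thesis
    unfolding a(2) b(2) tensor_of_smult[symmetric]
    by (metis a(1) b(1) free_space_smult_closed tensor_of_conv tensor_of_smult)
qed

lemma tensor_incl_closed: "v \<in> carrier M \<Longrightarrow> tensor_incl M v \<in> carrier (tensor_algebra M)"
  unfolding tensor_of_delta[symmetric] by (intro tensor_of_closed delta_closed) auto

end


section \<open>The Clifford algebra\<close>

text \<open>
  The elements \<open>v \<otimes> w + w \<otimes> v + 4 q(v, w)\<close> that generate the Clifford ideal.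
\<close>

definition clifford_gens ::
  "(real, 'v) module \<Rightarrow> ('v \<Rightarrow> 'v \<Rightarrow> real) \<Rightarrow> (nat \<Rightarrow> ('v list \<Rightarrow> real) set) set" where
  "clifford_gens M q = (let T = tensor_algebra M; e = tensor_incl M in
     {(e v \<otimes>\<^bsub>T\<^esub> e w) \<oplus>\<^bsub>T\<^esub> (e w \<otimes>\<^bsub>T\<^esub> e v) \<oplus>\<^bsub>T\<^esub> ((4 * q v w) \<odot>\<^bsub>T\<^esub> \<one>\<^bsub>T\<^esub>)
              | v w. v \<in> carrier M \<and> w \<in> carrier M})"

lemma clifford_ideal_gens: "clifford_ideal M q = Idl\<^bsub>tensor_algebra M\<^esub> (clifford_gens M q)"
  by (simp add: clifford_ideal_def clifford_gens_def Let_def)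

lemma clifford_algebra_simps:
  "carrier (clifford_algebra M q) = clifford_class M q ` carrier (tensor_algebra M)"
  "\<one>\<^bsub>clifford_algebra M q\<^esub> = clifford_class M q \<one>\<^bsub>tensor_algebra M\<^esub>"
  "k \<odot>\<^bsub>clifford_algebra M q\<^esub> A = (\<Union>t\<in>A. clifford_class M q (k \<odot>\<^bsub>tensor_algebra M\<^esub> t))"
  "\<zero>\<^bsub>clifford_algebra M q\<^esub> = clifford_ideal M q"
  by (auto simp: clifford_algebra_def FactRing_def clifford_class_def A_RCOSETS_def' Let_def)

context
  fixes M :: "(real, 'v) module" and q :: "'v \<Rightarrow> 'v \<Rightarrow> real"
  assumes M: "module class_ring M"
begin

lemma clifford_gens_closed: "clifford_gens M q \<subseteq> carrier (tensor_algebra M)"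
proof -
  interpret T: ring "tensor_algebra M" by (rule tensor_algebra_ring[OF M])
  show ?thesis
    by (auto simp: clifford_gens_def Let_def intro!: T.add.m_closed T.m_closed
        tensor_incl_closed[OF M] real_module_closed(2)[OF tensor_algebra_module[OF M]])
qed

lemma clifford_ideal_ideal: "ideal (clifford_ideal M q) (tensor_algebra M)"
proof -
  interpret T: ring "tensor_algebra M" by (rule tensor_algebra_ring[OF M])
  show ?thesis
    unfolding clifford_ideal_gens by (rule T.genideal_ideal[OF clifford_gens_closed])
qed

lemma clifford_class_hom:
  "clifford_class M q \<in> Ring.ring_hom (tensor_algebra M) (clifford_algebra M q)"
proof -
  interpret ideal "clifford_ideal M q" "tensor_algebra M" by (rule clifford_ideal_ideal)
  show ?thesis
    using rcos_ring_hom
    by (simp add: clifford_class_def[abs_def] clifford_algebra_def Ring.ring_hom_def Let_def)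
qed

lemma clifford_class_self:
  assumes "t \<in> carrier (tensor_algebra M)"
  shows "t \<in> clifford_class M q t"
proof -
  interpret ideal "clifford_ideal M q" "tensor_algebra M" by (rule clifford_ideal_ideal)
  show ?thesis unfolding clifford_class_def by (rule a_rcos_self[OF assms])
qed

text \<open>
  The scalar multiplication is well defined on cosets because the ideal is closed under
  scalars: \<open>k i = (k 1) i\<close>.
\<close>

lemma clifford_class_smult:
  assumes t: "t \<in> carrier (tensor_algebra M)"
  shows "clifford_class M q (k \<odot>\<^bsub>tensor_algebra M\<^esub> t) =
    k \<odot>\<^bsub>clifford_algebra M q\<^esub> clifford_class M q t"
proof -
  let ?T = "tensor_algebra M"
  interpret I: ideal "clifford_ideal M q" "tensor_algebra M" by (rule clifford_ideal_ideal)
  interpret T: module class_ring "tensor_algebra M" by (rule tensor_algebra_module[OF M])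
  have "clifford_class M q (k \<odot>\<^bsub>?T\<^esub> s) = clifford_class M q (k \<odot>\<^bsub>?T\<^esub> t)"
    if s: "s \<in> clifford_class M q t" for s
  proof -
    obtain i where i: "i \<in> clifford_ideal M q" "s = i \<oplus>\<^bsub>?T\<^esub> t"
      using s unfolding clifford_class_def a_r_coset_def' by blast
    have ic: "i \<in> carrier ?T" using i(1) I.a_subset by blast
    have "k \<odot>\<^bsub>?T\<^esub> i = (k \<odot>\<^bsub>?T\<^esub> \<one>\<^bsub>?T\<^esub>) \<otimes>\<^bsub>?T\<^esub> i"
      using ic by (simp add: tensor_algebra_smult_mult[OF M])
    then have ki: "k \<odot>\<^bsub>?T\<^esub> i \<in> clifford_ideal M q"
      using I.I_l_closed[OF i(1)] by (simp add: T.smult_closed)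
    have "k \<odot>\<^bsub>?T\<^esub> s = k \<odot>\<^bsub>?T\<^esub> i \<oplus>\<^bsub>?T\<^esub> k \<odot>\<^bsub>?T\<^esub> t"
      using ic t by (simp add: i(2) T.smult_r_distr)
    then have "k \<odot>\<^bsub>?T\<^esub> s \<in> clifford_class M q (k \<odot>\<^bsub>?T\<^esub> t)"
      using ki by (auto simp: clifford_class_def a_r_coset_def')
    then show ?thesis
      unfolding clifford_class_def
      using I.a_repr_independence'[of "k \<odot>\<^bsub>?T\<^esub> s" "k \<odot>\<^bsub>?T\<^esub> t"] t by (simp add: T.smult_closed)
  qed
  then have "k \<odot>\<^bsub>clifford_algebra M q\<^esub> clifford_class M q t =
      (\<Union>s\<in>clifford_class M q t. clifford_class M q (k \<odot>\<^bsub>?T\<^esub> t))"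
    unfolding clifford_algebra_simps by (rule SUP_cong[OF refl])
  then show ?thesis using clifford_class_self[OF t] by auto
qed

lemma clifford_algebra_module: "module class_ring (clifford_algebra M q)"
proof (rule module_surj_image[OF tensor_algebra_module[OF M], of "clifford_class M q"])
  interpret I: ideal "clifford_ideal M q" "tensor_algebra M" by (rule clifford_ideal_ideal)
  show "clifford_class M q \<zero>\<^bsub>tensor_algebra M\<^esub> = \<zero>\<^bsub>clifford_algebra M q\<^esub>"
    unfolding clifford_class_def clifford_algebra_simps using I.a_subset by simp
qed (auto simp: clifford_algebra_simps(1) ring_hom_add[OF clifford_class_hom] clifford_class_smult)

end


section \<open>Functoriality for linear isomorphisms\<close>

text \<open>
  The action of an injective map \<open>h\<close> on \<open>S\<close> on functions on words: a word in \<open>h ` S\<close> gets the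
  value of its preimage, every other word gets zero.
\<close>

definition pushforward :: "('a \<Rightarrow> 'b) \<Rightarrow> 'a set \<Rightarrow> ('a list \<Rightarrow> real) \<Rightarrow> 'b list \<Rightarrow> real" where
  "pushforward h S c = (\<lambda>l. if set l \<subseteq> h ` S then c (map (inv_into S h) l) else 0)"

lemma pushforward_map:
  assumes "inj_on h S" "set l \<subseteq> S"
  shows "pushforward h S c (map h l) = c l"
proof -
  have "map (inv_into S h) (map h l) = l"
    using assms by (auto simp: map_idI subset_iff)
  then show ?thesis using assms(2) by (auto simp: pushforward_def)
qed

lemma pushforward_outside: "\<not> set l \<subseteq> h ` S \<Longrightarrow> pushforward h S c l = 0"
  by (simp add: pushforward_def)

lemma word_in_image:
  assumes "set l \<subseteq> h ` S"
  obtains k where "set k \<subseteq> S" "l = map h k"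
proof
  show "set (map (inv_into S h) l) \<subseteq> S" using assms by (auto intro: inv_into_into)
  show "l = map h (map (inv_into S h) l)" using assms by (auto simp: map_idI f_inv_into_f subset_iff)
qed

text \<open>
  A function is determined by its values on relabelled words when it vanishes on all others;
  this characterises the pushforward and reduces its properties to computations on words.
\<close>

lemma pushforward_eqI:
  assumes "inj_on h S"
    and "\<And>l. set l \<subseteq> S \<Longrightarrow> d (map h l) = c l"
    and "\<And>l. \<not> set l \<subseteq> h ` S \<Longrightarrow> d l = 0"
  shows "pushforward h S c = d"
proof
  fix l
  show "pushforward h S c l = d l"
  proof (cases "set l \<subseteq> h ` S")
    case True
    then obtain k where "set k \<subseteq> S" "l = map h k" by (rule word_in_image)
    then show ?thesis using assms(1,2) by (simp add: pushforward_map)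
  qed (simp add: assms(3) pushforward_outside)
qed

lemma pushforward_compose:
  assumes "inj_on h S" "inj_on g (h ` S)"
  shows "pushforward g (h ` S) (pushforward h S c) = pushforward (g \<circ> h) S c"
proof (rule sym, rule pushforward_eqI)
  show "inj_on (g \<circ> h) S" by (rule comp_inj_on[OF assms])
  fix l assume "set l \<subseteq> S"
  moreover have "set (map h l) \<subseteq> h ` S" using calculation by auto
  ultimately show "pushforward g (h ` S) (pushforward h S c) (map (g \<circ> h) l) = c l"
    using pushforward_map[OF assms(2), of "map h l"] pushforward_map[OF assms(1), of l] by simp
qed (simp add: pushforward_outside image_comp)

lemma pushforward_cong:
  assumes "\<And>x. x \<in> S \<Longrightarrow> h x = h' x" "inj_on h S"
  shows "pushforward h S = pushforward h' S"
proof
  fix c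
  have "inj_on h' S" using assms by (simp add: inj_on_def)
  moreover have "h ` S = h' ` S" using assms(1) by (simp cong: image_cong)
  moreover have "pushforward h' S c (map h l) = c l" if l: "set l \<subseteq> S" for l
  proof -
    have eq: "map h l = map h' l" using l assms(1) by auto
    show ?thesis unfolding eq by (rule pushforward_map[OF \<open>inj_on h' S\<close> l])
  qed
  ultimately show "pushforward h S c = pushforward h' S c"
    by (intro pushforward_eqI[OF assms(2)]) (simp_all add: pushforward_outside)
qed

lemma pushforward_id:
  assumes "\<And>l. c l \<noteq> 0 \<Longrightarrow> set l \<subseteq> S"
  shows "pushforward (\<lambda>x. x) S c = c"
  by (rule pushforward_eqI) (use assms in auto)

lemma pushforward_inverse:
  assumes "inj_on h S" "\<And>l. c l \<noteq> 0 \<Longrightarrow> set l \<subseteq> S"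
  shows "pushforward (inv_into S h) (h ` S) (pushforward h S c) = c"
proof -
  have "inj_on (inv_into S h) (h ` S)" by (simp add: inj_on_inv_into)
  then have "pushforward (inv_into S h) (h ` S) (pushforward h S c) = pushforward (inv_into S h \<circ> h) S c"
    by (rule pushforward_compose[OF assms(1)])
  also have "\<dots> = pushforward (\<lambda>x. x) S c"
    using assms(1) by (subst pushforward_cong[of S "inv_into S h \<circ> h" "\<lambda>x. x"]) (auto simp: inj_on_def)
  also have "\<dots> = c" by (rule pushforward_id[OF assms(2)])
  finally show ?thesis .
qed

lemma pushforward_add: "pushforward h S (\<lambda>l. a l + b l) = (\<lambda>l. pushforward h S a l + pushforward h S b l)"
  and pushforward_diff: "pushforward h S (\<lambda>l. a l - b l) = (\<lambda>l. pushforward h S a l - pushforward h S b l)"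
  and pushforward_smult: "pushforward h S (\<lambda>l. k * a l) = (\<lambda>l. k * pushforward h S a l)"
  and pushforward_zero: "pushforward h S (\<lambda>_. 0) = (\<lambda>_. 0)"
  by (auto simp: pushforward_def)

lemma pushforward_sum:
  "pushforward h S (\<lambda>l. \<Sum>k\<in>K. c k l) = (\<lambda>l. \<Sum>k\<in>K. pushforward h S (c k) l)"
  by (auto simp: pushforward_def)

lemma pushforward_homog: "pushforward h S (homog r c) = homog r (pushforward h S c)"
  by (auto simp: pushforward_def homog_def)

lemma pushforward_conv: "pushforward h S (conv a b) = conv (pushforward h S a) (pushforward h S b)"
proof
  fix l
  show "pushforward h S (conv a b) l = conv (pushforward h S a) (pushforward h S b) l"
  proof (cases "set l \<subseteq> h ` S")
    case True
    then have "set (take i l) \<subseteq> h ` S" "set (drop i l) \<subseteq> h ` S" for i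
      using set_take_subset[of i l] set_drop_subset[of i l] by blast+
    then show ?thesis using True by (simp add: pushforward_def conv_def take_map drop_map)
  next
    case False
    have "pushforward h S a (take i l) * pushforward h S b (drop i l) = 0" for i
    proof -
      have "set l = set (take i l) \<union> set (drop i l)"
        by (metis append_take_drop_id set_append)
      then have "\<not> set (take i l) \<subseteq> h ` S \<or> \<not> set (drop i l) \<subseteq> h ` S" using False by auto
      then show ?thesis by (metis mult_zero_left mult_zero_right pushforward_outside)
    qed
    then show ?thesis using False by (simp add: conv_def pushforward_outside)
  qed
qed

lemma pushforward_delta:
  assumes "inj_on h S" "set xs \<subseteq> S"
  shows "pushforward h S (delta xs) = delta (map h xs)"
proof (rule pushforward_eqI[OF assms(1)])
  fix l assume "set l \<subseteq> S"
  then have "map h l = map h xs \<longleftrightarrow> l = xs"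
    using assms inj_on_map_eq_map[of h l xs] by (metis Un_least inj_on_subset)
  then show "delta (map h xs) (map h l) = delta xs l" by (simp add: delta_def)
next
  fix l assume "\<not> set l \<subseteq> h ` S"
  moreover have "set (map h xs) \<subseteq> h ` S" using assms(2) by auto
  ultimately show "delta (map h xs) l = 0" by (metis delta_def)
qed

lemma pushforward_closed:
  assumes "inj_on h S" "c \<in> words S"
  shows "pushforward h S c \<in> words (h ` S)"
proof -
  have supp: "l \<in> map h ` {k. c k \<noteq> 0}" if nz: "pushforward h S c l \<noteq> 0" for l
  proof -
    have "set l \<subseteq> h ` S" using nz pushforward_outside by metis
    then obtain k where k: "set k \<subseteq> S" "l = map h k" by (rule word_in_image)
    then show ?thesis using nz pushforward_map[OF assms(1) k(1)] by auto
  qed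
  have "finite {k. c k \<noteq> 0}" using assms(2) by (simp add: free_space_carrier)
  moreover have "{l. pushforward h S c l \<noteq> 0} \<subseteq> map h ` {k. c k \<noteq> 0}" using supp by blast
  ultimately have "finite {l. pushforward h S c l \<noteq> 0}" by (blast intro: finite_subset)
  moreover have "l \<in> lists (h ` S)" if "pushforward h S c l \<noteq> 0" for l
    using that pushforward_outside[of l h S c] by (auto simp: in_lists_conv_set)
  ultimately show ?thesis by (simp add: free_space_carrier)
qed

lemma sum_pure_tensors:
  assumes M: "module class_ring M"
    and len: "\<And>k. k \<in> K \<Longrightarrow> length (xs k) = r" and car: "\<And>k. k \<in> K \<Longrightarrow> set (xs k) \<subseteq> carrier M"
  shows "finsum (tensor_power M r) (\<lambda>k. pure_tensor M (xs k)) K =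
    tensor_class M r (\<lambda>l. \<Sum>k\<in>K. delta (xs k) l)"
proof -
  interpret T: module class_ring "tensor_power M r" by (rule tensor_power_module[OF M])
  have d: "delta (xs k) \<in> tuple_space M r" if "k \<in> K" for k
    using len[OF that] car[OF that] by (auto simp: tuples_iff intro!: delta_closed)
  have "finsum (tensor_power M r) (\<lambda>k. pure_tensor M (xs k)) K =
      finsum (tensor_power M r) (\<lambda>k. tensor_class M r (delta (xs k))) K"
    by (rule T.finsum_cong') (use len d in \<open>auto simp: pure_tensor_def tensor_power_carrier\<close>)
  also have "\<dots> = tensor_class M r (\<lambda>l. \<Sum>k\<in>K. delta (xs k) l)"
    by (rule tensor_power_finsum[OF M d])
  finally show ?thesis .
qed

lemma sum_pure_tensors_closed:
  assumes M: "module class_ring M"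
    and len: "\<And>k. k \<in> K \<Longrightarrow> length (xs k) = r" and car: "\<And>k. k \<in> K \<Longrightarrow> set (xs k) \<subseteq> carrier M"
  shows "finsum (tensor_power M r) (\<lambda>k. pure_tensor M (xs k)) K \<in> carrier (tensor_power M r)"
proof -
  have "delta (xs k) \<in> tuple_space M r" if "k \<in> K" for k
    using len[OF that] car[OF that] by (auto simp: tuples_iff intro!: delta_closed)
  then have "(\<lambda>l. \<Sum>k\<in>K. delta (xs k) l) \<in> tuple_space M r"
    by (rule free_space_sum_closed)
  then have "tensor_class M r (\<lambda>l. \<Sum>k\<in>K. delta (xs k) l) \<in> carrier (tensor_power M r)"
    by (simp add: tensor_power_carrier)
  then show ?thesis using sum_pure_tensors[OF M len car, of K] by simp
qed

text \<open>
  A linear isomorphism of real vector spaces. The values of \<open>h\<close> outside the carrier are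
  irrelevant.
\<close>

locale linear_iso =
  fixes M :: "(real, 'a) module" and M' :: "(real, 'b) module" and h :: "'a \<Rightarrow> 'b"
  assumes M: "module class_ring M" and M': "module class_ring M'"
    and add: "\<And>x y. x \<in> carrier M \<Longrightarrow> y \<in> carrier M \<Longrightarrow> h (x \<oplus>\<^bsub>M\<^esub> y) = h x \<oplus>\<^bsub>M'\<^esub> h y"
    and smult: "\<And>a x. x \<in> carrier M \<Longrightarrow> h (a \<odot>\<^bsub>M\<^esub> x) = a \<odot>\<^bsub>M'\<^esub> h x"
    and bij: "bij_betw h (carrier M) (carrier M')"
begin

lemma inj: "inj_on h (carrier M)" and image: "h ` carrier M = carrier M'"
  using bij by (simp_all add: bij_betw_def)

lemma mem: "x \<in> carrier M \<Longrightarrow> h x \<in> carrier M'"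
  using image by blast

lemma inverse: "linear_iso M' M (inv_into (carrier M) h)"
proof (rule linear_iso.intro)
  have inv: "inv_into (carrier M) h (h x) = x" if "x \<in> carrier M" for x
    using inj that by simp
  have ex: "\<exists>x. x \<in> carrier M \<and> y = h x" if "y \<in> carrier M'" for y
    using image that by blast
  show "inv_into (carrier M) h (x \<oplus>\<^bsub>M'\<^esub> y) = inv_into (carrier M) h x \<oplus>\<^bsub>M\<^esub> inv_into (carrier M) h y"
    if "x \<in> carrier M'" "y \<in> carrier M'" for x y
  proof -
    obtain u v where "u \<in> carrier M" "x = h u" "v \<in> carrier M" "y = h v"
      using ex \<open>x \<in> carrier M'\<close> \<open>y \<in> carrier M'\<close> by metis
    then show ?thesis
      by (simp add: inv add[symmetric] real_module_closed(1)[OF M])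
  qed
  show "inv_into (carrier M) h (a \<odot>\<^bsub>M'\<^esub> x) = a \<odot>\<^bsub>M\<^esub> inv_into (carrier M) h x"
    if "x \<in> carrier M'" for a x
  proof -
    obtain u where "u \<in> carrier M" "x = h u" using ex \<open>x \<in> carrier M'\<close> by metis
    then show ?thesis
      by (simp add: inv smult[symmetric] real_module_closed(2)[OF M])
  qed
  show "bij_betw (inv_into (carrier M) h) (carrier M') (carrier M)"
    by (rule bij_betw_inv_into[OF bij])
qed (rule M M')+

abbreviation push :: "('a list \<Rightarrow> real) \<Rightarrow> 'b list \<Rightarrow> real" where
  "push \<equiv> pushforward h (carrier M)"

lemma compose: "linear_iso M' N g \<Longrightarrow> linear_iso M N (g \<circ> h)"
proof (rule linear_iso.intro)
  assume g: "linear_iso M' N g"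
  then interpret g: linear_iso M' N g .
  show "module class_ring M" by (rule M)
  show "module class_ring N" by (rule g.M')
  show "bij_betw (g \<circ> h) (carrier M) (carrier N)" by (rule bij_betw_trans[OF bij g.bij])
  show "(g \<circ> h) (x \<oplus>\<^bsub>M\<^esub> y) = (g \<circ> h) x \<oplus>\<^bsub>N\<^esub> (g \<circ> h) y"
    if "x \<in> carrier M" "y \<in> carrier M" for x y
    using that by (simp add: add g.add mem)
  show "(g \<circ> h) (a \<odot>\<^bsub>M\<^esub> x) = a \<odot>\<^bsub>N\<^esub> (g \<circ> h) x" if "x \<in> carrier M" for a x
    using that by (simp add: smult g.smult mem)
qed

lemma cong_map: "(\<And>x. x \<in> carrier M \<Longrightarrow> h x = h' x) \<Longrightarrow> linear_iso M M' h'"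
proof (rule linear_iso.intro)
  assume eq: "\<And>x. x \<in> carrier M \<Longrightarrow> h x = h' x"
  show "bij_betw h' (carrier M) (carrier M')" using bij bij_betw_cong[of "carrier M" h h' "carrier M'"] eq by simp
  show "h' (x \<oplus>\<^bsub>M\<^esub> y) = h' x \<oplus>\<^bsub>M'\<^esub> h' y" if "x \<in> carrier M" "y \<in> carrier M" for x y
    using add[OF that] that real_module_closed(1)[OF M that] by (simp add: eq)
  show "h' (a \<odot>\<^bsub>M\<^esub> x) = a \<odot>\<^bsub>M'\<^esub> h' x" if "x \<in> carrier M" for a x
    using smult[OF that, of a] that real_module_closed(2)[OF M that, of a] by (simp add: eq)
qed (rule M M')+

lemma cancel:
  assumes "linear_iso M N (g \<circ> h)"
  shows "linear_iso M' N g"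
proof -
  interpret g: linear_iso M N "g \<circ> h" by (rule assms)
  interpret I: linear_iso M' M "inv_into (carrier M) h" by (rule inverse)
  have "linear_iso M' N ((g \<circ> h) \<circ> inv_into (carrier M) h)" by (rule I.compose[OF assms])
  then show ?thesis
    by (rule linear_iso.cong_map) (simp add: image f_inv_into_f)
qed

lemma is_module_hom: "h \<in> module_hom class_ring M M'"
  using add smult mem by (auto simp: module_hom_def)

lemma is_linear_map: "linear_map class_ring M M' h"
  using M M' is_module_hom
  unfolding linear_map_def mod_hom_def mod_hom_axioms_def vectorspace_iff_module by blast

lemma push_closed:
  "c \<in> words (carrier M) \<Longrightarrow> push c \<in> words (carrier M')"
  using pushforward_closed[OF inj] by (simp add: image)

lemma push_delta: "set xs \<subseteq> carrier M \<Longrightarrow> push (delta xs) = delta (map h xs)"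
  by (rule pushforward_delta[OF inj])

lemma push_push_inverse:
  assumes "\<And>l. c l \<noteq> 0 \<Longrightarrow> set l \<subseteq> carrier M'"
  shows "push (pushforward (inv_into (carrier M) h) (carrier M') c) = c"
proof -
  interpret I: linear_iso M' M "inv_into (carrier M) h" by (rule inverse)
  have "push (pushforward (inv_into (carrier M) h) (carrier M') c) =
      pushforward (h \<circ> inv_into (carrier M) h) (carrier M') c"
    using pushforward_compose[OF I.inj, of h c] inj by (simp add: I.image)
  also have "\<dots> = pushforward (\<lambda>x. x) (carrier M') c"
  proof -
    have "(h \<circ> inv_into (carrier M) h) y = y" if "y \<in> carrier M'" for y
      using that image f_inv_into_f[of y h "carrier M"] by simp
    then show ?thesis
      by (subst pushforward_cong[of _ "h \<circ> inv_into (carrier M) h" "\<lambda>x. x"]) (auto simp: inj_on_def)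
  qed
  also have "\<dots> = c" by (rule pushforward_id[OF assms])
  finally show ?thesis .
qed

lemma push_rels:
  assumes "c \<in> multilin_rels M r"
  shows "push c \<in> multilin_rels M' r"
proof -
  note cl = real_module_closed[OF M]
  have tup: "map h l \<in> tuples M' r" if "l \<in> tuples M r" for l
    using that mem by (auto simp: tuples_iff)
  from assms show ?thesis
  proof (cases rule: multilin_rels_cases)
    case (sum xs x y ys)
    have x: "x \<in> carrier M" "set xs \<subseteq> carrier M" "set ys \<subseteq> carrier M" using sum(1) by (auto simp: tuples_iff)
    have "push c = (\<lambda>l. delta (map h xs @ (h x \<oplus>\<^bsub>M'\<^esub> h y) # map h ys) l
        - delta (map h xs @ h x # map h ys) l - delta (map h xs @ h y # map h ys) l)"
      unfolding sum(3) pushforward_diff using x sum(2) by (simp add: push_delta cl add)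
    moreover have "map h xs @ h x # map h ys \<in> tuples M' r" using tup[OF sum(1)] by simp
    ultimately show ?thesis using mem[OF sum(2)] unfolding multilin_rels_def by blast
  next
    case (scale xs a x ys)
    have x: "x \<in> carrier M" "set xs \<subseteq> carrier M" "set ys \<subseteq> carrier M" using scale(1) by (auto simp: tuples_iff)
    have "push c = (\<lambda>l. delta (map h xs @ (a \<odot>\<^bsub>M'\<^esub> h x) # map h ys) l
        - a * delta (map h xs @ h x # map h ys) l)"
      unfolding scale(2) pushforward_diff pushforward_smult using x by (simp add: push_delta cl smult)
    moreover have "map h xs @ h x # map h ys \<in> tuples M' r" using tup[OF scale(1)] by simp
    ultimately show ?thesis unfolding multilin_rels_def by blast
  qed
qed

lemma push_span:
  assumes "c \<in> multilin_span M r"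
  shows "push c \<in> multilin_span M' r"
  using M assms
proof (induction rule: multilin_span_induct)
  case (gen s)
  then show ?case by (intro multilin_span_rels[OF M'] push_rels)
qed (simp_all add: pushforward_zero pushforward_add pushforward_smult multilin_span_zero[OF M']
    multilin_span_add[OF M'] multilin_span_smult[OF M'])

end

lemma multilin_span_supp:
  assumes "module class_ring M" "c \<in> multilin_span M r" "c l \<noteq> 0"
  shows "set l \<subseteq> carrier M"
  using multilin_span_closed[OF assms(1), of r] assms(2,3)
  by (auto simp: free_space_carrier tuples_iff dest!: subsetD)

lemma free_space_supp:
  "c \<in> words S \<Longrightarrow> c l \<noteq> 0 \<Longrightarrow> set l \<subseteq> S"
  by (auto simp: free_space_carrier)

text \<open>
  The map of tensor algebras induced by \<open>h\<close>, in each degree the image of a coset under the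
  pushforward.
\<close>

definition tensor_map :: "('v \<Rightarrow> 'w) \<Rightarrow> (real, 'v) module \<Rightarrow>
    (nat \<Rightarrow> ('v list \<Rightarrow> real) set) \<Rightarrow> nat \<Rightarrow> ('w list \<Rightarrow> real) set" where
  "tensor_map h M t = (\<lambda>r. pushforward h (carrier M) ` t r)"

text \<open>
  The map of Clifford algebras induced by \<open>h\<close>, the image of a coset under the map of tensor
  algebras. The forms do not occur in the definition; when \<open>h\<close> is a linear isomorphism that
  preserves them, cosets of the one Clifford ideal are mapped onto cosets of the other.
\<close>

definition clifford_map :: "('v \<Rightarrow> 'w) \<Rightarrow> (real, 'v) module \<Rightarrow>
    (nat \<Rightarrow> ('v list \<Rightarrow> real) set) set \<Rightarrow> (nat \<Rightarrow> ('w list \<Rightarrow> real) set) set" where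
  "clifford_map h M A = tensor_map h M ` A"

lemma clifford_map_cong:
  assumes "\<And>x. x \<in> carrier M \<Longrightarrow> h x = h' x" "inj_on h (carrier M)"
  shows "clifford_map h M = clifford_map h' M"
  using pushforward_cong[OF assms] by (intro ext) (simp add: clifford_map_def tensor_map_def[abs_def])

lemma clifford_map_compose:
  assumes h: "inj_on h (carrier M)" "h ` carrier M = carrier M'" and g: "inj_on g (carrier M')"
  shows "clifford_map g M' (clifford_map h M A) = clifford_map (g \<circ> h) M A"
  using pushforward_compose[OF h(1), of g] h(2) g
  by (simp add: clifford_map_def tensor_map_def image_image)

context linear_iso
begin

text \<open>
  Since \<open>h\<close> and its inverse both preserve the multilinearity span, the pushforward maps a
  coset \<^emph>\<open>onto\<close> the corresponding coset, so images of sets describe the induced map.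
\<close>

lemma push_class: "push ` tensor_class M r c = tensor_class M' r (push c)"
proof (intro equalityI subsetI)
  fix e assume "e \<in> push ` tensor_class M r c"
  then obtain d where d: "d \<in> tensor_class M r c" "e = push d" by blast
  then have "push (\<lambda>l. d l - c l) \<in> multilin_span M' r"
    by (intro push_span) (simp add: tensor_class_iff)
  then show "e \<in> tensor_class M' r (push c)" by (simp add: tensor_class_iff d(2) pushforward_diff)
next
  interpret I: linear_iso M' M "inv_into (carrier M) h" by (rule inverse)
  fix e assume "e \<in> tensor_class M' r (push c)"
  then have n: "(\<lambda>l. e l - push c l) \<in> multilin_span M' r" by (simp add: tensor_class_iff)
  let ?n = "\<lambda>l. e l - push c l"
  have inv: "push (I.push ?n) = ?n"
    by (rule push_push_inverse) (rule multilin_span_supp[OF M' n])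
  have "e = push (\<lambda>l. I.push ?n l + c l)" unfolding pushforward_add inv by simp
  moreover have "(\<lambda>l. I.push ?n l + c l) \<in> tensor_class M r c"
    using I.push_span[OF n] by (simp add: tensor_class_iff)
  ultimately show "e \<in> push ` tensor_class M r c" by blast
qed

lemma push_zero: "push ` \<zero>\<^bsub>tensor_power M r\<^esub> = \<zero>\<^bsub>tensor_power M' r\<^esub>"
  by (simp add: tensor_power_zero[OF M] tensor_power_zero[OF M'] push_class pushforward_zero)

lemma push_unit_smult:
  "push ` (k \<odot>\<^bsub>tensor_power M 0\<^esub> pure_tensor M []) = k \<odot>\<^bsub>tensor_power M' 0\<^esub> pure_tensor M' []"
  by (simp add: pure_tensor_def tensor_power_smult[OF M] tensor_power_smult[OF M'] push_class
      pushforward_smult push_delta)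

lemma push_sum_pure_tensors:
  assumes "\<And>k. k \<in> K \<Longrightarrow> length (xs k) = r \<and> set (xs k) \<subseteq> carrier M"
  shows "push ` finsum (tensor_power M r) (\<lambda>k. pure_tensor M (xs k)) K =
    finsum (tensor_power M' r) (\<lambda>k. pure_tensor M' (map h (xs k))) K"
proof -
  have xs: "length (xs k) = r" "set (xs k) \<subseteq> carrier M" "set (map h (xs k)) \<subseteq> carrier M'" if "k \<in> K" for k
    using assms[OF that] mem by auto
  have "push ` finsum (tensor_power M r) (\<lambda>k. pure_tensor M (xs k)) K =
      push ` tensor_class M r (\<lambda>l. \<Sum>k\<in>K. delta (xs k) l)"
    using sum_pure_tensors[OF M xs(1,2), of K] by simp
  also have "\<dots> = tensor_class M' r (\<lambda>l. \<Sum>k\<in>K. push (delta (xs k)) l)"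
    by (simp add: push_class pushforward_sum)
  also have "\<dots> = tensor_class M' r (\<lambda>l. \<Sum>k\<in>K. delta (map h (xs k)) l)"
    using xs(2) by (simp add: push_delta cong: sum.cong)
  also have "\<dots> = finsum (tensor_power M' r) (\<lambda>k. pure_tensor M' (map h (xs k))) K"
    by (rule sum_pure_tensors[OF M' _ xs(3), symmetric]) (simp_all add: xs(1))
  finally show ?thesis .
qed

lemma tensor_map_of: "tensor_map h M (tensor_of M c) = tensor_of M' (push c)"
  by (simp add: tensor_map_def tensor_of_def push_class pushforward_homog)

lemma tensor_map_closed:
  "t \<in> carrier (tensor_algebra M) \<Longrightarrow> tensor_map h M t \<in> carrier (tensor_algebra M')"
  by (metis M M' push_closed tensor_algebra_cases tensor_map_of tensor_of_closed)

lemma tensor_map_add: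
  assumes "s \<in> carrier (tensor_algebra M)" "t \<in> carrier (tensor_algebra M)"
  shows "tensor_map h M (s \<oplus>\<^bsub>tensor_algebra M\<^esub> t) =
    tensor_map h M s \<oplus>\<^bsub>tensor_algebra M'\<^esub> tensor_map h M t"
proof -
  obtain a b where "s = tensor_of M a" "t = tensor_of M b"
    using assms by (metis M tensor_algebra_cases)
  then show ?thesis
    by (simp add: tensor_map_of pushforward_add flip: tensor_of_add[OF M] tensor_of_add[OF M'])
qed

lemma tensor_map_smult:
  assumes "t \<in> carrier (tensor_algebra M)"
  shows "tensor_map h M (k \<odot>\<^bsub>tensor_algebra M\<^esub> t) = k \<odot>\<^bsub>tensor_algebra M'\<^esub> tensor_map h M t"
proof -
  obtain a where "t = tensor_of M a"
    using assms by (metis M tensor_algebra_cases)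
  then show ?thesis
    by (simp add: tensor_map_of pushforward_smult flip: tensor_of_smult[OF M] tensor_of_smult[OF M'])
qed

lemma tensor_map_mult:
  assumes "s \<in> carrier (tensor_algebra M)" "t \<in> carrier (tensor_algebra M)"
  shows "tensor_map h M (s \<otimes>\<^bsub>tensor_algebra M\<^esub> t) =
    tensor_map h M s \<otimes>\<^bsub>tensor_algebra M'\<^esub> tensor_map h M t"
proof -
  obtain a b where "s = tensor_of M a" "t = tensor_of M b"
    "a \<in> words (carrier M)" "b \<in> words (carrier M)"
    using assms by (metis M tensor_algebra_cases)
  then show ?thesis
    by (simp add: tensor_map_of pushforward_conv push_closed
        flip: tensor_of_conv[OF M] tensor_of_conv[OF M'])
qed

lemma tensor_map_one: "tensor_map h M \<one>\<^bsub>tensor_algebra M\<^esub> = \<one>\<^bsub>tensor_algebra M'\<^esub>"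
  using push_delta[of "[]"] by (simp add: tensor_map_of flip: tensor_of_one[OF M] tensor_of_one[OF M'])

lemma tensor_map_incl:
  "v \<in> carrier M \<Longrightarrow> tensor_map h M (tensor_incl M v) = tensor_incl M' (h v)"
  by (simp add: tensor_map_of push_delta flip: tensor_of_delta[OF M] tensor_of_delta[OF M'])

lemma tensor_map_hom: "tensor_map h M \<in> Ring.ring_hom (tensor_algebra M) (tensor_algebra M')"
  by (rule ring_hom_memI)
    (simp_all add: tensor_map_closed tensor_map_mult tensor_map_add tensor_map_one)

lemma tensor_map_inverse:
  assumes "t \<in> carrier (tensor_algebra M)"
  shows "tensor_map (inv_into (carrier M) h) M' (tensor_map h M t) = t"
proof -
  interpret I: linear_iso M' M "inv_into (carrier M) h" by (rule inverse)
  obtain a where a: "t = tensor_of M a" "a \<in> words (carrier M)"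
    using assms by (metis M tensor_algebra_cases)
  have "I.push (push a) = a"
    using pushforward_inverse[OF inj free_space_supp[OF a(2)]] by (simp add: image)
  then show ?thesis by (simp add: a(1) tensor_map_of I.tensor_map_of)
qed

lemma tensor_map_tensor_map_inverse:
  assumes "t \<in> carrier (tensor_algebra M')"
  shows "tensor_map h M (tensor_map (inv_into (carrier M) h) M' t) = t"
proof -
  interpret I: linear_iso M' M "inv_into (carrier M) h" by (rule inverse)
  obtain a where a: "t = tensor_of M' a" "a \<in> words (carrier M')"
    using assms by (metis M' tensor_algebra_cases)
  have "push (I.push a) = a" by (rule push_push_inverse) (rule free_space_supp[OF a(2)])
  then show ?thesis by (simp add: a(1) tensor_map_of I.tensor_map_of)
qed

end

text \<open>
  A linear isomorphism that preserves the forms \<open>q\<close> and \<open>q'\<close>. The forms are arbitrary functions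
  of two vectors, which suffices for the definition of the Clifford ideal.
\<close>

locale isometry = linear_iso M M' h
  for M :: "(real, 'a) module" and M' :: "(real, 'b) module" and h +
  fixes q :: "'a \<Rightarrow> 'a \<Rightarrow> real" and q' :: "'b \<Rightarrow> 'b \<Rightarrow> real"
  assumes form: "\<And>v w. v \<in> carrier M \<Longrightarrow> w \<in> carrier M \<Longrightarrow> q' (h v) (h w) = q v w"
begin

lemma inverse_isometry: "isometry M' M (inv_into (carrier M) h) q' q"
proof -
  interpret I: linear_iso M' M "inv_into (carrier M) h" by (rule inverse)
  show ?thesis
  proof
    fix v w assume vw: "v \<in> carrier M'" "w \<in> carrier M'"
    then have "h (inv_into (carrier M) h v) = v" "h (inv_into (carrier M) h w) = w"
      using image by (auto intro: f_inv_into_f)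
    then show "q (inv_into (carrier M) h v) (inv_into (carrier M) h w) = q' v w"
      using form[OF I.mem I.mem] vw by metis
  qed
qed

lemma tensor_map_gens: "tensor_map h M ` clifford_gens M q \<subseteq> clifford_gens M' q'"
proof
  interpret T: ring "tensor_algebra M" by (rule tensor_algebra_ring[OF M])
  fix x assume "x \<in> tensor_map h M ` clifford_gens M q"
  then obtain v w where vw: "v \<in> carrier M" "w \<in> carrier M"
    and x: "x = tensor_map h M
      (tensor_incl M v \<otimes>\<^bsub>tensor_algebra M\<^esub> tensor_incl M w \<oplus>\<^bsub>tensor_algebra M\<^esub>
       tensor_incl M w \<otimes>\<^bsub>tensor_algebra M\<^esub> tensor_incl M v \<oplus>\<^bsub>tensor_algebra M\<^esub>
       (4 * q v w) \<odot>\<^bsub>tensor_algebra M\<^esub> \<one>\<^bsub>tensor_algebra M\<^esub>)"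
    by (auto simp: clifford_gens_def Let_def)
  have "x = tensor_incl M' (h v) \<otimes>\<^bsub>tensor_algebra M'\<^esub> tensor_incl M' (h w) \<oplus>\<^bsub>tensor_algebra M'\<^esub>
       tensor_incl M' (h w) \<otimes>\<^bsub>tensor_algebra M'\<^esub> tensor_incl M' (h v) \<oplus>\<^bsub>tensor_algebra M'\<^esub>
       (4 * q' (h v) (h w)) \<odot>\<^bsub>tensor_algebra M'\<^esub> \<one>\<^bsub>tensor_algebra M'\<^esub>"
    unfolding x using vw
    by (simp add: tensor_map_add tensor_map_mult tensor_map_smult tensor_map_one tensor_map_incl
        form tensor_incl_closed[OF M] real_module_closed(2)[OF tensor_algebra_module[OF M]])
  then show "x \<in> clifford_gens M' q'"
    using mem vw unfolding clifford_gens_def Let_def by blast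
qed

lemma tensor_map_ideal_subset: "tensor_map h M ` clifford_ideal M q \<subseteq> clifford_ideal M' q'"
proof -
  interpret T: ring "tensor_algebra M" by (rule tensor_algebra_ring[OF M])
  interpret T': ring "tensor_algebra M'" by (rule tensor_algebra_ring[OF M'])
  interpret h: ring_hom_ring "tensor_algebra M" "tensor_algebra M'" "tensor_map h M"
    by (rule ring_hom_ringI2[OF T.ring_axioms T'.ring_axioms tensor_map_hom])
  have "clifford_ideal M q \<subseteq> {t \<in> carrier (tensor_algebra M). tensor_map h M t \<in> clifford_ideal M' q'}"
    unfolding clifford_ideal_gens[of M]
  proof (rule T.genideal_minimal)
    show "ideal {t \<in> carrier (tensor_algebra M). tensor_map h M t \<in> clifford_ideal M' q'} (tensor_algebra M)"
      by (rule h.ideal_vimage[OF clifford_ideal_ideal[OF M']])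
    show "clifford_gens M q \<subseteq> {t \<in> carrier (tensor_algebra M). tensor_map h M t \<in> clifford_ideal M' q'}"
      using tensor_map_gens T'.genideal_self[OF clifford_gens_closed[OF M']] clifford_gens_closed[OF M]
      unfolding clifford_ideal_gens by blast
  qed
  then show ?thesis by blast
qed

text \<open>
  An isometry and its inverse both preserve the generators of the Clifford ideal, so the
  coset of \<open>t\<close> is mapped onto the coset of the image of \<open>t\<close>.
\<close>

lemma clifford_map_class:
  assumes t: "t \<in> carrier (tensor_algebra M)"
  shows "clifford_map h M (clifford_class M q t) = clifford_class M' q' (tensor_map h M t)"
proof (intro equalityI subsetI)
  interpret I: ideal "clifford_ideal M q" "tensor_algebra M" by (rule clifford_ideal_ideal[OF M])
  fix x assume "x \<in> clifford_map h M (clifford_class M q t)"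
  then obtain i where i: "i \<in> clifford_ideal M q" "x = tensor_map h M (i \<oplus>\<^bsub>tensor_algebra M\<^esub> t)"
    by (auto simp: clifford_map_def clifford_class_def a_r_coset_def')
  have "x = tensor_map h M i \<oplus>\<^bsub>tensor_algebra M'\<^esub> tensor_map h M t"
    using i I.a_subset t by (auto intro: tensor_map_add)
  then show "x \<in> clifford_class M' q' (tensor_map h M t)"
    using i(1) tensor_map_ideal_subset by (auto simp: clifford_class_def a_r_coset_def')
next
  interpret J: isometry M' M "inv_into (carrier M) h" q' q by (rule inverse_isometry)
  interpret I: ideal "clifford_ideal M q" "tensor_algebra M" by (rule clifford_ideal_ideal[OF M])
  interpret I': ideal "clifford_ideal M' q'" "tensor_algebra M'" by (rule clifford_ideal_ideal[OF M'])
  let ?k = "tensor_map (inv_into (carrier M) h) M'"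
  fix x assume "x \<in> clifford_class M' q' (tensor_map h M t)"
  then obtain i where i: "i \<in> clifford_ideal M' q'"
    "x = i \<oplus>\<^bsub>tensor_algebra M'\<^esub> tensor_map h M t"
    by (auto simp: clifford_class_def a_r_coset_def')
  have ki: "?k i \<in> clifford_ideal M q" using J.tensor_map_ideal_subset i(1) by blast
  have ic: "i \<in> carrier (tensor_algebra M')" using i(1) I'.a_subset by blast
  have hk: "tensor_map h M (?k i) = i" by (rule tensor_map_tensor_map_inverse[OF ic])
  have "x = tensor_map h M (?k i \<oplus>\<^bsub>tensor_algebra M\<^esub> t)"
    using ki I.a_subset t by (subst tensor_map_add) (auto simp: hk i(2))
  then show "x \<in> clifford_map h M (clifford_class M q t)"
    using ki by (auto simp: clifford_map_def clifford_class_def a_r_coset_def')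
qed

lemma clifford_map_iso: "linear_iso (clifford_algebra M q) (clifford_algebra M' q') (clifford_map h M)"
proof (rule linear_iso.intro)
  show "module class_ring (clifford_algebra M q)" by (rule clifford_algebra_module[OF M])
  show "module class_ring (clifford_algebra M' q')" by (rule clifford_algebra_module[OF M'])
  interpret J: isometry M' M "inv_into (carrier M) h" q' q by (rule inverse_isometry)
  interpret T: module class_ring "tensor_algebra M" by (rule tensor_algebra_module[OF M])
  have ex: "\<exists>t. t \<in> carrier (tensor_algebra M) \<and> x = clifford_class M q t"
    if "x \<in> carrier (clifford_algebra M q)" for x
    using that by (auto simp: clifford_algebra_simps)
  show "clifford_map h M (x \<oplus>\<^bsub>clifford_algebra M q\<^esub> y) =
      clifford_map h M x \<oplus>\<^bsub>clifford_algebra M' q'\<^esub> clifford_map h M y"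
    if xy: "x \<in> carrier (clifford_algebra M q)" "y \<in> carrier (clifford_algebra M q)" for x y
  proof -
    obtain s t where st: "s \<in> carrier (tensor_algebra M)" "x = clifford_class M q s"
      "t \<in> carrier (tensor_algebra M)" "y = clifford_class M q t" using ex xy by metis
    then show ?thesis
      by (simp add: clifford_map_class tensor_map_add tensor_map_closed ring_hom_add[OF clifford_class_hom[OF M']]
          flip: ring_hom_add[OF clifford_class_hom[OF M]])
  qed
  show "clifford_map h M (a \<odot>\<^bsub>clifford_algebra M q\<^esub> x) =
      a \<odot>\<^bsub>clifford_algebra M' q'\<^esub> clifford_map h M x"
    if x: "x \<in> carrier (clifford_algebra M q)" for a x
  proof -
    obtain s where "s \<in> carrier (tensor_algebra M)" "x = clifford_class M q s" using ex x by metis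
    then show ?thesis
      by (simp add: clifford_map_class tensor_map_smult tensor_map_closed T.smult_closed
          clifford_class_smult[OF M'] flip: clifford_class_smult[OF M])
  qed
  show "bij_betw (clifford_map h M) (carrier (clifford_algebra M q)) (carrier (clifford_algebra M' q'))"
  proof (rule bij_betw_imageI)
    have "clifford_map (inv_into (carrier M) h) M' (clifford_map h M x) = x"
      if x: "x \<in> carrier (clifford_algebra M q)" for x
    proof -
      obtain s where "s \<in> carrier (tensor_algebra M)" "x = clifford_class M q s" using ex x by metis
      then show ?thesis
        by (simp add: clifford_map_class J.clifford_map_class tensor_map_closed tensor_map_inverse)
    qed
    then show "inj_on (clifford_map h M) (carrier (clifford_algebra M q))" by (metis inj_onI)
    have "tensor_map h M ` carrier (tensor_algebra M) = carrier (tensor_algebra M')"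
    proof (intro equalityI subsetI)
      fix t assume t: "t \<in> carrier (tensor_algebra M')"
      show "t \<in> tensor_map h M ` carrier (tensor_algebra M)"
        using tensor_map_tensor_map_inverse[OF t] J.tensor_map_closed[OF t] by (metis image_eqI)
    qed (auto simp: tensor_map_closed)
    then show "clifford_map h M ` carrier (clifford_algebra M q) = carrier (clifford_algebra M' q')"
      unfolding clifford_algebra_simps
      by (auto simp: image_image clifford_map_class tensor_map_closed) (metis (no_types, lifting) imageE image_eqI clifford_map_class)
  qed
qed

lemma clifford_map_ring_hom:
  "clifford_map h M \<in> Ring.ring_hom (clifford_algebra M q) (clifford_algebra M' q')"
proof (rule ring_hom_memI)
  interpret C: linear_iso "clifford_algebra M q" "clifford_algebra M' q'" "clifford_map h M"
    by (rule clifford_map_iso)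
  interpret T: ring "tensor_algebra M" by (rule tensor_algebra_ring[OF M])
  note hom = clifford_class_hom[OF M, of q] and hom' = clifford_class_hom[OF M', of q']
  show "clifford_map h M (x \<otimes>\<^bsub>clifford_algebra M q\<^esub> y) =
      clifford_map h M x \<otimes>\<^bsub>clifford_algebra M' q'\<^esub> clifford_map h M y"
    if xy: "x \<in> carrier (clifford_algebra M q)" "y \<in> carrier (clifford_algebra M q)" for x y
  proof -
    from xy obtain s t where "s \<in> carrier (tensor_algebra M)" "x = clifford_class M q s"
      "t \<in> carrier (tensor_algebra M)" "y = clifford_class M q t"
      unfolding clifford_algebra_simps by blast
    then show ?thesis
      by (simp add: clifford_map_class tensor_map_mult tensor_map_closed ring_hom_mult[OF hom']
          flip: ring_hom_mult[OF hom])
  qed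
  show "clifford_map h M \<one>\<^bsub>clifford_algebra M q\<^esub> = \<one>\<^bsub>clifford_algebra M' q'\<^esub>"
    by (simp add: clifford_algebra_simps clifford_map_class tensor_map_one)
qed (simp_all add: linear_iso.add[OF clifford_map_iso] linear_iso.mem[OF clifford_map_iso])

end

text \<open>
  The Clifford algebra is generated by the vectors, so a homomorphism is determined by its
  values on them.
\<close>

lemma clifford_hom_eqI:
  assumes M: "module class_ring M"
    and hom: "\<phi> \<in> Ring.ring_hom (clifford_algebra M q) N" "\<psi> \<in> Ring.ring_hom (clifford_algebra M q) N"
    and lin: "\<phi> \<in> module_hom class_ring (clifford_algebra M q) N"
      "\<psi> \<in> module_hom class_ring (clifford_algebra M q) N"
    and vec: "\<And>v. v \<in> carrier M \<Longrightarrow> \<phi> (clifford_class M q (tensor_incl M v)) =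
        \<psi> (clifford_class M q (tensor_incl M v))"
    and x: "x \<in> carrier (clifford_algebra M q)"
  shows "\<phi> x = \<psi> x"
proof -
  define e where "e = clifford_class M q \<circ> tensor_of M"
  have e: "e \<in> Ring.ring_hom (free_algebra (carrier M)) (clifford_algebra M q)"
    unfolding e_def by (rule ring_hom_trans[OF tensor_of_hom[OF M] clifford_class_hom[OF M]])
  note mem = ring_hom_closed[OF e, unfolded free_algebra_simps]
  have smult: "e (\<lambda>l. k * a l) = k \<odot>\<^bsub>clifford_algebra M q\<^esub> e a"
    if "a \<in> words (carrier M)" for k a
    using that by (simp add: e_def tensor_of_smult[OF M] clifford_class_smult[OF M] tensor_of_closed[OF M])
  have word: "\<phi> (e (delta l)) = \<psi> (e (delta l))" if "l \<in> lists (carrier M)" for l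
    using that
  proof induction
    case Nil
    show ?case
      using ring_hom_one[OF e] ring_hom_one[OF hom(1)] ring_hom_one[OF hom(2)]
      by (simp add: free_algebra_simps)
  next
    case (Cons v l)
    then have d: "delta [v] \<in> words (carrier M)"
      "delta l \<in> words (carrier M)"
      by (auto intro: delta_closed)
    have "e (delta (v # l)) = e (delta [v]) \<otimes>\<^bsub>clifford_algebra M q\<^esub> e (delta l)"
      using ring_hom_mult[OF e, unfolded free_algebra_simps, OF d] by (simp add: conv_delta)
    moreover have "\<phi> (e (delta [v])) = \<psi> (e (delta [v]))"
      using vec[OF Cons.hyps(1)] by (simp add: e_def tensor_of_delta[OF M])
    ultimately show ?case
      using Cons.IH by (simp add: ring_hom_mult[OF hom(1)] ring_hom_mult[OF hom(2)] mem[OF d(1)] mem[OF d(2)])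
  qed
  have "\<phi> (e c) = \<psi> (e c)" if "c \<in> words (carrier M)" for c
    using that
  proof (induction rule: free_space_induct)
    case zero
    \<comment> \<open>The zero function is a multiple of the empty word.\<close>
    have "delta [] \<in> words (carrier M)" by (rule delta_closed) simp
    then show ?case
      using smult[of "delta []" 0] word[of "[]"]
      by (simp add: module_hom_smult[OF lin(1)] module_hom_smult[OF lin(2)] mem)
  next
    case (add a b)
    then show ?case
      using ring_hom_add[OF e, unfolded free_algebra_simps, of a b]
      by (simp add: ring_hom_add[OF hom(1)] ring_hom_add[OF hom(2)] mem)
  qed (simp_all add: word smult module_hom_smult[OF lin(1)] module_hom_smult[OF lin(2)] mem)
  moreover obtain t where t: "t \<in> carrier (tensor_algebra M)" "x = clifford_class M q t"
    using x unfolding clifford_algebra_simps by blast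
  moreover obtain c where "c \<in> words (carrier M)" "t = tensor_of M c"
    using t(1) by (rule tensor_algebra_cases[OF M])
  ultimately show ?thesis by (simp add: e_def)
qed

lemma (in isometry) clifford_map_unique:
  assumes "\<phi> \<in> Ring.ring_hom (clifford_algebra M q) (clifford_algebra M' q')"
    and "\<phi> \<in> module_hom class_ring (clifford_algebra M q) (clifford_algebra M' q')"
    and "\<And>v. v \<in> carrier M \<Longrightarrow> \<phi> (clifford_class M q (tensor_incl M v)) =
        clifford_class M' q' (tensor_incl M' (h v))"
    and "x \<in> carrier (clifford_algebra M q)"
  shows "\<phi> x = clifford_map h M x"
proof (rule clifford_hom_eqI[OF M assms(1) clifford_map_ring_hom assms(2)
      linear_iso.is_module_hom[OF clifford_map_iso] _ assms(4)])
  fix v assume v: "v \<in> carrier M"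
  show "\<phi> (clifford_class M q (tensor_incl M v)) = clifford_map h M (clifford_class M q (tensor_incl M v))"
    unfolding assms(3)[OF v] clifford_map_class[OF tensor_incl_closed[OF M v]] tensor_map_incl[OF v] ..
qed

lemma transport_simps:
  assumes "inj_on h (carrier M)"
  shows "carrier (transport h M) = h ` carrier M"
    and "\<zero>\<^bsub>transport h M\<^esub> = h \<zero>\<^bsub>M\<^esub>" and "\<one>\<^bsub>transport h M\<^esub> = h \<one>\<^bsub>M\<^esub>"
    and "x \<in> carrier M \<Longrightarrow> y \<in> carrier M \<Longrightarrow> h x \<oplus>\<^bsub>transport h M\<^esub> h y = h (x \<oplus>\<^bsub>M\<^esub> y)"
    and "x \<in> carrier M \<Longrightarrow> y \<in> carrier M \<Longrightarrow> h x \<otimes>\<^bsub>transport h M\<^esub> h y = h (x \<otimes>\<^bsub>M\<^esub> y)"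
    and "x \<in> carrier M \<Longrightarrow> k \<odot>\<^bsub>transport h M\<^esub> h x = h (k \<odot>\<^bsub>M\<^esub> x)"
  using assms by (simp_all add: transport_def Let_def)

lemma transport_iso:
  assumes M: "module class_ring M" and inj: "inj_on h (carrier M)"
  shows "linear_iso M (transport h M) h"
proof (rule linear_iso.intro)
  show "module class_ring (transport h M)"
    by (rule module_surj_image[OF M, of h]) (simp_all add: transport_simps[OF inj])
  show "bij_betw h (carrier M) (carrier (transport h M))"
    using inj by (simp add: bij_betw_def transport_simps)
qed (simp_all add: M transport_simps[OF inj])


section \<open>Plots\<close>

abbreviation open_in :: "nat \<Rightarrow> (nat \<Rightarrow> real) set \<Rightarrow> bool" where
  "open_in n \<equiv> openin (Euclidean_space n)"

lemma Ck_on_const: "Ck_on k n U (\<lambda>_. c)"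
proof (induction k arbitrary: c)
  case (Suc k)
  then show ?case by (auto intro!: exI[of _ "\<lambda>_. 0"])
qed simp

lemma Ck_on_coord: "Ck_on k n U (\<lambda>x. x i)"
proof -
  have cont: "continuous_map (subtopology (Euclidean_space n) U) euclideanreal (\<lambda>x. x i)"
    unfolding Euclidean_space_def
    by (intro continuous_map_from_subtopology continuous_map_product_projection) simp
  show ?thesis
  proof (cases k)
    case (Suc k')
    have "((\<lambda>t. (x(j := t)) i) has_real_derivative (if i = j then 1 else 0)) (at (x j))" for x :: "nat \<Rightarrow> real" and j
      by (cases "i = j") auto
    then have "\<exists>f'. Ck_on k' n U f' \<and>
        (\<forall>x\<in>U. ((\<lambda>t. (x(j := t)) i) has_real_derivative f' x) (at (x j)))" for j
      by (intro exI[of _ "\<lambda>_. if i = j then 1 else 0"] conjI ballI Ck_on_const)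
    then show ?thesis unfolding Suc Ck_on.simps using cont by blast
  qed (use cont in simp)
qed

lemma Ck_on_subset: "Ck_on k n U f \<Longrightarrow> W \<subseteq> U \<Longrightarrow> Ck_on k n W f"
proof (induction k arbitrary: f)
  case 0
  then show ?case by (auto intro: continuous_map_from_subtopology_mono)
next
  case (Suc k)
  then show ?case
    by (auto intro: continuous_map_from_subtopology_mono) (meson subsetD)
qed

lemma real_plot_restrict:
  "plots real_dspace n U c \<Longrightarrow> open_in n W \<Longrightarrow> W \<subseteq> U \<Longrightarrow> plots real_dspace n W c"
  by (auto simp: real_dspace_def smooth_fun_def intro: Ck_on_subset)

lemma
  assumes "diffeological_space D" "plots D n U p"
  shows plot_open: "open_in n U" and plot_range: "u \<in> U \<Longrightarrow> p u \<in> points D"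
proof -
  have "\<forall>n U p. plots D n U p \<longrightarrow> open_in n U \<and> p ` U \<subseteq> points D"
    using assms(1) unfolding diffeological_space_def by (rule conjunct1)
  then have "open_in n U \<and> p ` U \<subseteq> points D" using assms(2) by metis
  then show "open_in n U" and "u \<in> U \<Longrightarrow> p u \<in> points D" by auto
qed

lemma plot_restrict:
  assumes D: "diffeological_space D" and p: "plots D n U p"
    and W: "open_in n W" "W \<subseteq> U"
  shows "plots D n W p"
proof -
  have "smooth_between n W n U (\<lambda>x. x)"
    using W(2) by (auto simp: smooth_between_def smooth_fun_def Ck_on_coord)
  then have "plots D n W (p \<circ> (\<lambda>x. x))"
    using D p W(1) unfolding diffeological_space_def by metis
  then show ?thesis by (simp add: comp_def)
qed

lemma locally_of_open: "locally_of P n U p \<Longrightarrow> open_in n U"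
  by (simp add: locally_of_def)

lemma locally_ofD:
  assumes "locally_of P n U p" "u \<in> U"
  shows "\<exists>W q. open_in n W \<and> u \<in> W \<and> W \<subseteq> U \<and> P n W q \<and> (\<forall>w\<in>W. p w = q w)"
  using assms unfolding locally_of_def by blast

lemma locally_ofI:
  assumes "open_in n U"
    and "\<And>u. u \<in> U \<Longrightarrow> \<exists>W q. open_in n W \<and> u \<in> W \<and> W \<subseteq> U \<and> P n W q \<and> (\<forall>w\<in>W. p w = q w)"
  shows "locally_of P n U p"
  using assms unfolding locally_of_def by blast

lemma dsmooth_plot: "dsmooth D D' h \<Longrightarrow> plots D n U p \<Longrightarrow> plots D' n U (h \<circ> p)"
  by (simp add: dsmooth_def)


section \<open>Fibrewise isomorphisms of pseudo-bundles\<close>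

text \<open>
  The part of the axioms of a pseudo-bundle on which the constructions of the tensor and
  Clifford pseudo-bundles depend.
\<close>

locale fibred =
  fixes E :: "('x, 'v) pbundle"
  assumes base_range: "\<And>n U b u. plots (base E) n U b \<Longrightarrow> u \<in> U \<Longrightarrow> b u \<in> points (base E)"
    and total_range: "\<And>n U q u. plots (total E) n U q \<Longrightarrow> u \<in> U \<Longrightarrow> q u \<in> points (total E)"
    and proj_mem: "\<And>v. v \<in> points (total E) \<Longrightarrow> proj E v \<in> points (base E)"
    and fib_module: "\<And>x. x \<in> points (base E) \<Longrightarrow> module class_ring (fib E x)"
    and fib_carrier: "\<And>x. x \<in> points (base E) \<Longrightarrow>
          carrier (fib E x) = {v \<in> points (total E). proj E v = x}"

lemma pseudo_bundle_fibred: "pseudo_bundle E \<Longrightarrow> fibred E"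
  unfolding pseudo_bundle_def fibred_def vectorspace_iff_module
  by (auto dest: plot_range)

text \<open>
  The sum of the \<open>m\<close> pure tensors of degree \<open>r\<close> with factors \<open>v k i\<close>.
\<close>

abbreviation pure_sum ::
  "(real, 'v) module \<Rightarrow> nat \<Rightarrow> nat \<Rightarrow> (nat \<Rightarrow> nat \<Rightarrow> 'v) \<Rightarrow> ('v list \<Rightarrow> real) set" where
  "pure_sum M r m v \<equiv> finsum (tensor_power M r) (\<lambda>k. pure_tensor M (map (v k) [0..<r])) {..<m}"

text \<open>
  The local form of a plot of a tensor power over the base plot \<open>b\<close>: a smooth multiple of the
  unit in degree zero, otherwise a sum of pure tensors of plots over \<open>b\<close>.
\<close>

definition tensor_power_form :: "('x, 'v) pbundle \<Rightarrow> nat \<Rightarrow> nat \<Rightarrow> (nat \<Rightarrow> real) set \<Rightarrow>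
    ((nat \<Rightarrow> real) \<Rightarrow> 'x) \<Rightarrow> ((nat \<Rightarrow> real) \<Rightarrow> ('v list \<Rightarrow> real) set) \<Rightarrow> bool" where
  "tensor_power_form E r n W b t \<longleftrightarrow>
     (if r = 0
      then \<exists>c. plots real_dspace n W c \<and>
        (\<forall>w\<in>W. t w = c w \<odot>\<^bsub>tensor_power (fib E (b w)) 0\<^esub> pure_tensor (fib E (b w)) [])
      else \<exists>(m::nat) q.
        (\<forall>k<m. \<forall>i<r. plots (total E) n W (q k i) \<and> (\<forall>w\<in>W. proj E (q k i w) = b w)) \<and>
        (\<forall>w\<in>W. t w = pure_sum (fib E (b w)) r m (\<lambda>k i. q k i w)))"

lemma tensor_power_formE:
  assumes "tensor_power_form E r n W b t" "r \<noteq> 0"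
  obtains m q where
    "\<And>k i. k < m \<Longrightarrow> i < r \<Longrightarrow> plots (total E) n W (q k i)"
    "\<And>k i w. k < m \<Longrightarrow> i < r \<Longrightarrow> w \<in> W \<Longrightarrow> proj E (q k i w) = b w"
    "\<And>w. w \<in> W \<Longrightarrow> t w = pure_sum (fib E (b w)) r m (\<lambda>k i. q k i w)"
proof -
  from assms obtain m q where
    "\<forall>k<m. \<forall>i<r. plots (total E) n W (q k i) \<and> (\<forall>w\<in>W. proj E (q k i w) = b w)"
    "\<forall>w\<in>W. t w = pure_sum (fib E (b w)) r m (\<lambda>k i. q k i w)"
    unfolding tensor_power_form_def by auto
  then show ?thesis using that[of m q] by simp
qed

lemma ex_pair_split:
  "(\<exists>m q. A m q \<and> (\<forall>w\<in>W. s w = (b w, S m q w))) \<longleftrightarrow>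
   (\<exists>t. (\<forall>w\<in>W. s w = (b w, t w)) \<and> (\<exists>m q. A m q \<and> (\<forall>w\<in>W. t w = S m q w)))"
proof (intro iffI; elim exE conjE)
  fix m q assume "A m q" "\<forall>w\<in>W. s w = (b w, S m q w)"
  then show "\<exists>t. (\<forall>w\<in>W. s w = (b w, t w)) \<and> (\<exists>m q. A m q \<and> (\<forall>w\<in>W. t w = S m q w))"
    by (intro exI[of _ "S m q"]) blast
next
  fix t m q assume "\<forall>w\<in>W. s w = (b w, t w)" "A m q" "\<forall>w\<in>W. t w = S m q w"
  then show "\<exists>m q. A m q \<and> (\<forall>w\<in>W. s w = (b w, S m q w))"
    by (intro exI[of _ m] exI[of _ q]) simp
qed

lemma tensor_power_form_iff:
  "(if r = 0
    then \<exists>c. plots real_dspace n W c \<and>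
      (\<forall>w\<in>W. s w = (b w, c w \<odot>\<^bsub>tensor_power (fib E (b w)) 0\<^esub> pure_tensor (fib E (b w)) []))
    else \<exists>(m::nat) q.
      (\<forall>k<m. \<forall>i<r. plots (total E) n W (q k i) \<and> (\<forall>w\<in>W. proj E (q k i w) = b w)) \<and>
      (\<forall>w\<in>W. s w = (b w, pure_sum (fib E (b w)) r m (\<lambda>k i. q k i w)))) \<longleftrightarrow>
   (\<exists>t. (\<forall>w\<in>W. s w = (b w, t w)) \<and> tensor_power_form E r n W b t)" (is "?l = ?r")
proof (cases "r = 0")
  case True
  then show ?thesis
    by (auto simp: tensor_power_form_def intro!: exI[of _ "\<lambda>w. snd (s w)"])
next
  case False
  show ?thesis
    unfolding tensor_power_form_def if_not_P[OF False] by (rule ex_pair_split)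
qed

lemma tensor_power_plots:
  "plots (total (tensor_power_bundle E r)) = locally_of (\<lambda>n W s. \<exists>b. plots (base E) n W b \<and>
     (\<exists>t. (\<forall>w\<in>W. s w = (b w, t w)) \<and> tensor_power_form E r n W b t))"
  unfolding tensor_power_bundle_def tensor_power_form_iff by simp

lemma tensor_power_plotE:
  assumes "plots (total (tensor_power_bundle E r)) n U s" "u \<in> U"
  obtains W b t where "open_in n W" "u \<in> W" "W \<subseteq> U" "plots (base E) n W b"
    "\<And>w. w \<in> W \<Longrightarrow> s w = (b w, t w)" "tensor_power_form E r n W b t"
proof -
  obtain W s' b t where W: "open_in n W" "u \<in> W" "W \<subseteq> U"
    and s': "\<forall>w\<in>W. s w = s' w" "plots (base E) n W b" "\<forall>w\<in>W. s' w = (b w, t w)"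
      "tensor_power_form E r n W b t"
    using locally_ofD[OF assms[unfolded tensor_power_plots]] by (elim exE conjE)
  then show ?thesis using that[OF W, of b t] s' by simp
qed

lemma tensor_power_plotI:
  assumes U: "open_in n U"
    and loc: "\<And>u. u \<in> U \<Longrightarrow> \<exists>W b t. open_in n W \<and> u \<in> W \<and> W \<subseteq> U \<and>
      plots (base E) n W b \<and> (\<forall>w\<in>W. s w = (b w, t w)) \<and> tensor_power_form E r n W b t"
  shows "plots (total (tensor_power_bundle E r)) n U s"
  unfolding tensor_power_plots
proof (rule locally_ofI[OF U])
  fix u assume "u \<in> U"
  from loc[OF this] obtain W b t where "open_in n W" "u \<in> W" "W \<subseteq> U"
    "plots (base E) n W b" "\<forall>w\<in>W. s w = (b w, t w)" "tensor_power_form E r n W b t" by metis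
  then show "\<exists>W q. open_in n W \<and> u \<in> W \<and> W \<subseteq> U \<and>
    (\<exists>b. plots (base E) n W b \<and> (\<exists>t. (\<forall>w\<in>W. q w = (b w, t w)) \<and> tensor_power_form E r n W b t)) \<and>
    (\<forall>w\<in>W. s w = q w)"
    by (intro exI[of _ W] exI[of _ s] exI[of _ b] exI[of _ t] conjI) auto
qed

lemma tensor_algebra_plotE:
  assumes "plots (total (tensor_algebra_bundle E)) n U s" "u \<in> U"
  obtains W b t N where "open_in n W" "u \<in> W" "W \<subseteq> U" "plots (base E) n W b"
    "\<And>w. w \<in> W \<Longrightarrow> s w = (b w, t w)"
    "\<And>w r. w \<in> W \<Longrightarrow> N < r \<Longrightarrow> t w r = \<zero>\<^bsub>tensor_power (fib E (b w)) r\<^esub>"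
    "\<And>r. r \<le> N \<Longrightarrow> plots (total (tensor_power_bundle E r)) n W (\<lambda>w. (b w, t w r))"
proof -
  have "locally_of (\<lambda>n W s. \<exists>b t N. plots (base E) n W b \<and>
          (\<forall>w\<in>W. s w = (b w, t w) \<and> (\<forall>r>N. t w r = \<zero>\<^bsub>tensor_power (fib E (b w)) r\<^esub>)) \<and>
          (\<forall>r\<le>N. plots (total (tensor_power_bundle E r)) n W (\<lambda>w. (b w, t w r)))) n U s"
    using assms(1) by (simp add: tensor_algebra_bundle_def)
  from locally_ofD[OF this assms(2)]
  obtain W s' b t N where W: "open_in n W" "u \<in> W" "W \<subseteq> U"
    and s': "\<forall>w\<in>W. s w = s' w" "plots (base E) n W b"
      "\<forall>w\<in>W. s' w = (b w, t w) \<and> (\<forall>r>N. t w r = \<zero>\<^bsub>tensor_power (fib E (b w)) r\<^esub>)"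
      "\<forall>r\<le>N. plots (total (tensor_power_bundle E r)) n W (\<lambda>w. (b w, t w r))"
    by (elim exE conjE)
  then show ?thesis using that[OF W, of b t N] s' by simp
qed

lemma tensor_algebra_plotI:
  assumes U: "open_in n U"
    and loc: "\<And>u. u \<in> U \<Longrightarrow> \<exists>W b t N. open_in n W \<and> u \<in> W \<and> W \<subseteq> U \<and>
      plots (base E) n W b \<and>
      (\<forall>w\<in>W. s w = (b w, t w) \<and> (\<forall>r>N. t w r = \<zero>\<^bsub>tensor_power (fib E (b w)) r\<^esub>)) \<and>
      (\<forall>r\<le>N. plots (total (tensor_power_bundle E r)) n W (\<lambda>w. (b w, t w r)))"
  shows "plots (total (tensor_algebra_bundle E)) n U s"
proof -
  have "locally_of (\<lambda>n W s. \<exists>b t N. plots (base E) n W b \<and>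
          (\<forall>w\<in>W. s w = (b w, t w) \<and> (\<forall>r>N. t w r = \<zero>\<^bsub>tensor_power (fib E (b w)) r\<^esub>)) \<and>
          (\<forall>r\<le>N. plots (total (tensor_power_bundle E r)) n W (\<lambda>w. (b w, t w r)))) n U s"
  proof (rule locally_ofI[OF U])
    fix u assume "u \<in> U"
    from loc[OF this] obtain W b t N where "open_in n W" "u \<in> W" "W \<subseteq> U"
      "plots (base E) n W b \<and>
      (\<forall>w\<in>W. s w = (b w, t w) \<and> (\<forall>r>N. t w r = \<zero>\<^bsub>tensor_power (fib E (b w)) r\<^esub>)) \<and>
      (\<forall>r\<le>N. plots (total (tensor_power_bundle E r)) n W (\<lambda>w. (b w, t w r)))" by blast
    then show "\<exists>W q. open_in n W \<and> u \<in> W \<and> W \<subseteq> U \<and>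
      (\<exists>b t N. plots (base E) n W b \<and>
          (\<forall>w\<in>W. q w = (b w, t w) \<and> (\<forall>r>N. t w r = \<zero>\<^bsub>tensor_power (fib E (b w)) r\<^esub>)) \<and>
          (\<forall>r\<le>N. plots (total (tensor_power_bundle E r)) n W (\<lambda>w. (b w, t w r)))) \<and> (\<forall>w\<in>W. s w = q w)"
      by (intro exI[of _ W] exI[of _ s]) blast
  qed
  then show ?thesis by (simp add: tensor_algebra_bundle_def)
qed

text \<open>
  The projection from the tensor algebra to the Clifford algebra, fibre by fibre.
\<close>

abbreviation clifford_proj :: "('x, 'v) pbundle \<Rightarrow> ('x \<Rightarrow> 'v \<Rightarrow> 'v \<Rightarrow> real) \<Rightarrow>
    'x \<times> (nat \<Rightarrow> ('v list \<Rightarrow> real) set) \<Rightarrow> 'x \<times> (nat \<Rightarrow> ('v list \<Rightarrow> real) set) set" where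
  "clifford_proj E g s \<equiv> (fst s, clifford_class (fib E (fst s)) (g (fst s)) (snd s))"

lemma clifford_points:
  "points (total (clifford_bundle E g)) =
    (SIGMA x:points (base E). carrier (clifford_algebra (fib E x) (g x)))"
  unfolding clifford_algebra_simps
  by (force simp: clifford_bundle_def quot_dspace_def tensor_algebra_bundle_def)

lemma clifford_plotE:
  assumes "plots (total (clifford_bundle E g)) n U p" "u \<in> U"
  obtains W s where "open_in n W" "u \<in> W" "W \<subseteq> U"
    "plots (total (tensor_algebra_bundle E)) n W s"
    "\<And>w. w \<in> W \<Longrightarrow> p w = clifford_proj E g (s w)"
proof -
  let ?pr = "\<lambda>(x, t). (x, clifford_class (fib E x) (g x) t)"
  have "locally_of (\<lambda>n U p. \<exists>s. plots (total (tensor_algebra_bundle E)) n U s \<and> p = ?pr \<circ> s) n U p"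
    using assms(1) by (simp add: clifford_bundle_def quot_dspace_def)
  from locally_ofD[OF this assms(2)]
  obtain W q s where "open_in n W" "u \<in> W" "W \<subseteq> U" "\<forall>w\<in>W. p w = q w"
    "plots (total (tensor_algebra_bundle E)) n W s" "q = ?pr \<circ> s"
    by (elim exE conjE)
  then show ?thesis using that[of W s] by (simp add: case_prod_beta)
qed

lemma clifford_plotI:
  assumes U: "open_in n U"
    and loc: "\<And>u. u \<in> U \<Longrightarrow> \<exists>W s. open_in n W \<and> u \<in> W \<and> W \<subseteq> U \<and>
      plots (total (tensor_algebra_bundle E)) n W s \<and>
      (\<forall>w\<in>W. p w = clifford_proj E g (s w))"
  shows "plots (total (clifford_bundle E g)) n U p"
proof -
  let ?pr = "\<lambda>(x, t). (x, clifford_class (fib E x) (g x) t)"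
  have "locally_of (\<lambda>n U p. \<exists>s. plots (total (tensor_algebra_bundle E)) n U s \<and> p = ?pr \<circ> s) n U p"
  proof (rule locally_ofI[OF U])
    fix u assume "u \<in> U"
    from loc[OF this] obtain W s where "open_in n W" "u \<in> W" "W \<subseteq> U"
      "plots (total (tensor_algebra_bundle E)) n W s"
      "\<forall>w\<in>W. p w = clifford_proj E g (s w)" by blast
    then show "\<exists>W q. open_in n W \<and> u \<in> W \<and> W \<subseteq> U \<and>
       (\<exists>s. plots (total (tensor_algebra_bundle E)) n W s \<and> q = ?pr \<circ> s) \<and> (\<forall>w\<in>W. p w = q w)"
      by (intro exI[of _ W] exI[of _ "?pr \<circ> s"]) (auto simp: case_prod_beta)
  qed
  then show ?thesis by (simp add: clifford_bundle_def quot_dspace_def)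
qed

context fibred
begin

lemma tensor_power_form_mem:
  assumes b: "\<And>w. w \<in> W \<Longrightarrow> b w \<in> points (base E)"
    and f: "tensor_power_form E r n W b t" and w: "w \<in> W"
  shows "t w \<in> carrier (tensor_power (fib E (b w)) r)"
proof (cases "r = 0")
  case True
  note M = fib_module[OF b[OF w]]
  from f True obtain c where
    "t w = c w \<odot>\<^bsub>tensor_power (fib E (b w)) 0\<^esub> pure_tensor (fib E (b w)) []"
    using w unfolding tensor_power_form_def by auto
  moreover have "pure_tensor (fib E (b w)) [] \<in> carrier (tensor_power (fib E (b w)) 0)"
    using pure_tensor_closed[OF M, of "[]"] by simp
  ultimately show ?thesis
    using real_module_closed(2)[OF tensor_power_module[OF M]] True by simp
next
  case False
  note M = fib_module[OF b[OF w]]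
  from f False obtain m q where
    q: "\<And>k i. k < m \<Longrightarrow> i < r \<Longrightarrow> plots (total E) n W (q k i)"
      "\<And>k i w. k < m \<Longrightarrow> i < r \<Longrightarrow> w \<in> W \<Longrightarrow> proj E (q k i w) = b w"
    and t: "\<And>w. w \<in> W \<Longrightarrow> t w = pure_sum (fib E (b w)) r m (\<lambda>k i. q k i w)"
    by (rule tensor_power_formE) (rule that)
  have "q k i w \<in> carrier (fib E (b w))" if "k < m" "i < r" for k i
    unfolding fib_carrier[OF b[OF w]] using q(1)[OF that] q(2)[OF that w] total_range w by auto
  then show ?thesis
    unfolding t[OF w] by (intro sum_pure_tensors_closed[OF M]) auto
qed

lemma tensor_algebra_plot_mem:
  assumes s: "plots (total (tensor_algebra_bundle E)) n U s" and u: "u \<in> U"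
  shows "fst (s u) \<in> points (base E)"
    and "snd (s u) \<in> carrier (tensor_algebra (fib E (fst (s u))))"
proof -
  from s u obtain W b t N where W: "u \<in> W" and b: "plots (base E) n W b"
    and st: "\<And>w. w \<in> W \<Longrightarrow> s w = (b w, t w)"
    and big: "\<And>w r. w \<in> W \<Longrightarrow> N < r \<Longrightarrow> t w r = \<zero>\<^bsub>tensor_power (fib E (b w)) r\<^esub>"
    and small: "\<And>r. r \<le> N \<Longrightarrow> plots (total (tensor_power_bundle E r)) n W (\<lambda>w. (b w, t w r))"
    by (rule tensor_algebra_plotE) blast
  have bu: "b u \<in> points (base E)" using base_range[OF b W] .
  then show "fst (s u) \<in> points (base E)" by (simp add: st[OF W])
  note M = fib_module[OF bu]
  have "t u r \<in> carrier (tensor_power (fib E (b u)) r)" for r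
  proof (cases "r \<le> N")
    case True
    from small[OF this] W obtain W' b' t' where W': "u \<in> W'" and b': "plots (base E) n W' b'"
      and eq: "\<And>w. w \<in> W' \<Longrightarrow> (b w, t w r) = (b' w, t' w)" and f: "tensor_power_form E r n W' b' t'"
      by (rule tensor_power_plotE) blast
    have "t' u \<in> carrier (tensor_power (fib E (b' u)) r)"
      using base_range[OF b'] by (rule tensor_power_form_mem[OF _ f W'])
    then show ?thesis using eq[OF W'] by simp
  next
    case False
    then show ?thesis
      using big[OF W] real_module_closed(3)[OF tensor_power_module[OF M]] by simp
  qed
  moreover have "{r. t u r \<noteq> \<zero>\<^bsub>tensor_power (fib E (b u)) r\<^esub>} \<subseteq> {..N}"
    using big[OF W] by (force simp: not_le)
  ultimately show "snd (s u) \<in> carrier (tensor_algebra (fib E (fst (s u))))"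
    by (simp add: st[OF W] tensor_algebra_simps finite_subset)
qed

lemma clifford_plot_mem:
  assumes p: "plots (total (clifford_bundle E g)) n U p" and u: "u \<in> U"
  shows "p u \<in> points (total (clifford_bundle E g))"
proof -
  from p u obtain W s where W: "u \<in> W" and s: "plots (total (tensor_algebra_bundle E)) n W s"
    and ps: "\<And>w. w \<in> W \<Longrightarrow> p w = clifford_proj E g (s w)"
    by (rule clifford_plotE) blast
  show ?thesis
    using tensor_algebra_plot_mem[OF s W] by (auto simp: ps[OF W] clifford_points clifford_algebra_simps)
qed

end

text \<open>
  A pair of smooth maps \<open>j\<close>, \<open>i\<close> of the total spaces and of the bases of two pseudo-bundles, such
  that \<open>j\<close> covers \<open>i\<close> and is an isometry on every fibre.
\<close>

locale fibre_isometry = E: fibred E + E': fibred E'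
  for E :: "('x, 'v) pbundle" and E' :: "('y, 'w) pbundle" +
  fixes i :: "'x \<Rightarrow> 'y" and j :: "'v \<Rightarrow> 'w"
    and g :: "'x \<Rightarrow> 'v \<Rightarrow> 'v \<Rightarrow> real" and g' :: "'y \<Rightarrow> 'w \<Rightarrow> 'w \<Rightarrow> real"
  assumes base_smooth: "\<And>n U b. plots (base E) n U b \<Longrightarrow> plots (base E') n U (i \<circ> b)"
    and total_smooth: "\<And>n U q. plots (total E) n U q \<Longrightarrow> plots (total E') n U (j \<circ> q)"
    and base_mem: "\<And>x. x \<in> points (base E) \<Longrightarrow> i x \<in> points (base E')"
    and proj_j: "\<And>v. v \<in> points (total E) \<Longrightarrow> proj E' (j v) = i (proj E v)"
    and iso: "\<And>x. x \<in> points (base E) \<Longrightarrow> isometry (fib E x) (fib E' (i x)) j (g x) (g' (i x))"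
begin

lemma linear: "x \<in> points (base E) \<Longrightarrow> linear_iso (fib E x) (fib E' (i x)) j"
  using iso isometry.axioms(1) by blast

text \<open>
  The pushforward along the inverse of \<open>j\<close> on the fibre over \<open>x\<close>.
\<close>

abbreviation pull :: "'x \<Rightarrow> ('w list \<Rightarrow> real) \<Rightarrow> 'v list \<Rightarrow> real" where
  "pull x \<equiv> pushforward (inv_into (carrier (fib E x)) j) (carrier (fib E' (i x)))"

lemma tensor_power_form_push:
  assumes b: "plots (base E) n W b" and f: "tensor_power_form E r n W b t"
  shows "tensor_power_form E' r n W (i \<circ> b) (\<lambda>w. pushforward j (carrier (fib E (b w))) ` t w)"
proof (cases "r = 0")
  case True
  from f True obtain c where c: "plots real_dspace n W c"
    "\<And>w. w \<in> W \<Longrightarrow> t w = c w \<odot>\<^bsub>tensor_power (fib E (b w)) 0\<^esub> pure_tensor (fib E (b w)) []"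
    unfolding tensor_power_form_def by auto
  have "pushforward j (carrier (fib E (b w))) ` t w =
      c w \<odot>\<^bsub>tensor_power (fib E' (i (b w))) 0\<^esub> pure_tensor (fib E' (i (b w))) []" if w: "w \<in> W" for w
    unfolding c(2)[OF w]
    by (rule linear_iso.push_unit_smult[OF linear[OF E.base_range[OF b w]]])
  then show ?thesis unfolding tensor_power_form_def using True c(1) by auto
next
  case False
  from f False obtain m q where
    q: "\<And>k i. k < m \<Longrightarrow> i < r \<Longrightarrow> plots (total E) n W (q k i)"
      "\<And>k i w. k < m \<Longrightarrow> i < r \<Longrightarrow> w \<in> W \<Longrightarrow> proj E (q k i w) = b w"
    and t: "\<And>w. w \<in> W \<Longrightarrow> t w = pure_sum (fib E (b w)) r m (\<lambda>k i. q k i w)"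
    by (rule tensor_power_formE) (rule that)
  have "pushforward j (carrier (fib E (b w))) ` t w = finsum (tensor_power (fib E' (i (b w))) r)
     (\<lambda>k. pure_tensor (fib E' (i (b w))) (map (\<lambda>l. (j \<circ> q k l) w) [0..<r])) {..<m}" if w: "w \<in> W" for w
  proof -
    note bw = E.base_range[OF b w]
    interpret L: linear_iso "fib E (b w)" "fib E' (i (b w))" j by (rule linear[OF bw])
    have "q k l w \<in> carrier (fib E (b w))" if "k < m" "l < r" for k l
      unfolding E.fib_carrier[OF bw] using q(1)[OF that] q(2)[OF that w] E.total_range w by auto
    then show ?thesis
      unfolding t[OF w] by (subst L.push_sum_pure_tensors) (auto simp: comp_def)
  qed
  moreover have "plots (total E') n W (j \<circ> q k l)" if "k < m" "l < r" for k l
    by (rule total_smooth[OF q(1)[OF that]])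
  moreover have "proj E' ((j \<circ> q k l) w) = (i \<circ> b) w" if "k < m" "l < r" "w \<in> W" for k l w
    using proj_j[OF E.total_range[OF q(1)[OF that(1,2)] that(3)]] q(2)[OF that] by simp
  ultimately show ?thesis
    unfolding tensor_power_form_def using False
    by (auto intro!: exI[of _ m] exI[of _ "\<lambda>k l. j \<circ> q k l"])
qed

lemma tensor_algebra_push:
  assumes s: "plots (total (tensor_algebra_bundle E)) n U s" and U: "open_in n U"
  shows "plots (total (tensor_algebra_bundle E')) n U
    (\<lambda>u. (i (fst (s u)), tensor_map j (fib E (fst (s u))) (snd (s u))))"
proof (rule tensor_algebra_plotI[OF U])
  fix u assume "u \<in> U"
  with s obtain W b t N where W: "open_in n W" "u \<in> W" "W \<subseteq> U" and b: "plots (base E) n W b"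
    and st: "\<And>w. w \<in> W \<Longrightarrow> s w = (b w, t w)"
    and big: "\<And>w r. w \<in> W \<Longrightarrow> N < r \<Longrightarrow> t w r = \<zero>\<^bsub>tensor_power (fib E (b w)) r\<^esub>"
    and small: "\<And>r. r \<le> N \<Longrightarrow> plots (total (tensor_power_bundle E r)) n W (\<lambda>w. (b w, t w r))"
    by (rule tensor_algebra_plotE) blast
  let ?t = "\<lambda>w. tensor_map j (fib E (b w)) (t w)"
  have zero: "?t w r = \<zero>\<^bsub>tensor_power (fib E' ((i \<circ> b) w)) r\<^esub>" if "w \<in> W" "N < r" for w r
    using linear_iso.push_zero[OF linear[OF E.base_range[OF b that(1)]]] big[OF that]
    by (simp add: tensor_map_def)
  have power: "plots (total (tensor_power_bundle E' r)) n W (\<lambda>w. ((i \<circ> b) w, ?t w r))" if r: "r \<le> N" for r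
  proof (rule tensor_power_plotI[OF W(1)])
    fix v assume "v \<in> W"
    with small[OF r] obtain W' b' t' where W': "open_in n W'" "v \<in> W'" "W' \<subseteq> W"
      and b': "plots (base E) n W' b'"
      and eq: "\<And>w. w \<in> W' \<Longrightarrow> (b w, t w r) = (b' w, t' w)" and f: "tensor_power_form E r n W' b' t'"
      by (rule tensor_power_plotE) blast
    show "\<exists>V b2 t2. open_in n V \<and> v \<in> V \<and> V \<subseteq> W \<and> plots (base E') n V b2 \<and>
       (\<forall>w\<in>V. ((i \<circ> b) w, ?t w r) = (b2 w, t2 w)) \<and> tensor_power_form E' r n V b2 t2"
      using W' base_smooth[OF b'] tensor_power_form_push[OF b' f] eq
      by (intro exI[of _ W'] exI[of _ "i \<circ> b'"]
        exI[of _ "\<lambda>w. pushforward j (carrier (fib E (b' w))) ` t' w"]) (auto simp: tensor_map_def)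
  qed
  show "\<exists>W b t N. open_in n W \<and> u \<in> W \<and> W \<subseteq> U \<and> plots (base E') n W b \<and>
      (\<forall>w\<in>W. (i (fst (s w)), tensor_map j (fib E (fst (s w))) (snd (s w))) = (b w, t w) \<and>
         (\<forall>r>N. t w r = \<zero>\<^bsub>tensor_power (fib E' (b w)) r\<^esub>)) \<and>
      (\<forall>r\<le>N. plots (total (tensor_power_bundle E' r)) n W (\<lambda>w. (b w, t w r)))"
    using W base_smooth[OF b] zero power st
    by (intro exI[of _ W] exI[of _ "i \<circ> b"] exI[of _ ?t] exI[of _ N]) auto
qed

text \<open>
  The map of Clifford pseudo-bundles induced by the pair \<open>j\<close>, \<open>i\<close>.
\<close>

definition cliff :: "'x \<times> (nat \<Rightarrow> ('v list \<Rightarrow> real) set) set \<Rightarrow> 'y \<times> (nat \<Rightarrow> ('w list \<Rightarrow> real) set) set" where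
  "cliff = (\<lambda>(x, A). (i x, clifford_map j (fib E x) A))"

lemma cliff_class:
  assumes "x \<in> points (base E)" "t \<in> carrier (tensor_algebra (fib E x))"
  shows "cliff (x, clifford_class (fib E x) (g x) t) =
    (i x, clifford_class (fib E' (i x)) (g' (i x)) (tensor_map j (fib E x) t))"
  using isometry.clifford_map_class[OF iso[OF assms(1)] assms(2)] by (simp add: cliff_def)

lemma cliff_smooth:
  assumes p: "plots (total (clifford_bundle E g)) n U p" and U: "open_in n U"
  shows "plots (total (clifford_bundle E' g')) n U (cliff \<circ> p)"
proof (rule clifford_plotI[OF U])
  fix u assume "u \<in> U"
  with p obtain W s where W: "open_in n W" "u \<in> W" "W \<subseteq> U"
    and s: "plots (total (tensor_algebra_bundle E)) n W s"
    and ps: "\<And>w. w \<in> W \<Longrightarrow> p w = clifford_proj E g (s w)"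
    by (rule clifford_plotE) blast
  let ?s = "\<lambda>u. (i (fst (s u)), tensor_map j (fib E (fst (s u))) (snd (s u)))"
  have "\<forall>w\<in>W. (cliff \<circ> p) w =
      clifford_proj E' g' (?s w)"
    using E.tensor_algebra_plot_mem[OF s] by (simp add: ps cliff_class)
  then show "\<exists>W s. open_in n W \<and> u \<in> W \<and> W \<subseteq> U \<and>
      plots (total (tensor_algebra_bundle E')) n W s \<and>
      (\<forall>w\<in>W. (cliff \<circ> p) w = clifford_proj E' g' (s w))"
    using W tensor_algebra_push[OF s W(1)] by blast
qed

text \<open>
  Plots of the total space of \<open>E'\<close> over \<open>i \<circ> b\<close> lift locally along \<open>j\<close> to plots over \<open>b\<close>. The plot
  \<open>q\<close> may be defined outside \<open>W\<close>, and only its restriction to \<open>W\<close> is required to lie over \<open>i \<circ> b\<close>;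
  so no restriction of plots of \<open>E'\<close> is needed.
\<close>

definition lifts_over :: "nat \<Rightarrow> (nat \<Rightarrow> real) set \<Rightarrow> ((nat \<Rightarrow> real) \<Rightarrow> 'x) \<Rightarrow> bool" where
  "lifts_over n W b \<longleftrightarrow> (\<forall>V q u. plots (total E') n V q \<and> u \<in> V \<inter> W \<and>
     (\<forall>w\<in>V \<inter> W. proj E' (q w) = i (b w)) \<longrightarrow>
     (\<exists>V0 q0. open_in n V0 \<and> u \<in> V0 \<and> V0 \<subseteq> V \<inter> W \<and> plots (total E) n V0 q0 \<and>
        (\<forall>w\<in>V0. proj E (q0 w) = b w \<and> q w = j (q0 w))))"

text \<open>
  When \<open>i\<close> is injective, a local lift along \<open>j\<close> lies over \<open>b\<close> automatically.
\<close>

lemma lifts_overI: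
  assumes b: "plots (base E) n W b" and inj: "inj_on i (points (base E))"
    and loc: "\<And>V q u. plots (total E') n V q \<Longrightarrow> u \<in> V \<inter> W \<Longrightarrow> \<forall>w\<in>V \<inter> W. proj E' (q w) = i (b w) \<Longrightarrow>
      \<exists>V0 q0. open_in n V0 \<and> u \<in> V0 \<and> V0 \<subseteq> V \<inter> W \<and> plots (total E) n V0 q0 \<and>
        (\<forall>w\<in>V0. q w = j (q0 w))"
  shows "lifts_over n W b"
  unfolding lifts_over_def
proof (intro allI impI, elim conjE)
  fix V q u assume *: "plots (total E') n V q" "u \<in> V \<inter> W" "\<forall>w\<in>V \<inter> W. proj E' (q w) = i (b w)"
  from loc[OF this] obtain V0 q0 where V0: "open_in n V0" "u \<in> V0" "V0 \<subseteq> V \<inter> W"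
    and q0: "plots (total E) n V0 q0" "\<forall>w\<in>V0. q w = j (q0 w)" by (elim exE conjE)
  have "proj E (q0 w) = b w" if w: "w \<in> V0" for w
  proof -
    note m = E.total_range[OF q0(1) w]
    have wW: "w \<in> V \<inter> W" using w V0(3) by blast
    then have "proj E' (q w) = i (b w)" using *(3) by blast
    then have "i (proj E (q0 w)) = i (b w)" using q0(2) w proj_j[OF m] by simp
    then show ?thesis using inj_onD[OF inj _ E.proj_mem[OF m] E.base_range[OF b]] wW by blast
  qed
  then show "\<exists>V0 q0. open_in n V0 \<and> u \<in> V0 \<and> V0 \<subseteq> V \<inter> W \<and> plots (total E) n V0 q0 \<and>
      (\<forall>w\<in>V0. proj E (q0 w) = b w \<and> q w = j (q0 w))"
    using V0 q0 by (intro exI[of _ V0] exI[of _ q0]) simp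
qed

text \<open>
  A sum of pure tensors of plots involves finitely many plots; on the intersection of the
  neighbourhoods on which they lift, the whole sum lifts.
\<close>

lemma tensor_power_form_lift:
  assumes E: "diffeological_space (base E)" "diffeological_space (total E)"
    and b: "plots (base E) n W b" and lift: "lifts_over n W b"
    and V: "open_in n V" and f: "tensor_power_form E' r n V b' t"
    and bb': "\<And>w. w \<in> V \<inter> W \<Longrightarrow> b' w = i (b w)" and u: "u \<in> V \<inter> W"
  shows "\<exists>V0. open_in n V0 \<and> u \<in> V0 \<and> V0 \<subseteq> V \<inter> W \<and>
    tensor_power_form E r n V0 b
      (\<lambda>w. pull (b w) ` t w)"
proof -
  have W: "open_in n W" by (rule plot_open[OF E(1) b])
  then have VW: "open_in n (V \<inter> W)" using V by blast
  have inv: "linear_iso (fib E' (i (b w))) (fib E (b w)) (inv_into (carrier (fib E (b w))) j)"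
    if "w \<in> W" for w
    by (rule linear_iso.inverse[OF linear[OF E.base_range[OF b that]]])
  show ?thesis
  proof (cases "r = 0")
    case True
    from f True obtain c where c: "plots real_dspace n V c"
      "\<And>w. w \<in> V \<Longrightarrow> t w = c w \<odot>\<^bsub>tensor_power (fib E' (b' w)) 0\<^esub> pure_tensor (fib E' (b' w)) []"
      unfolding tensor_power_form_def by auto
    have "pull (b w) ` t w =
        c w \<odot>\<^bsub>tensor_power (fib E (b w)) 0\<^esub> pure_tensor (fib E (b w)) []" if w: "w \<in> V \<inter> W" for w
      using linear_iso.push_unit_smult[OF inv, of w "c w"] c(2)[of w] bb'[OF w] w by simp
    moreover have "plots real_dspace n (V \<inter> W) c" by (rule real_plot_restrict[OF c(1) VW]) blast
    ultimately show ?thesis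
      using VW u True by (intro exI[of _ "V \<inter> W"]) (auto simp: tensor_power_form_def)
  next
    case False
    from f False obtain m q where
      q: "\<And>k l. k < m \<Longrightarrow> l < r \<Longrightarrow> plots (total E') n V (q k l)"
        "\<And>k l w. k < m \<Longrightarrow> l < r \<Longrightarrow> w \<in> V \<Longrightarrow> proj E' (q k l w) = b' w"
      and t: "\<And>w. w \<in> V \<Longrightarrow> t w = pure_sum (fib E' (b' w)) r m (\<lambda>k l. q k l w)"
      by (rule tensor_power_formE) (rule that)
    define Q where "Q k l V0 q0 \<longleftrightarrow> open_in n V0 \<and> u \<in> V0 \<and> V0 \<subseteq> V \<inter> W \<and>
        plots (total E) n V0 q0 \<and> (\<forall>w\<in>V0. proj E (q0 w) = b w \<and> q k l w = j (q0 w))" for k l V0 q0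
    have ex: "\<exists>V0 q0. Q k l V0 q0" if kl: "k < m" "l < r" for k l
    proof -
      have "plots (total E') n V (q k l) \<and> u \<in> V \<inter> W \<and> (\<forall>w\<in>V \<inter> W. proj E' (q k l w) = i (b w))"
        using q(1)[OF kl] q(2)[OF kl] bb' u by auto
      from lift[unfolded lifts_over_def, THEN spec, THEN spec, THEN spec, THEN mp, OF this]
      show ?thesis unfolding Q_def .
    qed
    define V0 where "V0 k l = (SOME V0. \<exists>q0. Q k l V0 q0)" for k l
    define q0 where "q0 k l = (SOME q0. Q k l (V0 k l) q0)" for k l
    have Q: "Q k l (V0 k l) (q0 k l)" if "k < m" "l < r" for k l
      unfolding q0_def V0_def by (rule someI_ex[OF someI_ex[OF ex[OF that]]])
    have V0: "open_in n (V0 k l)" "u \<in> V0 k l" "V0 k l \<subseteq> V \<inter> W"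
      and q0: "plots (total E) n (V0 k l) (q0 k l)"
        "w \<in> V0 k l \<Longrightarrow> proj E (q0 k l w) = b w" "w \<in> V0 k l \<Longrightarrow> q k l w = j (q0 k l w)"
      if "k < m" "l < r" for k l w
      using Q[OF that] unfolding Q_def by simp_all
    \<comment> \<open>The intersection with \<open>V \<inter> W\<close> keeps the family nonempty when \<open>m = 0\<close>.\<close>
    let ?N = "\<Inter>(insert (V \<inter> W) ((\<lambda>(k, l). V0 k l) ` ({..<m} \<times> {..<r})))"
    have N: "open_in n ?N"
      using VW V0(1) by (intro openin_Inter) auto
    have uN: "u \<in> ?N" using u V0(2) by auto
    have sub: "?N \<subseteq> V \<inter> W" by blast
    have sub': "?N \<subseteq> V0 k l" if "k < m" "l < r" for k l using that by force
    have q0N: "plots (total E) n ?N (q0 k l)" if "k < m" "l < r" for k l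
      by (rule plot_restrict[OF E(2) q0(1)[OF that] N sub'[OF that]])
    have eq: "pull (b w) ` t w =
        pure_sum (fib E (b w)) r m (\<lambda>k l. q0 k l w)" if w: "w \<in> ?N" for w
    proof -
      have wV: "w \<in> V" "w \<in> W" using sub w by blast+
      note bw = E.base_range[OF b wV(2)]
      interpret L: linear_iso "fib E (b w)" "fib E' (i (b w))" j by (rule linear[OF bw])
      interpret I: linear_iso "fib E' (i (b w))" "fib E (b w)" "inv_into (carrier (fib E (b w))) j"
        by (rule inv[OF wV(2)])
      have mem: "q0 k l w \<in> carrier (fib E (b w))" if "k < m" "l < r" for k l
        unfolding E.fib_carrier[OF bw]
        using E.total_range[OF q0N[OF that] w] q0(2)[OF that] sub'[OF that] w by blast
      have ql: "q k l w = j (q0 k l w)" if "k < m" "l < r" for k l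
        using q0(3)[OF that] sub'[OF that] w by blast
      have cancel: "map (inv_into (carrier (fib E (b w))) j) (map (\<lambda>l. q k l w) [0..<r]) = map (\<lambda>l. q0 k l w) [0..<r]"
        if "k < m" for k
        using mem[OF that] ql[OF that] L.inj by simp
      have "b' w = i (b w)" using bb' wV by blast
      then have "pull (b w) ` t w =
        finsum (tensor_power (fib E (b w)) r) (\<lambda>k. pure_tensor (fib E (b w))
          (map (inv_into (carrier (fib E (b w))) j) (map (\<lambda>l. q k l w) [0..<r]))) {..<m}"
        unfolding t[OF wV(1)] using mem ql L.mem
        by (simp only:) (rule I.push_sum_pure_tensors, auto)
      also have "\<dots> = pure_sum (fib E (b w)) r m (\<lambda>k l. q0 k l w)"
      proof -
        interpret T: module class_ring "tensor_power (fib E (b w)) r" by (rule tensor_power_module[OF L.M])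
        have "pure_tensor (fib E (b w)) (map (\<lambda>l. q0 k l w) [0..<r]) \<in> carrier (tensor_power (fib E (b w)) r)"
          if "k < m" for k
        proof -
          have "set (map (\<lambda>l. q0 k l w) [0..<r]) \<subseteq> carrier (fib E (b w))" using mem[OF that] by auto
          from pure_tensor_closed[OF L.M this] show ?thesis by simp
        qed
        then show ?thesis
        proof (intro T.finsum_cong'[OF refl])
          fix k assume "k \<in> {..<m}"
          then show "pure_tensor (fib E (b w)) (map (inv_into (carrier (fib E (b w))) j) (map (\<lambda>l. q k l w) [0..<r])) =
              pure_tensor (fib E (b w)) (map (\<lambda>l. q0 k l w) [0..<r])"
            using cancel by (simp only: lessThan_iff)
        qed auto
      qed
      finally show ?thesis .
    qed
    have pr: "proj E (q0 k l w) = b w" if "k < m" "l < r" "w \<in> ?N" for k l w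
      using q0(2)[OF that(1,2)] sub'[OF that(1,2)] that(3) by blast
    have "tensor_power_form E r n ?N b
      (\<lambda>w. pull (b w) ` t w)"
      unfolding tensor_power_form_def if_not_P[OF False]
    proof (intro exI[of _ m] exI[of _ q0] conjI allI impI ballI)
      fix k l assume kl: "k < m" "l < r"
      show "plots (total E) n ?N (q0 k l)" by (rule q0N[OF kl])
      show "proj E (q0 k l w) = b w" if "w \<in> ?N" for w by (rule pr[OF kl that])
    qed (rule eq)
    then show ?thesis using N uN sub by blast
  qed
qed

lemma tensor_algebra_lift:
  assumes E: "diffeological_space (base E)" "diffeological_space (total E)"
    and b: "plots (base E) n W b" and lift: "lifts_over n W b"
    and s: "plots (total (tensor_algebra_bundle E')) n V s" and WV: "W \<subseteq> V"
    and bs: "\<And>w. w \<in> W \<Longrightarrow> fst (s w) = i (b w)"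
  shows "plots (total (tensor_algebra_bundle E)) n W
    (\<lambda>w. (b w, tensor_map (inv_into (carrier (fib E (b w))) j) (fib E' (i (b w))) (snd (s w))))"
    (is "plots _ n W (\<lambda>w. (b w, ?t w))")
proof (rule tensor_algebra_plotI)
  show W: "open_in n W" by (rule plot_open[OF E(1) b])
  fix u assume u: "u \<in> W"
  then have "u \<in> V" using WV by blast
  with s obtain V' b' t N where V': "open_in n V'" "u \<in> V'" "V' \<subseteq> V"
    and b': "plots (base E') n V' b'"
    and st: "\<And>w. w \<in> V' \<Longrightarrow> s w = (b' w, t w)"
    and big: "\<And>w r. w \<in> V' \<Longrightarrow> N < r \<Longrightarrow> t w r = \<zero>\<^bsub>tensor_power (fib E' (b' w)) r\<^esub>"
    and small: "\<And>r. r \<le> N \<Longrightarrow> plots (total (tensor_power_bundle E' r)) n V' (\<lambda>w. (b' w, t w r))"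
    by (rule tensor_algebra_plotE) blast
  let ?N = "V' \<inter> W"
  have N: "open_in n ?N" using V'(1) W by blast
  have bN: "plots (base E) n ?N b" by (rule plot_restrict[OF E(1) b N]) blast
  have b'b: "b' w = i (b w)" if "w \<in> ?N" for w using st[of w] bs[of w] that by simp
  have zero: "?t w r = \<zero>\<^bsub>tensor_power (fib E (b w)) r\<^esub>" if "w \<in> ?N" "N < r" for w r
  proof -
    have "b w \<in> points (base E)" using E.base_range[OF bN that(1)] .
    then show ?thesis
      using linear_iso.push_zero[OF linear_iso.inverse[OF linear]] big[of w r] b'b st that
      by (simp add: tensor_map_def)
  qed
  have power: "plots (total (tensor_power_bundle E r)) n ?N (\<lambda>w. (b w, ?t w r))" if r: "r \<le> N" for r
  proof (rule tensor_power_plotI[OF N])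
    fix v assume v: "v \<in> ?N"
    then have "v \<in> V'" by blast
    with small[OF r] obtain V1 b1 t1 where V1: "open_in n V1" "v \<in> V1" "V1 \<subseteq> V'"
      and eq: "\<And>w. w \<in> V1 \<Longrightarrow> (b' w, t w r) = (b1 w, t1 w)" and f: "tensor_power_form E' r n V1 b1 t1"
      by (rule tensor_power_plotE) blast
    have b1: "b1 w = i (b w)" if "w \<in> V1 \<inter> W" for w
      using eq[of w] b'b[of w] V1(3) that by auto
    obtain V0 where V0: "open_in n V0" "v \<in> V0" "V0 \<subseteq> V1 \<inter> W"
      and f0: "tensor_power_form E r n V0 b
      (\<lambda>w. pull (b w) ` t1 w)"
      using tensor_power_form_lift[OF E b lift V1(1) f b1, of v] V1(2) v by blast
    have "V0 \<subseteq> ?N" using V0(3) V1(3) by blast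
    moreover have "plots (base E) n V0 b"
      by (rule plot_restrict[OF E(1) b V0(1)]) (use V0(3) in blast)
    moreover have "?t w r = pull (b w) ` t1 w"
      if "w \<in> V0" for w
    proof -
      have "w \<in> V1" "w \<in> V'" using that V0(3) V1(3) by auto
      then show ?thesis using st[of w] eq[of w] by (simp add: tensor_map_def)
    qed
    ultimately show "\<exists>W ba t. open_in n W \<and> v \<in> W \<and> W \<subseteq> ?N \<and>
      plots (base E) n W ba \<and> (\<forall>w\<in>W. (b w, ?t w r) = (ba w, t w)) \<and> tensor_power_form E r n W ba t"
      using V0(1,2) f0
      by (intro exI[of _ V0] exI[of _ b] exI[of _ "\<lambda>w. pull (b w) ` t1 w"]) auto
  qed
  show "\<exists>Wa ba t N. open_in n Wa \<and> u \<in> Wa \<and> Wa \<subseteq> W \<and> plots (base E) n Wa ba \<and>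
      (\<forall>w\<in>Wa. (b w, ?t w) = (ba w, t w) \<and> (\<forall>r>N. t w r = \<zero>\<^bsub>tensor_power (fib E (ba w)) r\<^esub>)) \<and>
      (\<forall>r\<le>N. plots (total (tensor_power_bundle E r)) n Wa (\<lambda>w. (ba w, t w r)))"
    using N u V'(2) bN zero power
    by (intro exI[of _ ?N] exI[of _ b] exI[of _ ?t] exI[of _ N]) auto
qed

lemma clifford_lift:
  assumes E: "diffeological_space (base E)" "diffeological_space (total E)"
    and b: "plots (base E) n W b" and lift: "lifts_over n W b"
    and s: "plots (total (tensor_algebra_bundle E')) n V s" and WV: "W \<subseteq> V"
    and bs: "\<And>w. w \<in> W \<Longrightarrow> fst (s w) = i (b w)"
  obtains p where "plots (total (clifford_bundle E g)) n W p"
    "\<And>w. w \<in> W \<Longrightarrow> cliff (p w) =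
      clifford_proj E' g' (s w)"
proof
  let ?s = "\<lambda>w. (b w, tensor_map (inv_into (carrier (fib E (b w))) j) (fib E' (i (b w))) (snd (s w)))"
  let ?p = "\<lambda>w. clifford_proj E g (?s w)"
  have W: "open_in n W" by (rule plot_open[OF E(1) b])
  have s': "plots (total (tensor_algebra_bundle E)) n W ?s"
    by (rule tensor_algebra_lift[OF E b lift s WV bs])
  then show "plots (total (clifford_bundle E g)) n W ?p"
    using W by (intro clifford_plotI[OF W]) blast
  show "cliff (?p w) = clifford_proj E' g' (s w)"
    if w: "w \<in> W" for w
  proof -
    note bw = E.base_range[OF b w]
    have "snd (s w) \<in> carrier (tensor_algebra (fib E' (i (b w))))"
      using E'.tensor_algebra_plot_mem(2)[OF s, of w] WV w bs[OF w] by auto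
    then have "tensor_map j (fib E (b w)) (snd (?s w)) = snd (s w)"
      using linear_iso.tensor_map_tensor_map_inverse[OF linear[OF bw]] by simp
    then show ?thesis
      using cliff_class[OF bw] E.tensor_algebra_plot_mem(2)[OF s' w] bs[OF w] by simp
  qed
qed

end


context fibre_isometry
begin

lemma cliff_linear:
  assumes x: "x \<in> points (base E)"
  shows "linear_iso (fib (clifford_bundle E g) x) (fib (clifford_bundle E' g') (i x)) cliff"
proof -
  interpret I: isometry "fib E x" "fib E' (i x)" j "g x" "g' (i x)" by (rule iso[OF x])
  interpret C: linear_iso "clifford_algebra (fib E x) (g x)" "clifford_algebra (fib E' (i x)) (g' (i x))"
    "clifford_map j (fib E x)" by (rule I.clifford_map_iso)
  have T: "linear_iso (clifford_algebra (fib E x) (g x)) (fib (clifford_bundle E g) x) (Pair x)"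
    unfolding clifford_bundle_def by (simp add: transport_iso[OF C.M] inj_on_def)
  have T': "linear_iso (clifford_algebra (fib E' (i x)) (g' (i x))) (fib (clifford_bundle E' g') (i x)) (Pair (i x))"
    unfolding clifford_bundle_def by (simp add: transport_iso[OF C.M'] inj_on_def)
  have "Pair (i x) \<circ> clifford_map j (fib E x) = cliff \<circ> Pair x" by (auto simp: cliff_def)
  then show ?thesis using linear_iso.cancel[OF T] C.compose[OF T'] by simp
qed

lemma cliff_bij:
  assumes x: "x \<in> points (base E)"
  shows "bij_betw (clifford_map j (fib E x)) (carrier (clifford_algebra (fib E x) (g x)))
    (carrier (clifford_algebra (fib E' (i x)) (g' (i x))))"
  by (rule linear_iso.bij[OF isometry.clifford_map_iso[OF iso[OF x]]])

lemma cliff_mem: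
  "a \<in> points (total (clifford_bundle E g)) \<Longrightarrow> cliff a \<in> points (total (clifford_bundle E' g'))"
  unfolding clifford_points using base_mem cliff_bij by (auto simp: cliff_def dest: bij_betwE)

lemma cliff_inj:
  assumes "inj_on i (points (base E))"
  shows "inj_on cliff (points (total (clifford_bundle E g)))"
proof (rule inj_onI)
  fix a b assume a: "a \<in> points (total (clifford_bundle E g))"
    and b: "b \<in> points (total (clifford_bundle E g))" and eq: "cliff a = cliff b"
  obtain x A y B where ab: "a = (x, A)" "b = (y, B)" by (metis surj_pair)
  have mem: "x \<in> points (base E)" "A \<in> carrier (clifford_algebra (fib E x) (g x))"
    "y \<in> points (base E)" "B \<in> carrier (clifford_algebra (fib E y) (g y))"
    using a b unfolding ab clifford_points by auto
  have "x = y" using eq inj_onD[OF assms _ mem(1,3)] by (simp add: ab cliff_def)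
  then have "A = B"
    using eq mem bij_betw_imp_inj_on[OF cliff_bij[OF mem(1)]] by (auto simp: ab cliff_def inj_on_def)
  then show "a = b" using \<open>x = y\<close> by (simp add: ab)
qed

lemma cliff_surj:
  assumes x: "x \<in> points (base E)" and A: "A \<in> carrier (clifford_algebra (fib E' (i x)) (g' (i x)))"
  shows "(i x, A) \<in> cliff ` points (total (clifford_bundle E g))"
proof -
  obtain B where "B \<in> carrier (clifford_algebra (fib E x) (g x))" "A = clifford_map j (fib E x) B"
    using bij_betw_imp_surj_on[OF cliff_bij[OF x]] A by (metis imageE)
  then show ?thesis
    using x by (intro image_eqI[of _ _ "(x, B)"]) (auto simp: cliff_def clifford_points)
qed

end


section \<open>Gluing\<close>

text \<open>
  Every class of the gluing relation has a canonical representative: a point of \<open>Y\<close> is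
  replaced by its image under \<open>f\<close>, all other points stay.
\<close>

definition glue_rep :: "'a set \<Rightarrow> ('a \<Rightarrow> 'b) \<Rightarrow> 'a + 'b \<Rightarrow> 'a + 'b" where
  "glue_rep Y f = case_sum (\<lambda>x. if x \<in> Y then Inr (f x) else Inl x) Inr"

lemma glue_rep_simps [simp]:
  "glue_rep Y f (Inl x) = (if x \<in> Y then Inr (f x) else Inl x)"
  "glue_rep Y f (Inr y) = Inr y"
  by (simp_all add: glue_rep_def)

lemma glue_rel_iff:
  "(a, b) \<in> glue_rel A B Y f \<longleftrightarrow>
    a \<in> Sum_Type.Plus A B \<and> b \<in> Sum_Type.Plus A B \<and> glue_rep Y f a = glue_rep Y f b"
proof -
  let ?R = "\<lambda>a b. \<exists>y\<in>Y. a = Inl y \<and> b = Inr (f y)"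
  have 1: "glue_rep Y f a = glue_rep Y f b" if "equivclp ?R a b"
    using that by (induction rule: equivclp_induct) auto
  have rep: "equivclp ?R a (glue_rep Y f a)" for a
    by (cases a) (auto intro!: r_into_equivclp)
  have 2: "equivclp ?R a b" if "glue_rep Y f a = glue_rep Y f b"
    using equivclp_trans[OF rep[of a, unfolded that] equivclp_sym[OF rep[of b]]] .
  have "equivclp ?R a b \<longleftrightarrow> glue_rep Y f a = glue_rep Y f b"
    using 1 2 by (rule iffI)
  then show ?thesis by (simp add: glue_rel_def)
qed

lemma glue_class_eq_iff:
  assumes "a \<in> Sum_Type.Plus A B" "b \<in> Sum_Type.Plus A B"
  shows "glue_rel A B Y f `` {a} = glue_rel A B Y f `` {b} \<longleftrightarrow> glue_rep Y f a = glue_rep Y f b"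
proof
  assume eq: "glue_rel A B Y f `` {a} = glue_rel A B Y f `` {b}"
  have "b \<in> glue_rel A B Y f `` {b}" using assms by (simp add: glue_rel_iff)
  then have "b \<in> glue_rel A B Y f `` {a}" by (simp only: eq)
  then show "glue_rep Y f a = glue_rep Y f b" by (simp add: glue_rel_iff)
next
  assume "glue_rep Y f a = glue_rep Y f b"
  then show "glue_rel A B Y f `` {a} = glue_rel A B Y f `` {b}"
    unfolding set_eq_iff Image_singleton_iff glue_rel_iff using assms by simp
qed

lemma glue_inl_eq_inr:
  assumes "x \<in> points D1" "y \<in> points D2"
  shows "glue_inl D1 D2 Y f x = glue_inr D1 D2 Y f y \<longleftrightarrow> x \<in> Y \<and> f x = y"
  unfolding glue_inl_def glue_inr_def using assms by (subst glue_class_eq_iff) auto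

lemma glue_inr_inj: "inj_on (glue_inr D1 D2 Y f) (points D2)"
  unfolding glue_inr_def by (rule inj_onI) (simp add: glue_class_eq_iff[OF InrI InrI])

lemma glue_inl_inj: "inj_on f Y \<Longrightarrow> inj_on (glue_inl D1 D2 Y f) (points D1)"
  unfolding glue_inl_def
  by (rule inj_onI) (auto simp: glue_class_eq_iff[OF InlI InlI] inj_on_def split: if_splits)

lemma glue_points:
  "points (glue_dspace D1 D2 Y f) = glue_inl D1 D2 Y f ` points D1 \<union> glue_inr D1 D2 Y f ` points D2"
  unfolding glue_dspace_def quot_dspace_def sum_dspace_def glue_inl_def glue_inr_def
  by (auto simp: Sum_Type.Plus_def image_Un image_image)

lemma glue_plotE:
  assumes "plots (glue_dspace D1 D2 Y f) n U p" "u \<in> U"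
  obtains (inl) W q where "open_in n W" "u \<in> W" "W \<subseteq> U"
      "plots D1 n W q" "\<And>w. w \<in> W \<Longrightarrow> p w = glue_inl D1 D2 Y f (q w)"
    | (inr) W q where "open_in n W" "u \<in> W" "W \<subseteq> U"
      "plots D2 n W q" "\<And>w. w \<in> W \<Longrightarrow> p w = glue_inr D1 D2 Y f (q w)"
proof -
  let ?R = "glue_rel (points D1) (points D2) Y f"
  have "locally_of (\<lambda>n U p. \<exists>q. plots (sum_dspace D1 D2) n U q \<and> p = (\<lambda>a. ?R `` {a}) \<circ> q) n U p"
    using assms(1) by (simp add: glue_dspace_def quot_dspace_def)
  from locally_ofD[OF this assms(2)]
  obtain W p' s where W: "open_in n W" "u \<in> W" "W \<subseteq> U" "\<forall>w\<in>W. p w = p' w"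
    and s: "plots (sum_dspace D1 D2) n W s" "p' = (\<lambda>a. ?R `` {a}) \<circ> s" by (elim exE conjE)
  have "locally_of (\<lambda>n U p. (\<exists>q. plots D1 n U q \<and> p = Inl \<circ> q) \<or> (\<exists>q. plots D2 n U q \<and> p = Inr \<circ> q)) n W s"
    using s(1) by (simp add: sum_dspace_def)
  from locally_ofD[OF this W(2)]
  obtain W' s' where W': "open_in n W'" "u \<in> W'" "W' \<subseteq> W" "\<forall>w\<in>W'. s w = s' w"
    and or: "(\<exists>q. plots D1 n W' q \<and> s' = Inl \<circ> q) \<or> (\<exists>q. plots D2 n W' q \<and> s' = Inr \<circ> q)"
    by (elim exE conjE)
  have p: "p w = ?R `` {s' w}" if "w \<in> W'" for w
    using W W' s(2) that by auto
  from or show ?thesis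
  proof (elim disjE exE conjE)
    fix q assume "plots D1 n W' q" "s' = Inl \<circ> q"
    then show ?thesis using inl[of W' q] W' W(3) p by (auto simp: glue_inl_def)
  next
    fix q assume "plots D2 n W' q" "s' = Inr \<circ> q"
    then show ?thesis using inr[of W' q] W' W(3) p by (auto simp: glue_inr_def)
  qed
qed

lemma sum_plot_Inl:
  assumes "open_in n U" "plots D1 n U q"
  shows "plots (sum_dspace D1 D2) n U (Inl \<circ> q)"
proof -
  have "locally_of (\<lambda>n U p. (\<exists>q. plots D1 n U q \<and> p = Inl \<circ> q) \<or> (\<exists>q. plots D2 n U q \<and> p = Inr \<circ> q)) n U (Inl \<circ> q)"
    by (rule locally_ofI[OF assms(1)], rule exI[of _ U], rule exI[of _ "Inl \<circ> q"]) (use assms in blast)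
  then show ?thesis by (simp add: sum_dspace_def)
qed

lemma sum_plot_Inr:
  assumes "open_in n U" "plots D2 n U q"
  shows "plots (sum_dspace D1 D2) n U (Inr \<circ> q)"
proof -
  have "locally_of (\<lambda>n U p. (\<exists>q. plots D1 n U q \<and> p = Inl \<circ> q) \<or> (\<exists>q. plots D2 n U q \<and> p = Inr \<circ> q)) n U (Inr \<circ> q)"
    by (rule locally_ofI[OF assms(1)], rule exI[of _ U], rule exI[of _ "Inr \<circ> q"]) (use assms in blast)
  then show ?thesis by (simp add: sum_dspace_def)
qed

lemma glue_plotI:
  assumes U: "open_in n U"
    and loc: "\<And>u. u \<in> U \<Longrightarrow> \<exists>W. open_in n W \<and> u \<in> W \<and> W \<subseteq> U \<and>
      ((\<exists>q. plots D1 n W q \<and> (\<forall>w\<in>W. p w = glue_inl D1 D2 Y f (q w))) \<or>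
       (\<exists>q. plots D2 n W q \<and> (\<forall>w\<in>W. p w = glue_inr D1 D2 Y f (q w))))"
  shows "plots (glue_dspace D1 D2 Y f) n U p"
proof -
  let ?R = "glue_rel (points D1) (points D2) Y f"
  have "locally_of (\<lambda>n U p. \<exists>q. plots (sum_dspace D1 D2) n U q \<and> p = (\<lambda>a. ?R `` {a}) \<circ> q) n U p"
  proof (rule locally_ofI[OF U])
    fix u assume "u \<in> U"
    from loc[OF this] obtain W where W: "open_in n W" "u \<in> W" "W \<subseteq> U"
      and or: "(\<exists>q. plots D1 n W q \<and> (\<forall>w\<in>W. p w = glue_inl D1 D2 Y f (q w))) \<or>
       (\<exists>q. plots D2 n W q \<and> (\<forall>w\<in>W. p w = glue_inr D1 D2 Y f (q w)))" by (elim exE conjE)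
    from or obtain s where "plots (sum_dspace D1 D2) n W s" "\<forall>w\<in>W. p w = ?R `` {s w}"
    proof (elim disjE exE conjE)
      fix q assume "plots D1 n W q" "\<forall>w\<in>W. p w = glue_inl D1 D2 Y f (q w)"
      then show ?thesis using that[of "Inl \<circ> q"] sum_plot_Inl[OF W(1), of D1 q D2] by (simp add: glue_inl_def)
    next
      fix q assume "plots D2 n W q" "\<forall>w\<in>W. p w = glue_inr D1 D2 Y f (q w)"
      then show ?thesis using that[of "Inr \<circ> q"] sum_plot_Inr[OF W(1), of D2 q D1] by (simp add: glue_inr_def)
    qed
    then show "\<exists>W q. open_in n W \<and> u \<in> W \<and> W \<subseteq> U \<and>
       (\<exists>s. plots (sum_dspace D1 D2) n W s \<and> q = (\<lambda>a. ?R `` {a}) \<circ> s) \<and> (\<forall>w\<in>W. p w = q w)"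
      using W by (intro exI[of _ W] exI[of _ "(\<lambda>a. ?R `` {a}) \<circ> s"]) auto
  qed
  then show ?thesis by (simp add: glue_dspace_def quot_dspace_def)
qed

lemma glue_inl_plot:
  assumes "open_in n U" "plots D1 n U q"
  shows "plots (glue_dspace D1 D2 Y f) n U (glue_inl D1 D2 Y f \<circ> q)"
  using assms by (intro glue_plotI exI[of _ U]) auto

lemma glue_inr_plot:
  assumes "open_in n U" "plots D2 n U q"
  shows "plots (glue_dspace D1 D2 Y f) n U (glue_inr D1 D2 Y f \<circ> q)"
  using assms by (intro glue_plotI exI[of _ U]) auto

lemma glue_bundle_simps:
  "base (glue_bundle E1 E2 Y f ft) = glue_dspace (base E1) (base E2) Y f"
  "total (glue_bundle E1 E2 Y f ft) = glue_dspace (total E1) (total E2) (over E1 Y) ft"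
  "proj (glue_bundle E1 E2 Y f ft) =
     (\<lambda>C. glue_rel (points (base E1)) (points (base E2)) Y f `` (map_sum (proj E1) (proj E2) ` C))"
  by (simp_all add: glue_bundle_def Let_def)

lemma glue_fib_inr:
  assumes "x \<in> points (base E2)"
  shows "fib (glue_bundle E1 E2 Y f ft) (glue_inr (base E1) (base E2) Y f x) =
    transport (glue_inr (total E1) (total E2) (over E1 Y) ft) (fib E2 x)"
  using assms by (simp add: glue_bundle_def Let_def inv_into_f_f[OF glue_inr_inj])

lemma glue_fib_inl:
  assumes "inj_on f Y" "x \<in> points (base E1) - Y"
  shows "fib (glue_bundle E1 E2 Y f ft) (glue_inl (base E1) (base E2) Y f x) =
    transport (glue_inl (total E1) (total E2) (over E1 Y) ft) (fib E1 x)"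
proof -
  have "inj_on (glue_inl (base E1) (base E2) Y f) (points (base E1) - Y)"
    using glue_inl_inj[OF assms(1)] by (rule inj_on_subset) blast
  moreover have "glue_inl (base E1) (base E2) Y f x \<notin> glue_inr (base E1) (base E2) Y f ` points (base E2)"
    using assms(2) by (auto simp: glue_inl_eq_inr)
  ultimately show ?thesis using assms(2) by (simp add: glue_bundle_def Let_def)
qed

text \<open>The projection of a glued pseudo-bundle, computed on representatives.\<close>

lemma glue_proj_class:
  assumes p: "\<And>v. v \<in> points (total E1) \<Longrightarrow> proj E1 v \<in> points (base E1)"
      "\<And>v. v \<in> points (total E2) \<Longrightarrow> proj E2 v \<in> points (base E2)"
    and ft: "\<And>v. v \<in> over E1 Y \<Longrightarrow> proj E2 (ft v) = f (proj E1 v)"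
    and a: "a \<in> Sum_Type.Plus (points (total E1)) (points (total E2))"
  shows "proj (glue_bundle E1 E2 Y f ft) (glue_rel (points (total E1)) (points (total E2)) (over E1 Y) ft `` {a}) =
    glue_rel (points (base E1)) (points (base E2)) Y f `` {map_sum (proj E1) (proj E2) a}"
    (is "proj _ (?S `` {a}) = ?R `` {?m a}")
proof -
  have m: "?m c \<in> Sum_Type.Plus (points (base E1)) (points (base E2))"
    if "c \<in> Sum_Type.Plus (points (total E1)) (points (total E2))" for c
    using that p by auto
  have rep: "glue_rep Y f (?m c) = glue_rep Y f (?m (glue_rep (over E1 Y) ft c))"
    if "c \<in> Sum_Type.Plus (points (total E1)) (points (total E2))" for c
    using that by (auto simp: ft) (auto simp: over_def)
  have eq: "?R `` {?m c} = ?R `` {?m a}" if "c \<in> ?S `` {a}" for c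
  proof -
    from that have c: "c \<in> Sum_Type.Plus (points (total E1)) (points (total E2))"
      and "glue_rep (over E1 Y) ft a = glue_rep (over E1 Y) ft c" by (simp_all add: glue_rel_iff)
    then have "glue_rep Y f (?m c) = glue_rep Y f (?m a)" using rep[OF a] rep[OF c] by simp
    then show ?thesis by (simp add: glue_class_eq_iff[OF m[OF c] m[OF a]])
  qed
  have "a \<in> ?S `` {a}" using a by (simp add: glue_rel_iff)
  then have "?S `` {a} \<noteq> {}" by blast
  have "proj (glue_bundle E1 E2 Y f ft) (?S `` {a}) = (\<Union>c\<in>?S `` {a}. ?R `` {?m c})"
    unfolding glue_bundle_simps Image_eq_UN[of ?R "?m ` (?S `` {a})"] by (simp only: image_image)
  also have "\<dots> = (\<Union>c\<in>?S `` {a}. ?R `` {?m a})" by (rule SUP_cong[OF refl eq])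
  also have "\<dots> = ?R `` {?m a}" using \<open>?S `` {a} \<noteq> {}\<close> by (rule SUP_const)
  finally show ?thesis .
qed


section \<open>The Clifford pseudo-bundle of a glued pseudo-bundle\<close>

text \<open>
  Two pseudo-bundles with a gluing along a diffeomorphism \<open>ft\<close>, and forms \<open>g1 x\<close>, \<open>g2 x\<close> on the
  fibres that are compatible with it.
\<close>

locale glued_bundles =
  fixes V1 :: "('x1, 'v1) pbundle" and V2 :: "('x2, 'v2) pbundle"
    and Y :: "'x1 set" and f :: "'x1 \<Rightarrow> 'x2" and ft :: "'v1 \<Rightarrow> 'v2"
    and g1 :: "'x1 \<Rightarrow> 'v1 \<Rightarrow> 'v1 \<Rightarrow> real" and g2 :: "'x2 \<Rightarrow> 'v2 \<Rightarrow> 'v2 \<Rightarrow> real"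
  assumes V1: "pseudo_bundle V1" and V2: "pseudo_bundle V2"
    and gluing: "gluing V1 V2 Y f ft"
    and ft_diffeo: "diffeomorphism (sub_dspace (total V1) (over V1 Y))
           (sub_dspace (total V2) (over V2 (f ` Y))) ft"
    and compatible: "compatible_metrics V1 Y f ft g1 g2"
begin

sublocale V1: fibred V1 by (rule pseudo_bundle_fibred[OF V1])
sublocale V2: fibred V2 by (rule pseudo_bundle_fibred[OF V2])

abbreviation i1 where "i1 \<equiv> glue_inl (base V1) (base V2) Y f"
abbreviation i2 where "i2 \<equiv> glue_inr (base V1) (base V2) Y f"
abbreviation j1 where "j1 \<equiv> glue_inl (total V1) (total V2) (over V1 Y) ft"
abbreviation j2 where "j2 \<equiv> glue_inr (total V1) (total V2) (over V1 Y) ft"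
abbreviation V where "V \<equiv> glue_bundle V1 V2 Y f ft"
abbreviation g where "g \<equiv> glue_metric V1 V2 Y f ft g1 g2"

lemma diffeo:
  "diffeological_space (base V1)" "diffeological_space (total V1)"
  "diffeological_space (base V2)" "diffeological_space (total V2)"
  using V1 V2 by (simp_all add: pseudo_bundle_def)

lemma Y_sub: "Y \<subseteq> points (base V1)" and fY_sub: "f ` Y \<subseteq> points (base V2)"
  using gluing by (simp_all add: gluing_def)

lemma f_inj: "inj_on f Y"
proof -
  have "bij_betw f (points (sub_dspace (base V1) Y)) (points (sub_dspace (base V2) (f ` Y)))"
    using gluing by (simp add: gluing_def diffeomorphism_def)
  moreover have "points (sub_dspace (base V1) Y) = Y" using Y_sub by (auto simp: sub_dspace_def)
  ultimately show ?thesis by (simp add: bij_betw_def)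
qed

lemma over_points: "points (sub_dspace (total V1) (over V1 Y)) = over V1 Y"
    "points (sub_dspace (total V2) (over V2 (f ` Y))) = over V2 (f ` Y)"
  by (auto simp: sub_dspace_def over_def)

lemma ft_bij: "bij_betw ft (over V1 Y) (over V2 (f ` Y))"
  using ft_diffeo unfolding diffeomorphism_def over_points by blast

lemma ft_inj: "inj_on ft (over V1 Y)"
  using ft_bij by (rule bij_betw_imp_inj_on)

lemma ft_mem: "v \<in> over V1 Y \<Longrightarrow> ft v \<in> points (total V2)"
  using bij_betwE[OF ft_bij] by (auto simp: over_def)

lemma over_sub: "over V1 Y \<subseteq> points (total V1)"
  by (auto simp: over_def)

lemma ft_proj: "v \<in> over V1 Y \<Longrightarrow> proj V2 (ft v) = f (proj V1 v)"
  using gluing by (simp add: gluing_def)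

lemma ft_plot:
  assumes "plots (total V1) n U q" "\<And>u. u \<in> U \<Longrightarrow> proj V1 (q u) \<in> Y"
  shows "plots (total V2) n U (ft \<circ> q)"
proof -
  have "plots (sub_dspace (total V1) (over V1 Y)) n U q"
    using assms V1.total_range by (auto simp: sub_dspace_def over_def)
  then have "plots (sub_dspace (total V2) (over V2 (f ` Y))) n U (ft \<circ> q)"
    using ft_diffeo by (intro dsmooth_plot[of _ _ ft]) (simp_all add: diffeomorphism_def)
  then show ?thesis by (simp add: sub_dspace_def)
qed

lemma ft_inverse_plot:
  assumes "plots (total V2) n U q" "\<And>u. u \<in> U \<Longrightarrow> proj V2 (q u) \<in> f ` Y"
  shows "plots (total V1) n U (inv_into (over V1 Y) ft \<circ> q)"
proof -
  have "plots (sub_dspace (total V2) (over V2 (f ` Y))) n U q"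
    using assms V2.total_range by (auto simp: sub_dspace_def over_def)
  then have "plots (sub_dspace (total V1) (over V1 Y)) n U (inv_into (over V1 Y) ft \<circ> q)"
    using ft_diffeo
    by (intro dsmooth_plot[of _ _ "inv_into (over V1 Y) ft"]) (simp_all add: diffeomorphism_def over_points)
  then show ?thesis by (simp add: sub_dspace_def)
qed

lemma fib_over: "y \<in> Y \<Longrightarrow> carrier (fib V1 y) \<subseteq> over V1 Y"
  using Y_sub V1.fib_carrier[of y] by (auto simp: over_def)

text \<open>
  A bijection between the parts of \<open>V1\<close> and \<open>V2\<close> over \<open>Y\<close> and \<open>f ` Y\<close> that covers the injective
  map \<open>f\<close> restricts to bijections of fibres.
\<close>

lemma ft_isometry:
  assumes y: "y \<in> Y"
  shows "isometry (fib V1 y) (fib V2 (f y)) ft (g1 y) (g2 (f y))"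
proof -
  have yX: "y \<in> points (base V1)" and fyX: "f y \<in> points (base V2)" using y Y_sub fY_sub by auto
  have lin: "linear_map class_ring (fib V1 y) (fib V2 (f y)) ft"
    using gluing y by (simp add: gluing_def)
  then interpret linear_map class_ring "fib V1 y" "fib V2 (f y)" ft .
  have "bij_betw ft (carrier (fib V1 y)) (carrier (fib V2 (f y)))"
  proof (rule bij_betw_imageI)
    show "inj_on ft (carrier (fib V1 y))" using ft_inj fib_over[OF y] by (rule inj_on_subset)
    show "ft ` carrier (fib V1 y) = carrier (fib V2 (f y))"
    proof (intro equalityI subsetI)
      fix w assume "w \<in> carrier (fib V2 (f y))"
      then have w: "w \<in> points (total V2)" "proj V2 w = f y" by (simp_all add: V2.fib_carrier[OF fyX])
      then have "w \<in> over V2 (f ` Y)" using y by (auto simp: over_def)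
      then obtain v where v: "v \<in> over V1 Y" "w = ft v"
        using bij_betw_imp_surj_on[OF ft_bij] by blast
      then have "proj V1 v \<in> Y" "f (proj V1 v) = f y" using ft_proj w by (auto simp: over_def)
      then have "proj V1 v = y" using f_inj y by (auto simp: inj_on_def)
      then have "v \<in> carrier (fib V1 y)" using v(1) by (simp add: V1.fib_carrier[OF yX] over_def)
      then show "w \<in> ft ` carrier (fib V1 y)" using v(2) by blast
    qed auto
  qed
  then have "linear_iso (fib V1 y) (fib V2 (f y)) ft"
    by (intro linear_iso.intro V1.fib_module[OF yX] V2.fib_module[OF fyX]) auto
  then show ?thesis
    using compatible y by (intro isometry.intro isometry_axioms.intro) (auto simp: compatible_metrics_def)
qed

lemma i1_eq_i2: "x \<in> points (base V1) \<Longrightarrow> y \<in> points (base V2) \<Longrightarrow> i1 x = i2 y \<longleftrightarrow> x \<in> Y \<and> f x = y"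
  by (rule glue_inl_eq_inr)

lemma j1_eq_j2:
  "v \<in> points (total V1) \<Longrightarrow> w \<in> points (total V2) \<Longrightarrow> j1 v = j2 w \<longleftrightarrow> v \<in> over V1 Y \<and> ft v = w"
  by (rule glue_inl_eq_inr)

lemma i1_inj: "inj_on i1 (points (base V1))" and i2_inj: "inj_on i2 (points (base V2))"
  and j1_inj: "inj_on j1 (points (total V1))" and j2_inj: "inj_on j2 (points (total V2))"
  by (simp_all add: glue_inr_inj glue_inl_inj f_inj ft_inj)

lemma i1_glued: "y \<in> Y \<Longrightarrow> i1 y = i2 (f y)"
  using Y_sub fY_sub by (subst i1_eq_i2) auto

lemma j1_glued: "v \<in> over V1 Y \<Longrightarrow> j1 v = j2 (ft v)"
  using over_sub ft_mem by (subst j1_eq_j2) auto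

lemma proj_j1: "v \<in> points (total V1) \<Longrightarrow> proj V (j1 v) = i1 (proj V1 v)"
  unfolding glue_inl_def using glue_proj_class[where ?E1.0=V1 and ?E2.0=V2 and Y=Y and f=f and ft=ft, OF V1.proj_mem V2.proj_mem ft_proj, of "Inl v"] by auto

lemma proj_j2: "v \<in> points (total V2) \<Longrightarrow> proj V (j2 v) = i2 (proj V2 v)"
  unfolding glue_inr_def using glue_proj_class[where ?E1.0=V1 and ?E2.0=V2 and Y=Y and f=f and ft=ft, OF V1.proj_mem V2.proj_mem ft_proj, of "Inr v"] by auto

text \<open>
  Every point of the glued base is \<open>i1 x\<close> with \<open>x\<close> outside \<open>Y\<close>, or of the form \<open>i2 x\<close>; these are
  the two cases in the definition of the fibres.
\<close>

lemma base_cases: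
  assumes "z \<in> points (base V)"
  obtains (left) x where "x \<in> points (base V1) - Y" "z = i1 x" | (right) x where "x \<in> points (base V2)" "z = i2 x"
proof -
  from assms consider (l) x where "x \<in> points (base V1)" "z = i1 x" | (r) x where "x \<in> points (base V2)" "z = i2 x"
    by (auto simp: glue_bundle_simps glue_points)
  then show ?thesis
  proof cases
    case l
    show ?thesis
    proof (cases "x \<in> Y")
      case True
      then show ?thesis using l i1_glued fY_sub right[of "f x"] by auto
    next
      case False
      then show ?thesis using l left by blast
    qed
  next
    case r
    then show ?thesis by (rule right)
  qed
qed

lemma base_mem: "x \<in> points (base V1) \<Longrightarrow> i1 x \<in> points (base V)" "y \<in> points (base V2) \<Longrightarrow> i2 y \<in> points (base V)"
  by (simp_all add: glue_bundle_simps glue_points)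

lemma total_mem: "v \<in> points (total V1) \<Longrightarrow> j1 v \<in> points (total V)" "w \<in> points (total V2) \<Longrightarrow> j2 w \<in> points (total V)"
  by (simp_all add: glue_bundle_simps glue_points)

lemma fib_i1: "x \<in> points (base V1) - Y \<Longrightarrow> fib V (i1 x) = transport j1 (fib V1 x)"
  by (rule glue_fib_inl[OF f_inj])

lemma fib_i2: "x \<in> points (base V2) \<Longrightarrow> fib V (i2 x) = transport j2 (fib V2 x)"
  by (rule glue_fib_inr)

lemma j2_iso:
  assumes "x \<in> points (base V2)"
  shows "linear_iso (fib V2 x) (fib V (i2 x)) j2"
proof -
  have "carrier (fib V2 x) \<subseteq> points (total V2)" using V2.fib_carrier[of x] assms by auto
  then show ?thesis
    unfolding fib_i2[OF assms] using assms
    by (intro transport_iso V2.fib_module inj_on_subset[OF j2_inj]) auto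
qed

text \<open>
  Over a point \<open>x\<close> of \<open>Y\<close> the fibre of the glued pseudo-bundle is a copy of the fibre of \<open>V2\<close> over
  \<open>f x\<close>, and \<open>j1\<close> is the composition of \<open>ft\<close> and \<open>j2\<close>.
\<close>

lemma j1_iso:
  assumes x: "x \<in> points (base V1)"
  shows "linear_iso (fib V1 x) (fib V (i1 x)) j1"
proof (cases "x \<in> Y")
  case False
  have "carrier (fib V1 x) \<subseteq> points (total V1)" using V1.fib_carrier[OF x] by auto
  moreover have "fib V (i1 x) = transport j1 (fib V1 x)" using x False by (intro fib_i1) blast
  ultimately show ?thesis
    by (simp add: transport_iso[OF V1.fib_module[OF x] inj_on_subset[OF j1_inj]])
next
  case True
  interpret F: isometry "fib V1 x" "fib V2 (f x)" ft "g1 x" "g2 (f x)" by (rule ft_isometry[OF True])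
  have "f x \<in> points (base V2)" using True fY_sub by blast
  then have "linear_iso (fib V1 x) (fib V (i1 x)) (j2 \<circ> ft)"
    unfolding i1_glued[OF True] by (intro F.compose j2_iso)
  then show ?thesis
    by (rule linear_iso.cong_map) (use fib_over[OF True] j1_glued in auto)
qed

lemma glued_base_range: "plots (base V) n U b \<Longrightarrow> u \<in> U \<Longrightarrow> b u \<in> points (base V)"
  unfolding glue_bundle_simps
  by (erule (1) glue_plotE) (auto simp: glue_points V1.base_range V2.base_range)

lemma glued_total_range: "plots (total V) n U q \<Longrightarrow> u \<in> U \<Longrightarrow> q u \<in> points (total V)"
  unfolding glue_bundle_simps
  by (erule (1) glue_plotE) (auto simp: glue_points V1.total_range V2.total_range)

lemma total_cases:
  assumes "v \<in> points (total V)"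
  obtains (left) u where "u \<in> points (total V1)" "v = j1 u" | (right) u where "u \<in> points (total V2)" "v = j2 u"
  using assms by (auto simp: glue_bundle_simps glue_points)

lemma glued_fib_carrier:
  assumes z: "z \<in> points (base V)"
  shows "carrier (fib V z) = {v \<in> points (total V). proj V v = z}"
proof (intro equalityI subsetI)
  fix v assume v: "v \<in> carrier (fib V z)"
  from z consider x where "x \<in> points (base V1)" "z = i1 x" | x where "x \<in> points (base V2)" "z = i2 x"
    by (auto simp: glue_bundle_simps glue_points)
  then show "v \<in> {v \<in> points (total V). proj V v = z}"
  proof cases
    case (1 x)
    then have "v \<in> j1 ` carrier (fib V1 x)" using linear_iso.image[OF j1_iso[OF 1(1)]] v by simp
    then show ?thesis using V1.fib_carrier[OF 1(1)] by (auto simp: total_mem proj_j1 1(2))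
  next
    case (2 x)
    then have "v \<in> j2 ` carrier (fib V2 x)" using linear_iso.image[OF j2_iso[OF 2(1)]] v by simp
    then show ?thesis using V2.fib_carrier[OF 2(1)] by (auto simp: total_mem proj_j2 2(2))
  qed
next
  fix v assume v: "v \<in> {v \<in> points (total V). proj V v = z}"
  then have "v \<in> points (total V)" by blast
  then show "v \<in> carrier (fib V z)"
  proof (cases rule: total_cases)
    case (left u)
    have "u \<in> carrier (fib V1 (proj V1 u))" using left(1) V1.fib_carrier[OF V1.proj_mem] by simp
    then show ?thesis
      using linear_iso.mem[OF j1_iso[OF V1.proj_mem[OF left(1)]]] v left by (simp add: proj_j1)
  next
    case (right u)
    have "u \<in> carrier (fib V2 (proj V2 u))" using right(1) V2.fib_carrier[OF V2.proj_mem] by simp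
    then show ?thesis
      using linear_iso.mem[OF j2_iso[OF V2.proj_mem[OF right(1)]]] v right by (simp add: proj_j2)
  qed
qed

sublocale V: fibred V
proof (rule fibred.intro)
  show "module class_ring (fib V z)" if "z \<in> points (base V)" for z
    using that by (cases rule: base_cases) (auto intro: linear_iso.M' j1_iso j2_iso)
  show "proj V v \<in> points (base V)" if "v \<in> points (total V)" for v
    using that by (cases rule: total_cases) (auto simp: proj_j1 proj_j2 base_mem V1.proj_mem V2.proj_mem)
qed (simp_all add: glued_base_range glued_total_range glued_fib_carrier)

lemma metric_i2:
  assumes "x \<in> points (base V2)" "v \<in> points (total V2)" "w \<in> points (total V2)"
  shows "g (i2 x) (j2 v) (j2 w) = g2 x v w"
  using assms by (simp add: glue_metric_def Let_def inv_into_f_f[OF i2_inj] inv_into_f_f[OF j2_inj])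

lemma metric_i1:
  assumes x: "x \<in> points (base V1) - Y" and v: "v \<in> carrier (fib V1 x)" and w: "w \<in> carrier (fib V1 x)"
  shows "g (i1 x) (j1 v) (j1 w) = g1 x v w"
proof -
  have "i1 x \<notin> i2 ` points (base V2)" using x by (auto simp: i1_eq_i2)
  moreover have "inj_on i1 (points (base V1) - Y)" by (rule inj_on_subset[OF i1_inj]) blast
  moreover have "inj_on j1 (points (total V1) - over V1 Y)" by (rule inj_on_subset[OF j1_inj]) blast
  moreover have "v \<in> points (total V1) - over V1 Y" "w \<in> points (total V1) - over V1 Y"
    using x v w V1.fib_carrier[of x] by (auto simp: over_def)
  ultimately show ?thesis using x by (simp add: glue_metric_def Let_def)
qed

lemma j2_isometry:
  assumes x: "x \<in> points (base V2)"
  shows "isometry (fib V2 x) (fib V (i2 x)) j2 (g2 x) (g (i2 x))"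
  by (intro isometry.intro isometry_axioms.intro j2_iso[OF x])
    (simp add: V2.fib_carrier[OF x] metric_i2[OF x])

lemma j1_isometry:
  assumes x: "x \<in> points (base V1)"
  shows "isometry (fib V1 x) (fib V (i1 x)) j1 (g1 x) (g (i1 x))"
proof (intro isometry.intro isometry_axioms.intro j1_iso[OF x])
  fix v w assume vw: "v \<in> carrier (fib V1 x)" "w \<in> carrier (fib V1 x)"
  show "g (i1 x) (j1 v) (j1 w) = g1 x v w"
  proof (cases "x \<in> Y")
    case False
    then show ?thesis using x vw by (simp add: metric_i1)
  next
    case True
    interpret F: isometry "fib V1 x" "fib V2 (f x)" ft "g1 x" "g2 (f x)" by (rule ft_isometry[OF True])
    have "v \<in> over V1 Y" "w \<in> over V1 Y" using vw fib_over[OF True] by auto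
    moreover have "f x \<in> points (base V2)" using True fY_sub by blast
    ultimately show ?thesis
      using vw by (simp add: i1_glued[OF True] j1_glued metric_i2 ft_mem F.form)
  qed
qed

sublocale B1: fibre_isometry V1 V i1 j1 g1 g
proof (intro fibre_isometry.intro fibre_isometry_axioms.intro V1.fibred_axioms V.fibred_axioms)
  show "plots (base V) n U (i1 \<circ> b)" if "plots (base V1) n U b" for n U b
    unfolding glue_bundle_simps using plot_open[OF diffeo(1) that] that by (rule glue_inl_plot)
  show "plots (total V) n U (j1 \<circ> q)" if "plots (total V1) n U q" for n U q
    unfolding glue_bundle_simps using plot_open[OF diffeo(2) that] that by (rule glue_inl_plot)
qed (simp_all add: base_mem proj_j1 j1_isometry)

sublocale B2: fibre_isometry V2 V i2 j2 g2 g
proof (intro fibre_isometry.intro fibre_isometry_axioms.intro V2.fibred_axioms V.fibred_axioms)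
  show "plots (base V) n U (i2 \<circ> b)" if "plots (base V2) n U b" for n U b
    unfolding glue_bundle_simps using plot_open[OF diffeo(3) that] that by (rule glue_inr_plot)
  show "plots (total V) n U (j2 \<circ> q)" if "plots (total V2) n U q" for n U q
    unfolding glue_bundle_simps using plot_open[OF diffeo(4) that] that by (rule glue_inr_plot)
qed (simp_all add: base_mem proj_j2 j2_isometry)

text \<open>
  A plot of the glued total space comes locally from \<open>V1\<close> or from \<open>V2\<close>. In the second case, if it
  lies over points of the form \<open>i1 x\<close>, then it takes values over \<open>f ` Y\<close> and is moved to \<open>V1\<close> by
  the inverse of \<open>ft\<close>.
\<close>

lemma lifts_over_1:
  assumes b: "plots (base V1) n W b"
  shows "B1.lifts_over n W b"
proof (rule B1.lifts_overI[OF b i1_inj])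
  fix N q u assume q: "plots (total V) n N q" and u: "u \<in> N \<inter> W"
    and over: "\<forall>w\<in>N \<inter> W. proj V (q w) = i1 (b w)"
  have W: "open_in n W" by (rule plot_open[OF diffeo(1) b])
  have uN: "u \<in> N" using u by blast
  from q uN show "\<exists>V0 q0. open_in n V0 \<and> u \<in> V0 \<and> V0 \<subseteq> N \<inter> W \<and>
    plots (total V1) n V0 q0 \<and> (\<forall>w\<in>V0. q w = j1 (q0 w))"
    unfolding glue_bundle_simps
  proof (cases rule: glue_plotE)
    case (inl N' q')
    have N: "open_in n (N' \<inter> W)" using inl(1) W by blast
    have "plots (total V1) n (N' \<inter> W) q'" by (rule plot_restrict[OF diffeo(2) inl(4) N]) blast
    then show ?thesis
      using N inl(2,3,5) u by (intro exI[of _ "N' \<inter> W"] exI[of _ q']) auto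
  next
    case (inr N' q')
    let ?N = "N' \<inter> W" and ?q = "inv_into (over V1 Y) ft \<circ> q'"
    have N: "open_in n ?N" using inr(1) W by blast
    have q'N: "plots (total V2) n ?N q'" by (rule plot_restrict[OF diffeo(4) inr(4) N]) blast
    have pr: "proj V2 (q' w) \<in> f ` Y" "q' w \<in> over V2 (f ` Y)" if w: "w \<in> ?N" for w
    proof -
      have m: "q' w \<in> points (total V2)" by (rule V2.total_range[OF q'N w])
      have "proj V (q w) = i1 (b w)" using over inr(3) w by blast
      then have "i1 (b w) = i2 (proj V2 (q' w))" using inr(5)[of w] w proj_j2[OF m] by simp
      then have "b w \<in> Y \<and> f (b w) = proj V2 (q' w)"
        using i1_eq_i2[OF V1.base_range[OF b] V2.proj_mem[OF m]] w by blast
      then show "proj V2 (q' w) \<in> f ` Y" by force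
      then show "q' w \<in> over V2 (f ` Y)" using m by (simp add: over_def)
    qed
    have "plots (total V1) n ?N ?q" by (rule ft_inverse_plot[OF q'N pr(1)])
    moreover have "q w = j1 (?q w)" if w: "w \<in> ?N" for w
    proof -
      have "?q w \<in> over V1 Y" and "ft (?q w) = q' w"
        using pr(2)[OF w] ft_bij by (auto simp: bij_betw_def inv_into_into f_inv_into_f)
      then show ?thesis using j1_glued[of "?q w"] inr(5) w by simp
    qed
    ultimately show ?thesis
      using N inr(2,3) u by (intro exI[of _ ?N] exI[of _ ?q]) auto
  qed
qed

lemma lifts_over_2:
  assumes b: "plots (base V2) n W b"
  shows "B2.lifts_over n W b"
proof (rule B2.lifts_overI[OF b i2_inj])
  fix N q u assume q: "plots (total V) n N q" and u: "u \<in> N \<inter> W"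
    and over: "\<forall>w\<in>N \<inter> W. proj V (q w) = i2 (b w)"
  have W: "open_in n W" by (rule plot_open[OF diffeo(3) b])
  have uN: "u \<in> N" using u by blast
  from q uN show "\<exists>V0 q0. open_in n V0 \<and> u \<in> V0 \<and> V0 \<subseteq> N \<inter> W \<and>
    plots (total V2) n V0 q0 \<and> (\<forall>w\<in>V0. q w = j2 (q0 w))"
    unfolding glue_bundle_simps
  proof (cases rule: glue_plotE)
    case (inr N' q')
    have N: "open_in n (N' \<inter> W)" using inr(1) W by blast
    have "plots (total V2) n (N' \<inter> W) q'" by (rule plot_restrict[OF diffeo(4) inr(4) N]) blast
    then show ?thesis
      using N inr(2,3,5) u by (intro exI[of _ "N' \<inter> W"] exI[of _ q']) auto
  next
    case (inl N' q')
    let ?N = "N' \<inter> W"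
    have N: "open_in n ?N" using inl(1) W by blast
    have q'N: "plots (total V1) n ?N q'" by (rule plot_restrict[OF diffeo(2) inl(4) N]) blast
    have pr: "proj V1 (q' w) \<in> Y" "q' w \<in> over V1 Y" if w: "w \<in> ?N" for w
    proof -
      have m: "q' w \<in> points (total V1)" by (rule V1.total_range[OF q'N w])
      have "proj V (q w) = i2 (b w)" using over inl(3) w by blast
      then have "i1 (proj V1 (q' w)) = i2 (b w)" using inl(5)[of w] w proj_j1[OF m] by simp
      then show "proj V1 (q' w) \<in> Y"
        using i1_eq_i2[OF V1.proj_mem[OF m] V2.base_range[OF b]] w by blast
      then show "q' w \<in> over V1 Y" using m by (simp add: over_def)
    qed
    have "plots (total V2) n ?N (ft \<circ> q')" by (rule ft_plot[OF q'N pr(1)])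
    moreover have "q w = j2 ((ft \<circ> q') w)" if w: "w \<in> ?N" for w
      using j1_glued[OF pr(2)[OF w]] inl(5) w by simp
    ultimately show ?thesis
      using N inl(2,3) u by (intro exI[of _ ?N] exI[of _ "ft \<circ> q'"]) auto
  qed
qed

end

text \<open>
  The map \<open>F\<close> of Clifford pseudo-bundles induced by \<open>ft\<close> is added to the data.
\<close>

locale glued_clifford = glued_bundles V1 V2 Y f ft g1 g2
  for V1 :: "('x1, 'v1) pbundle" and V2 :: "('x2, 'v2) pbundle"
    and Y :: "'x1 set" and f :: "'x1 \<Rightarrow> 'x2" and ft :: "'v1 \<Rightarrow> 'v2"
    and g1 :: "'x1 \<Rightarrow> 'v1 \<Rightarrow> 'v1 \<Rightarrow> real" and g2 :: "'x2 \<Rightarrow> 'v2 \<Rightarrow> 'v2 \<Rightarrow> real" +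
  fixes F :: "'x1 \<times> (nat \<Rightarrow> ('v1 list \<Rightarrow> real) set) set \<Rightarrow> 'x2 \<times> (nat \<Rightarrow> ('v2 list \<Rightarrow> real) set) set"
  assumes induced: "clifford_induced V1 V2 Y f ft g1 g2 F"
begin

abbreviation C1 where "C1 \<equiv> clifford_bundle V1 g1"
abbreviation C2 where "C2 \<equiv> clifford_bundle V2 g2"
abbreviation CV where "CV \<equiv> clifford_bundle V g"
abbreviation C where "C \<equiv> glue_bundle C1 C2 Y f F"
abbreviation J1 where "J1 \<equiv> glue_inl (total C1) (total C2) (over C1 Y) F"
abbreviation J2 where "J2 \<equiv> glue_inr (total C1) (total C2) (over C1 Y) F"

lemma clifford_bundle_simps:
  "base (clifford_bundle E h) = base E" "proj (clifford_bundle E h) = fst"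
  "fib (clifford_bundle E h) x = transport (Pair x) (clifford_algebra (fib E x) (h x))"
  by (simp_all add: clifford_bundle_def)

lemma over_C1: "over C1 Y = (SIGMA y:Y. carrier (clifford_algebra (fib V1 y) (g1 y)))"
  using Y_sub by (auto simp: over_def clifford_points clifford_bundle_simps)

text \<open>
  After removal of the base points, \<open>F\<close> is a homomorphism of Clifford algebras that extends
  \<open>ft\<close>, hence it is the induced map.
\<close>

lemma F_eq:
  assumes y: "y \<in> Y" and A: "A \<in> carrier (clifford_algebra (fib V1 y) (g1 y))"
  shows "F (y, A) = (f y, clifford_map ft (fib V1 y) A)"
proof -
  let ?K1 = "clifford_algebra (fib V1 y) (g1 y)" and ?K2 = "clifford_algebra (fib V2 (f y)) (g2 (f y))"
  interpret I: isometry "fib V1 y" "fib V2 (f y)" ft "g1 y" "g2 (f y)" by (rule ft_isometry[OF y])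
  have inj: "inj_on (Pair y) (carrier ?K1)" "inj_on (Pair (f y)) (carrier ?K2)" by (simp_all add: inj_on_def)
  note tr1 = transport_simps[OF inj(1)] and tr2 = transport_simps[OF inj(2)]
  have ring: "F \<in> Ring.ring_hom (transport (Pair y) ?K1) (transport (Pair (f y)) ?K2)"
    and lin: "F \<in> module_hom class_ring (transport (Pair y) ?K1) (transport (Pair (f y)) ?K2)"
    and vec: "\<And>v. v \<in> carrier (fib V1 y) \<Longrightarrow> F (y, clifford_class (fib V1 y) (g1 y) (tensor_incl (fib V1 y) v)) =
           (f y, clifford_class (fib V2 (f y)) (g2 (f y)) (tensor_incl (fib V2 (f y)) (ft v)))"
    using induced y by (auto simp: clifford_induced_def clifford_bundle_simps)
  define \<phi> where "\<phi> B = snd (F (y, B))" for B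
  have \<phi>: "F (y, B) = (f y, \<phi> B)" "\<phi> B \<in> carrier ?K2" if "B \<in> carrier ?K1" for B
    using ring_hom_closed[OF ring, of "(y, B)"] that by (auto simp: tr1 tr2 \<phi>_def)
  interpret K1: module class_ring ?K1 by (rule clifford_algebra_module[OF I.M])
  interpret R: ideal "clifford_ideal (fib V1 y) (g1 y)" "tensor_algebra (fib V1 y)"
    by (rule clifford_ideal_ideal[OF I.M])
  have mult: "B \<otimes>\<^bsub>?K1\<^esub> D \<in> carrier ?K1" if "B \<in> carrier ?K1" "D \<in> carrier ?K1" for B D
    using ring.ring_simprules(5)[OF R.quotient_is_ring, of B D] that
    by (simp add: clifford_algebra_def Let_def)
  have one: "\<one>\<^bsub>?K1\<^esub> \<in> carrier ?K1"
    using ring.ring_simprules(6)[OF R.quotient_is_ring] by (simp add: clifford_algebra_def Let_def)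
  have "\<phi> A = clifford_map ft (fib V1 y) A"
  proof (rule I.clifford_map_unique[OF _ _ _ A])
    show "\<phi> \<in> Ring.ring_hom ?K1 ?K2"
    proof (rule ring_hom_memI)
      fix B D assume BD: "B \<in> carrier ?K1" "D \<in> carrier ?K1"
      then have m: "(y, B) \<in> carrier (transport (Pair y) ?K1)" "(y, D) \<in> carrier (transport (Pair y) ?K1)"
        by (simp_all add: tr1)
      show "\<phi> (B \<otimes>\<^bsub>?K1\<^esub> D) = \<phi> B \<otimes>\<^bsub>?K2\<^esub> \<phi> D"
        using ring_hom_mult[OF ring m] BD by (simp add: tr1 tr2 \<phi> mult)
      show "\<phi> (B \<oplus>\<^bsub>?K1\<^esub> D) = \<phi> B \<oplus>\<^bsub>?K2\<^esub> \<phi> D"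
        using ring_hom_add[OF ring m] BD by (simp add: tr1 tr2 \<phi>)
    next
      show "\<phi> \<one>\<^bsub>?K1\<^esub> = \<one>\<^bsub>?K2\<^esub>"
        using ring_hom_one[OF ring] by (simp add: tr1 tr2 \<phi> one)
    qed (simp add: \<phi>)
    have smult: "\<phi> (r \<odot>\<^bsub>?K1\<^esub> B) = r \<odot>\<^bsub>?K2\<^esub> \<phi> B" if "B \<in> carrier ?K1" for r B
      using module_hom_smult[OF lin, of r "(y, B)"] that by (simp add: tr1 tr2 \<phi> K1.smult_closed)
    then show "\<phi> \<in> module_hom class_ring ?K1 ?K2"
      using ring_hom_add[OF \<open>\<phi> \<in> Ring.ring_hom ?K1 ?K2\<close>] by (auto simp: module_hom_def \<phi>)
    show "\<phi> (clifford_class (fib V1 y) (g1 y) (tensor_incl (fib V1 y) v)) =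
        clifford_class (fib V2 (f y)) (g2 (f y)) (tensor_incl (fib V2 (f y)) (ft v))"
      if "v \<in> carrier (fib V1 y)" for v using vec[OF that] by (simp add: \<phi>_def)
  qed
  then show ?thesis by (simp add: \<phi>(1)[OF A])
qed

lemma F_mem: "a \<in> over C1 Y \<Longrightarrow> F a \<in> points (total C2)"
proof -
  assume a: "a \<in> over C1 Y"
  then obtain y A where yA: "a = (y, A)" "y \<in> Y" "A \<in> carrier (clifford_algebra (fib V1 y) (g1 y))"
    by (auto simp: over_C1)
  interpret I: isometry "fib V1 y" "fib V2 (f y)" ft "g1 y" "g2 (f y)" by (rule ft_isometry[OF yA(2)])
  show ?thesis
    using yA fY_sub linear_iso.mem[OF I.clifford_map_iso yA(3)] by (auto simp: F_eq clifford_points)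
qed

text \<open>
  Functoriality applied to \<open>j1 = j2 \<circ> ft\<close>.
\<close>

lemma cliff_F:
  assumes "a \<in> over C1 Y"
  shows "B2.cliff (F a) = B1.cliff a"
proof -
  from assms obtain y A where yA: "a = (y, A)" "y \<in> Y" "A \<in> carrier (clifford_algebra (fib V1 y) (g1 y))"
    by (auto simp: over_C1)
  interpret I: isometry "fib V1 y" "fib V2 (f y)" ft "g1 y" "g2 (f y)" by (rule ft_isometry[OF yA(2)])
  have fy: "f y \<in> points (base V2)" using yA(2) fY_sub by blast
  have "y \<in> points (base V1)" using yA(2) Y_sub by blast
  have "clifford_map j2 (fib V2 (f y)) (clifford_map ft (fib V1 y) A) = clifford_map (j2 \<circ> ft) (fib V1 y) A"
    by (rule clifford_map_compose[OF I.inj I.image linear_iso.inj[OF j2_iso[OF fy]]])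
  also have "clifford_map (j2 \<circ> ft) (fib V1 y) = clifford_map j1 (fib V1 y)"
  proof (rule clifford_map_cong[symmetric])
    show "j1 v = (j2 \<circ> ft) v" if "v \<in> carrier (fib V1 y)" for v
      using that fib_over[OF yA(2)] j1_glued by auto
    show "inj_on j1 (carrier (fib V1 y))"
      using fib_over[OF yA(2)] over_sub by (intro inj_on_subset[OF j1_inj]) blast
  qed
  finally show ?thesis
    using yA(2,3) by (simp add: yA(1) F_eq B2.cliff_def B1.cliff_def i1_glued)
qed

lemma F_inj: "inj_on F (over C1 Y)"
proof (rule inj_onI)
  fix a b assume ab: "a \<in> over C1 Y" "b \<in> over C1 Y" "F a = F b"
  then have "B1.cliff a = B1.cliff b" by (metis cliff_F)
  moreover have "a \<in> points (total C1)" "b \<in> points (total C1)" using ab by (auto simp: over_def)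
  ultimately show "a = b" using B1.cliff_inj[OF i1_inj] by (meson inj_onD)
qed

lemma cliff_eq_iff:
  assumes a: "a \<in> points (total C1)" and b: "b \<in> points (total C2)"
  shows "B1.cliff a = B2.cliff b \<longleftrightarrow> a \<in> over C1 Y \<and> F a = b"
proof
  assume eq: "B1.cliff a = B2.cliff b"
  have "fst a \<in> points (base V1)" "fst b \<in> points (base V2)" using a b by (auto simp: clifford_points)
  moreover have "i1 (fst a) = i2 (fst b)"
    using eq by (simp add: B1.cliff_def B2.cliff_def case_prod_beta)
  ultimately have "fst a \<in> Y" by (simp add: i1_eq_i2)
  then have ao: "a \<in> over C1 Y" using a by (simp add: over_def clifford_bundle_simps)
  then have "B2.cliff (F a) = B2.cliff b" using eq cliff_F by simp
  then have "F a = b" using inj_onD[OF B2.cliff_inj[OF i2_inj] _ F_mem[OF ao] b] by blast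
  then show "a \<in> over C1 Y \<and> F a = b" using ao by blast
next
  assume "a \<in> over C1 Y \<and> F a = b"
  then show "B1.cliff a = B2.cliff b" using cliff_F[of a] by metis
qed

lemma J1_eq_J2:
  "a \<in> points (total C1) \<Longrightarrow> b \<in> points (total C2) \<Longrightarrow> J1 a = J2 b \<longleftrightarrow> a \<in> over C1 Y \<and> F a = b"
  by (rule glue_inl_eq_inr)

lemma J1_inj: "inj_on J1 (points (total C1))" and J2_inj: "inj_on J2 (points (total C2))"
  by (simp_all add: glue_inr_inj glue_inl_inj F_inj)

text \<open>
  The diffeomorphism. A class of the glued Clifford pseudo-bundle is represented in \<open>C2\<close>, or
  else by a unique element of \<open>C1\<close>, and is mapped by \<open>cliff\<close> of that side.
\<close>

definition \<Phi> where
  "\<Phi> c = (if c \<in> J2 ` points (total C2) then B2.cliff (inv_into (points (total C2)) J2 c)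
          else B1.cliff (inv_into (points (total C1)) J1 c))"

lemma \<Phi>_J2: "b \<in> points (total C2) \<Longrightarrow> \<Phi> (J2 b) = B2.cliff b"
  by (simp add: \<Phi>_def J2_inj)

lemma \<Phi>_J1: "a \<in> points (total C1) \<Longrightarrow> \<Phi> (J1 a) = B1.cliff a"
proof (cases "J1 a \<in> J2 ` points (total C2)")
  case True
  assume a: "a \<in> points (total C1)"
  from True obtain b where b: "b \<in> points (total C2)" "J1 a = J2 b" by blast
  then have "a \<in> over C1 Y \<and> F a = b" using J1_eq_J2[OF a b(1)] by blast
  then have "B1.cliff a = B2.cliff b" using cliff_eq_iff[OF a b(1)] by blast
  then show ?thesis using b(2) \<Phi>_J2[OF b(1)] by simp
next
  case False
  assume "a \<in> points (total C1)"
  then show ?thesis using False by (simp add: \<Phi>_def J1_inj)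
qed

lemma C_points: "points (total C) = J1 ` points (total C1) \<union> J2 ` points (total C2)"
  by (simp add: glue_bundle_simps glue_points)

lemma \<Phi>_bij: "bij_betw \<Phi> (points (total C)) (points (total CV))"
proof (rule bij_betw_imageI)
  show "inj_on \<Phi> (points (total C))"
  proof (rule inj_onI)
    fix c d assume cd: "c \<in> points (total C)" "d \<in> points (total C)" and eq: "\<Phi> c = \<Phi> d"
    have J: "J1 a = J2 b" if "a \<in> points (total C1)" "b \<in> points (total C2)" "B1.cliff a = B2.cliff b" for a b
      using that by (simp add: J1_eq_J2 cliff_eq_iff)
    from cd(1) cd(2) show "c = d"
      unfolding C_points
    proof (elim UnE imageE)
      fix a b assume ab: "c = J1 a" "a \<in> points (total C1)" "d = J1 b" "b \<in> points (total C1)"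
      then show ?thesis using eq inj_onD[OF B1.cliff_inj[OF i1_inj], of a b] by (simp add: \<Phi>_J1)
    next
      fix a b assume ab: "c = J1 a" "a \<in> points (total C1)" "d = J2 b" "b \<in> points (total C2)"
      then show ?thesis using eq J by (simp add: \<Phi>_J1 \<Phi>_J2)
    next
      fix a b assume ab: "c = J2 b" "b \<in> points (total C2)" "d = J1 a" "a \<in> points (total C1)"
      then show ?thesis using eq J[of a b] by (simp add: \<Phi>_J1 \<Phi>_J2)
    next
      fix a b assume ab: "c = J2 a" "a \<in> points (total C2)" "d = J2 b" "b \<in> points (total C2)"
      then show ?thesis using eq inj_onD[OF B2.cliff_inj[OF i2_inj], of a b] by (simp add: \<Phi>_J2)
    qed
  qed
  show "\<Phi> ` points (total C) = points (total CV)"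
  proof (intro equalityI subsetI)
    fix d assume "d \<in> \<Phi> ` points (total C)"
    then show "d \<in> points (total CV)"
      unfolding C_points by (auto simp: \<Phi>_J1 \<Phi>_J2 B1.cliff_mem B2.cliff_mem)
  next
    fix d assume "d \<in> points (total CV)"
    then obtain z A where d: "d = (z, A)" "z \<in> points (base V)" "A \<in> carrier (clifford_algebra (fib V z) (g z))"
      by (auto simp: clifford_points)
    from d(2) show "d \<in> \<Phi> ` points (total C)"
    proof (cases rule: base_cases)
      case (left x)
      then have "d \<in> B1.cliff ` points (total C1)" using d B1.cliff_surj[of x A] by auto
      then obtain a where "a \<in> points (total C1)" "d = B1.cliff a" by blast
      then show ?thesis unfolding C_points by (intro image_eqI[of _ _ "J1 a"]) (auto simp: \<Phi>_J1)
    next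
      case (right x)
      then have "d \<in> B2.cliff ` points (total C2)" using d B2.cliff_surj[of x A] by auto
      then obtain a where "a \<in> points (total C2)" "d = B2.cliff a" by blast
      then show ?thesis unfolding C_points by (intro image_eqI[of _ _ "J2 a"]) (auto simp: \<Phi>_J2)
    qed
  qed
qed

lemma \<Phi>_smooth: "dsmooth (total C) (total CV) \<Phi>"
  unfolding dsmooth_def
proof (intro conjI allI impI)
  show "\<Phi> ` points (total C) \<subseteq> points (total CV)" using \<Phi>_bij by (simp add: bij_betw_def)
  fix n U p assume p: "plots (total C) n U p"
  then have U: "open_in n U"
    by (simp add: glue_bundle_simps glue_dspace_def quot_dspace_def locally_of_open)
  have loc: "\<exists>W p'. open_in n W \<and> u \<in> W \<and> W \<subseteq> U \<and> plots (total CV) n W p' \<and>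
      (\<forall>w\<in>W. (\<Phi> \<circ> p) w = p' w)" if u: "u \<in> U" for u
    using p[unfolded glue_bundle_simps] u
  proof (cases rule: glue_plotE)
    case (inl W q)
    have "\<forall>w\<in>W. (\<Phi> \<circ> p) w = (B1.cliff \<circ> q) w"
      using V1.clifford_plot_mem[OF inl(4)] inl(5) by (simp add: \<Phi>_J1)
    then show ?thesis using inl B1.cliff_smooth[OF inl(4,1)] by blast
  next
    case (inr W q)
    have "\<forall>w\<in>W. (\<Phi> \<circ> p) w = (B2.cliff \<circ> q) w"
      using V2.clifford_plot_mem[OF inr(4)] inr(5) by (simp add: \<Phi>_J2)
    then show ?thesis using inr B2.cliff_smooth[OF inr(4,1)] by blast
  qed
  show "plots (total CV) n U (\<Phi> \<circ> p)"
  proof (rule clifford_plotI[OF U])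
    fix u assume "u \<in> U"
    from loc[OF this] obtain W p' where W: "open_in n W" "u \<in> W" "W \<subseteq> U"
      and p': "plots (total CV) n W p'" and eq: "\<forall>w\<in>W. (\<Phi> \<circ> p) w = p' w" by blast
    from p' W(2) obtain W' s where "open_in n W'" "u \<in> W'" "W' \<subseteq> W"
      "plots (total (tensor_algebra_bundle V)) n W' s"
      "\<And>w. w \<in> W' \<Longrightarrow> p' w = clifford_proj V g (s w)"
      by (rule clifford_plotE) (rule that)
    then show "\<exists>W s. open_in n W \<and> u \<in> W \<and> W \<subseteq> U \<and>
      plots (total (tensor_algebra_bundle V)) n W s \<and>
      (\<forall>w\<in>W. (\<Phi> \<circ> p) w = clifford_proj V g (s w))"
      using W eq by (intro exI[of _ W'] exI[of _ s]) auto
  qed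
qed

text \<open>
  The base plot \<open>b\<close> of a local lift to the tensor algebra decides on which side the preimage
  is constructed.
\<close>

lemma \<Phi>_inverse_smooth: "dsmooth (total CV) (total C) (inv_into (points (total C)) \<Phi>)"
  unfolding dsmooth_def
proof (intro conjI allI impI)
  let ?\<Psi> = "inv_into (points (total C)) \<Phi>"
  have inv: "?\<Psi> (\<Phi> c) = c" if "c \<in> points (total C)" for c
    using that \<Phi>_bij by (simp add: bij_betw_def)
  show "?\<Psi> ` points (total CV) \<subseteq> points (total C)"
    using bij_betw_inv_into[OF \<Phi>_bij] by (simp add: bij_betw_def)
  fix n U P assume P: "plots (total CV) n U P"
  then have U: "open_in n U"
    by (simp add: clifford_bundle_def quot_dspace_def locally_of_open)
  have "plots (glue_dspace (total C1) (total C2) (over C1 Y) F) n U (?\<Psi> \<circ> P)"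
  proof (rule glue_plotI[OF U])
    fix u assume "u \<in> U"
    with P obtain W s where W: "open_in n W" "u \<in> W" "W \<subseteq> U"
      and s: "plots (total (tensor_algebra_bundle V)) n W s"
      and Ps: "\<And>w. w \<in> W \<Longrightarrow> P w = clifford_proj V g (s w)"
      by (rule clifford_plotE) (rule that)
    from s W(2) obtain W1 b t N where W1: "u \<in> W1" "W1 \<subseteq> W" and b: "plots (base V) n W1 b"
      and sb: "\<And>w. w \<in> W1 \<Longrightarrow> s w = (b w, t w)"
      by (rule tensor_algebra_plotE) (rule that)
    from b[unfolded glue_bundle_simps] W1(1)
    show "\<exists>W. open_in n W \<and> u \<in> W \<and> W \<subseteq> U \<and>
      ((\<exists>q. plots (total C1) n W q \<and> (\<forall>w\<in>W. (?\<Psi> \<circ> P) w = J1 (q w))) \<or>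
       (\<exists>q. plots (total C2) n W q \<and> (\<forall>w\<in>W. (?\<Psi> \<circ> P) w = J2 (q w))))"
    proof (cases rule: glue_plotE)
      case (inl W2 b1)
      have sub: "W2 \<subseteq> W" using inl(3) W1(2) by blast
      have bs: "fst (s w) = i1 (b1 w)" if "w \<in> W2" for w using sb[of w] inl(3,5) that by auto
      obtain q where q: "plots (total C1) n W2 q"
        "\<And>w. w \<in> W2 \<Longrightarrow> B1.cliff (q w) =
          clifford_proj V g (s w)"
        by (rule B1.clifford_lift[OF diffeo(1,2) inl(4) lifts_over_1[OF inl(4)] s sub bs], assumption) (rule that)
      have "(?\<Psi> \<circ> P) w = J1 (q w)" if w: "w \<in> W2" for w
      proof -
        have m: "q w \<in> points (total C1)" by (rule V1.clifford_plot_mem[OF q(1) w])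
        have "P w = \<Phi> (J1 (q w))" using Ps[of w] q(2)[OF w] sub w \<Phi>_J1[OF m] by auto
        then show ?thesis using inv[of "J1 (q w)"] m by (simp add: C_points)
      qed
      then show ?thesis using q(1) inl(1,2) sub W(3) by (intro exI[of _ W2]) auto
    next
      case (inr W2 b2)
      have sub: "W2 \<subseteq> W" using inr(3) W1(2) by blast
      have bs: "fst (s w) = i2 (b2 w)" if "w \<in> W2" for w using sb[of w] inr(3,5) that by auto
      obtain q where q: "plots (total C2) n W2 q"
        "\<And>w. w \<in> W2 \<Longrightarrow> B2.cliff (q w) =
          clifford_proj V g (s w)"
        by (rule B2.clifford_lift[OF diffeo(3,4) inr(4) lifts_over_2[OF inr(4)] s sub bs], assumption) (rule that)
      have "(?\<Psi> \<circ> P) w = J2 (q w)" if w: "w \<in> W2" for w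
      proof -
        have m: "q w \<in> points (total C2)" by (rule V2.clifford_plot_mem[OF q(1) w])
        have "P w = \<Phi> (J2 (q w))" using Ps[of w] q(2)[OF w] sub w \<Phi>_J2[OF m] by auto
        then show ?thesis using inv[of "J2 (q w)"] m by (simp add: C_points)
      qed
      then show ?thesis using q(1) inr(1,2) sub W(3) by (intro exI[of _ W2]) auto
    qed
  qed
  then show "plots (total C) n U (?\<Psi> \<circ> P)" by (simp only: glue_bundle_simps(2))
qed

lemma \<Phi>_proj:
  assumes "c \<in> points (total C)"
  shows "proj CV (\<Phi> c) = proj C c"
proof -
  have p: "\<And>v. v \<in> points (total C1) \<Longrightarrow> proj C1 v \<in> points (base C1)"
    "\<And>v. v \<in> points (total C2) \<Longrightarrow> proj C2 v \<in> points (base C2)"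
    by (auto simp: clifford_points clifford_bundle_simps)
  have F: "proj C2 (F v) = f (proj C1 v)" if "v \<in> over C1 Y" for v
    using that by (auto simp: over_C1 clifford_bundle_simps F_eq)
  note cl = glue_proj_class[where ?E1.0=C1 and ?E2.0=C2 and Y=Y and f=f and ft=F, OF p F]
  from assms show ?thesis
    unfolding C_points
  proof (elim UnE imageE)
    fix a assume a: "c = J1 a" "a \<in> points (total C1)"
    have "proj C (J1 a) = i1 (fst a)"
      using cl[of "Inl a"] a(2) by (simp add: glue_inl_def clifford_bundle_simps InlI)
    then show ?thesis using a by (simp add: \<Phi>_J1 clifford_bundle_simps B1.cliff_def case_prod_beta)
  next
    fix a assume a: "c = J2 a" "a \<in> points (total C2)"
    have "proj C (J2 a) = i2 (fst a)"
      using cl[of "Inr a"] a(2) by (simp add: glue_inr_def clifford_bundle_simps InrI)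
    then show ?thesis using a by (simp add: \<Phi>_J2 clifford_bundle_simps B2.cliff_def case_prod_beta)
  qed
qed

lemma \<Phi>_linear:
  assumes z: "z \<in> points (base V)"
  shows "linear_map class_ring (fib C z) (fib CV z) \<Phi>"
  using z
proof (cases rule: base_cases)
  case (left x)
  then have xX: "x \<in> points (base V1)" by blast
  interpret L: linear_iso "fib C1 x" "fib CV (i1 x)" B1.cliff by (rule B1.cliff_linear[OF xX])
  have sub: "carrier (fib C1 x) \<subseteq> points (total C1)"
    using xX by (auto simp: clifford_bundle_simps clifford_points transport_simps inj_on_def)
  have fib: "fib C z = transport J1 (fib C1 x)"
    using glue_fib_inl[OF f_inj, of x C1 C2 F] left by (simp add: clifford_bundle_simps)
  have T: "linear_iso (fib C1 x) (fib C z) J1"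
    unfolding fib by (intro transport_iso L.M inj_on_subset[OF J1_inj sub])
  have "linear_iso (fib C1 x) (fib CV z) (\<Phi> \<circ> J1)"
    unfolding left(2) by (rule L.cong_map) (use sub \<Phi>_J1 in auto)
  then show ?thesis by (intro linear_iso.is_linear_map linear_iso.cancel[OF T])
next
  case (right x)
  interpret L: linear_iso "fib C2 x" "fib CV (i2 x)" B2.cliff by (rule B2.cliff_linear[OF right(1)])
  have sub: "carrier (fib C2 x) \<subseteq> points (total C2)"
    using right(1) by (auto simp: clifford_bundle_simps clifford_points transport_simps inj_on_def)
  have fib: "fib C z = transport J2 (fib C2 x)"
    using glue_fib_inr[of x C2 C1 Y f F] right by (simp add: clifford_bundle_simps)
  have T: "linear_iso (fib C2 x) (fib C z) J2"
    unfolding fib by (intro transport_iso L.M inj_on_subset[OF J2_inj sub])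
  have "linear_iso (fib C2 x) (fib CV z) (\<Phi> \<circ> J2)"
    unfolding right(2) by (rule L.cong_map) (use sub \<Phi>_J2 in auto)
  then show ?thesis by (intro linear_iso.is_linear_map linear_iso.cancel[OF T])
qed

lemma clifford_diffeomorphic: "bundle_diffeomorphic C CV"
proof -
  have base: "base C = base V" "base CV = base V"
    by (simp_all add: glue_bundle_simps clifford_bundle_simps)
  have "diffeomorphism (total C) (total CV) \<Phi>"
    using \<Phi>_bij \<Phi>_smooth \<Phi>_inverse_smooth by (simp add: diffeomorphism_def)
  then show ?thesis
    unfolding bundle_diffeomorphic_def base using \<Phi>_proj \<Phi>_linear by blast
qed

end

theorem theorem5p4:
  fixes V1 :: "('x1, 'v1) pbundle" and V2 :: "('x2, 'v2) pbundle"
    and Y :: "'x1 set" and f :: "'x1 \<Rightarrow> 'x2" and ft :: "'v1 \<Rightarrow> 'v2"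
    and g1 :: "'x1 \<Rightarrow> 'v1 \<Rightarrow> 'v1 \<Rightarrow> real" and g2 :: "'x2 \<Rightarrow> 'v2 \<Rightarrow> 'v2 \<Rightarrow> real"
    and F :: "'x1 \<times> (nat \<Rightarrow> ('v1 list \<Rightarrow> real) set) set \<Rightarrow>
              'x2 \<times> (nat \<Rightarrow> ('v2 list \<Rightarrow> real) set) set"
  assumes "pseudo_bundle V1" and "finite_dimensional V1"
    and "pseudo_bundle V2" and "finite_dimensional V2"
    and "gluing V1 V2 Y f ft"
    and "diffeomorphism (sub_dspace (total V1) (over V1 Y))
           (sub_dspace (total V2) (over V2 (f ` Y))) ft"
    and "pseudo_metric V1 g1" and "pseudo_metric V2 g2"
    and "compatible_metrics V1 Y f ft g1 g2"
    and "clifford_induced V1 V2 Y f ft g1 g2 F"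
  shows "bundle_diffeomorphic
           (glue_bundle (clifford_bundle V1 g1) (clifford_bundle V2 g2) Y f F)
           (clifford_bundle (glue_bundle V1 V2 Y f ft) (glue_metric V1 V2 Y f ft g1 g2))"
proof -
  interpret glued_clifford V1 V2 Y f ft g1 g2 F
    by (intro glued_clifford.intro glued_bundles.intro glued_clifford_axioms.intro assms)
  show ?thesis by (rule clifford_diffeomorphic)
qed

end
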